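(* Let $U\subset D(A^\infty)$ be a nonempty open set on which the distribution $D_{LA}$ has constant dimension $k_D\in\mathbb{N}$. Then $k_D>d$ and $$\mu(h)\notin\langle\sigma^1(h),\dots,\sigma^d(h)\rangle\quad\text{for all }h\in U.$$ Moreover, for every $h_0\in U$ there exist an open neighborhood $V$ of $h_0$ and Banach maps $X^{d+1},\dots,X^{k_D-1}$ on $V$ such that $\{\mu,\sigma^1,\dots,\sigma^d,X^{d+1},\dots,X^{k_D-1}\}$ is a basis for $D_{LA}$ on $V$ (i.e. their values at $h$ form a basis of $D_{LA}(h)$ for every $h\in V$).
   Context: Smoothness: a curve into a Fréchet space is smooth if all derivatives exist as limits of difference quotients; a map between open subsets of Fréchet spaces is smooth if it maps smooth curves to smooth curves. A smooth map $P:U\subset E\to E$, $U$ open in a Fréchet space $E$, is a Banach map if there are a Banach space $X$, an open set $V\subset X$ and smooth (not necessarily linear) maps $R:U\to X$ with $R(U)\subset V$ and $Q:V\to E$ such that $P=Q\circ R$. The Lie bracket of vector fields (smooth maps $U\to E$) is $[X,Y](x)=DX(x)\cdot Y(x)-DY(x)\cdot X(x)$. $\langle\dots\rangle$ denotes real linear span. Setting: $H$ is a separable Hilbert space of continuous functions $\mathbb{R}_{\ge0}\to\mathbb{R}$ such that: the point evaluations $ev_x:h\mapsto h(x)$ are continuous on $H$; the shifts $S(t)f(x)=f(t+x)$, $t\ge 0$, form a strongly continuous semigroup on $H$, with generator $A$, where $D(A)=\{h\in H\cap C^1(\mathbb{R}_{\ge0};\mathbb{R}) : h'\in H\}$ and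 $Ah=h'$; there is a closed subspace $H_0\subset H$ such that $\mathcal{S}(f,g)(x):=f(x)\int_0^x g(\eta)\,d\eta$ defines a continuous bilinear map $\mathcal{S}:H_0\times H_0\to H$. Write $\mathcal{S}(f)=\mathcal{S}(f,f)$. $D(A^\infty)=\bigcap_n D(A^n)$ is the Fréchet space with seminorms $p_n(h)=\sum_{m=0}^n\|A^mh\|_H$, $n\ge0$. $A_0$ is the restriction of $A$ to $H_0$, $D(A_0)=\{h\in D(A)\cap H_0: Ah\in H_0\}$, and $D(A_0^\infty)=\bigcap_n D(A_0^n)$ is the analogous Fréchet space. Let $d\in\mathbb{N}$, $d\ge1$, $B$ a Banach space, $\ell:H\to B$ continuous linear, $\phi=(\phi^1,\dots,\phi^d):B\to D(A_0^\infty)^d$ smooth, and assume: $(\ell,\ell\circ A):D(A^\infty)\to B\times B$ is an open map; $\phi^1(y),\dots,\phi^d(y)$ are linearly independent for each $y\in B$; $A$ is unbounded, i.e. $D(A)\ne H$. Put $\sigma^j(h)=\phi^j(\ell(h))$ and $$\mu(h)=Ah+\sum_{j=1}^d\mathcal{S}(\sigma^j(h))-\tfrac12\sum_{j=1}^dD\sigma^j(h)\sigma^j(h),\qquad h\in D(A^\infty).$$ These are smooth vector fields on $D(A^\infty)$. $D_{LA}$ is the distribution on $D(A^\infty)$ whose value $D_{LA}(h)$ is the linear span of the values at $h$ of $\mu,\sigma^1,\dots,\sigma^d$ and all their iterated (multiple) Lie brackets. *)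

theory Defs
  imports "HOL-Analysis.Analysis"
begin

(* A linear subspace of an ambient real vector space with a countable family of seminorms.
   Frechet spaces and Banach spaces (constant family) are both presented in this form. *)

record 'a seminormed_space =
  points :: "'a set"
  seminorm :: "nat \<Rightarrow> 'a \<Rightarrow> real"

definition seminorm_open :: "'a::real_vector seminormed_space \<Rightarrow> 'a set \<Rightarrow> bool" where
  "seminorm_open E U \<longleftrightarrow> U \<subseteq> points E \<and>
     (\<forall>x\<in>U. \<exists>N. \<exists>\<epsilon>>0. \<forall>y\<in>points E. (\<forall>n\<le>N. seminorm E n (y - x) < \<epsilon>) \<longrightarrow> y \<in> U)"

definition seminorm_topology :: "'a::real_vector seminormed_space \<Rightarrow> 'a topology" where
  "seminorm_topology E = topology (seminorm_open E)"

lemma istopology_seminorm_open: "istopology (seminorm_open E)"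
  unfolding istopology_def
proof (intro conjI allI impI)
  fix S T assume S: "seminorm_open E S" and T: "seminorm_open E T"
  show "seminorm_open E (S \<inter> T)"
    unfolding seminorm_open_def
  proof (intro conjI ballI)
    show "S \<inter> T \<subseteq> points E" using S by (auto simp: seminorm_open_def)
    fix x assume x: "x \<in> S \<inter> T"
    obtain N e where e: "e > 0"
      "\<And>y. y \<in> points E \<Longrightarrow> \<forall>n\<le>N. seminorm E n (y - x) < e \<Longrightarrow> y \<in> S"
      using S x unfolding seminorm_open_def by blast
    obtain M r where r: "r > 0"
      "\<And>y. y \<in> points E \<Longrightarrow> \<forall>n\<le>M. seminorm E n (y - x) < r \<Longrightarrow> y \<in> T"
      using T x unfolding seminorm_open_def by blast
    have "\<forall>y\<in>points E. (\<forall>n\<le>max N M. seminorm E n (y - x) < min e r) \<longrightarrow> y \<in> S \<inter> T"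
      using e(2) r(2) by simp
    moreover have "min e r > 0" using e(1) r(1) by simp
    ultimately show "\<exists>N. \<exists>\<epsilon>>0. \<forall>y\<in>points E. (\<forall>n\<le>N. seminorm E n (y - x) < \<epsilon>) \<longrightarrow> y \<in> S \<inter> T"
      by blast
  qed
next
  fix K assume "\<forall>S\<in>K. seminorm_open E S"
  then show "seminorm_open E (\<Union>K)"
    unfolding seminorm_open_def by (meson Sup_least UnionE UnionI)
qed

lemma openin_seminorm_topology: "openin (seminorm_topology E) U \<longleftrightarrow> seminorm_open E U"
  unfolding seminorm_topology_def by (simp add: istopology_seminorm_open)

lemma topspace_seminorm_topology: "topspace (seminorm_topology E) = points E"
proof
  show "topspace (seminorm_topology E) \<subseteq> points E"
    unfolding topspace_def by (auto simp: openin_seminorm_topology seminorm_open_def)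
  have "openin (seminorm_topology E) (points E)"
    unfolding openin_seminorm_topology seminorm_open_def by (auto intro: exI[of _ 1])
  then show "points E \<subseteq> topspace (seminorm_topology E)"
    by (rule openin_subset)
qed

definition has_curve_derivative ::
  "'a::real_vector seminormed_space \<Rightarrow> (real \<Rightarrow> 'a) \<Rightarrow> 'a \<Rightarrow> real \<Rightarrow> bool" where
  "has_curve_derivative E c l t \<longleftrightarrow> l \<in> points E \<and>
     (\<forall>n. ((\<lambda>s. seminorm E n ((1 / (s - t)) *\<^sub>R (c s - c t) - l)) \<longlongrightarrow> 0) (at t))"

definition smooth_curve :: "'a::real_vector seminormed_space \<Rightarrow> (real \<Rightarrow> 'a) \<Rightarrow> bool" where
  "smooth_curve E c \<longleftrightarrow> (\<exists>D. D 0 = c \<and> (\<forall>k t. D k t \<in> points E) \<and>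
     (\<forall>k t. has_curve_derivative E (D k) (D (Suc k) t) t))"

definition smooth_map :: "'a::real_vector seminormed_space \<Rightarrow> 'a set \<Rightarrow>
    'c::real_vector seminormed_space \<Rightarrow> ('a \<Rightarrow> 'c) \<Rightarrow> bool" where
  "smooth_map E U F f \<longleftrightarrow> openin (seminorm_topology E) U \<and> f ` U \<subseteq> points F \<and>
     (\<forall>c. smooth_curve E c \<and> range c \<subseteq> U \<longrightarrow> smooth_curve F (f \<circ> c))"

(* The derivative Df(x).v of a map with values in F. *)
definition dir_deriv :: "'c::real_vector seminormed_space \<Rightarrow> ('a::real_vector \<Rightarrow> 'c) \<Rightarrow> 'a \<Rightarrow> 'a \<Rightarrow> 'c" where
  "dir_deriv F f x v = (THE l. has_curve_derivative F (\<lambda>t. f (x + t *\<^sub>R v)) l 0)"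

definition lie_bracket :: "'a::real_vector seminormed_space \<Rightarrow> ('a \<Rightarrow> 'a) \<Rightarrow> ('a \<Rightarrow> 'a) \<Rightarrow> 'a \<Rightarrow> 'a" where
  "lie_bracket E X Y x = dir_deriv E X x (Y x) - dir_deriv E Y x (X x)"

inductive_set iterated_brackets ::
  "'a::real_vector seminormed_space \<Rightarrow> ('a \<Rightarrow> 'a) set \<Rightarrow> ('a \<Rightarrow> 'a) set"
  for E G where
  generator: "X \<in> G \<Longrightarrow> X \<in> iterated_brackets E G"
| bracket: "X \<in> iterated_brackets E G \<Longrightarrow> Y \<in> iterated_brackets E G \<Longrightarrow>
    lie_bracket E X Y \<in> iterated_brackets E G"

definition normed_space_on :: "'a set \<Rightarrow> ('a \<Rightarrow> real) \<Rightarrow> 'a seminormed_space" where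
  "normed_space_on X N = \<lparr>points = X, seminorm = (\<lambda>_. N)\<rparr>"

definition banach_norm_on :: "'a::real_vector set \<Rightarrow> ('a \<Rightarrow> real) \<Rightarrow> bool" where
  "banach_norm_on X N \<longleftrightarrow> subspace X \<and>
     (\<forall>x\<in>X. N x \<ge> 0 \<and> (N x = 0 \<longleftrightarrow> x = 0)) \<and>
     (\<forall>x\<in>X. \<forall>y\<in>X. N (x + y) \<le> N x + N y) \<and>
     (\<forall>a. \<forall>x\<in>X. N (a *\<^sub>R x) = \<bar>a\<bar> * N x) \<and>
     (\<forall>s. range s \<subseteq> X \<and> (\<forall>\<epsilon>>0. \<exists>M. \<forall>m\<ge>M. \<forall>n\<ge>M. N (s m - s n) < \<epsilon>) \<longrightarrow>
        (\<exists>x\<in>X. (\<lambda>n. N (s n - x)) \<longlonglongrightarrow> 0))"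

(* Types cannot be quantified existentially, so the Banach space X ranges over all linear
   subspaces of an ambient vector space 'x, each carrying an arbitrary complete norm of its own.
   Only the linear dimension of 'x matters: any Banach space whose algebraic dimension is at most
   that of 'x is linearly isomorphic to such an X. If E is separable, X may be replaced by the
   closed linear span of the image of R, so an ambient space of dimension at least the continuum,
   such as the bounded sequences nat \<Rightarrow>\<^sub>C (real \<times> 'b), loses no generality. *)
definition banach_map :: "'x::real_vector itself \<Rightarrow> 'a::real_vector seminormed_space \<Rightarrow>
    'a set \<Rightarrow> ('a \<Rightarrow> 'a) \<Rightarrow> bool" where
  "banach_map _ E U P \<longleftrightarrow> smooth_map E U E P \<and>
     (\<exists>(X::'x set) N V R Q. banach_norm_on X N \<and>
        openin (seminorm_topology (normed_space_on X N)) V \<and>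
        smooth_map E U (normed_space_on X N) R \<and> R ` U \<subseteq> V \<and>
        smooth_map (normed_space_on X N) V E Q \<and>
        (\<forall>x\<in>U. P x = Q (R x)))"

(* Members of the family indexed by I are counted with repetition, hence injectivity. *)
definition lin_indep_family :: "'i set \<Rightarrow> ('i \<Rightarrow> 'a::real_vector) \<Rightarrow> bool" where
  "lin_indep_family I b \<longleftrightarrow> inj_on b I \<and> independent (b ` I)"

definition basis_family :: "'i set \<Rightarrow> ('i \<Rightarrow> 'a::real_vector) \<Rightarrow> 'a set \<Rightarrow> bool" where
  "basis_family I b S \<longleftrightarrow> lin_indep_family I b \<and> span (b ` I) = S"

(* Unlike dim S = k, this excludes infinite-dimensional S for k = 0. *)
definition has_dimension :: "'a::real_vector set \<Rightarrow> nat \<Rightarrow> bool" where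
  "has_dimension S k \<longleftrightarrow> (\<exists>B. finite B \<and> card B = k \<and> independent B \<and> span B = S)"

definition c0_semigroup :: "(real \<Rightarrow> 'h::real_normed_vector \<Rightarrow> 'h) \<Rightarrow> bool" where
  "c0_semigroup T \<longleftrightarrow> (\<forall>t\<ge>0. bounded_linear (T t)) \<and> (\<forall>h. T 0 h = h) \<and>
     (\<forall>s\<ge>0. \<forall>t\<ge>0. \<forall>h. T (s + t) h = T s (T t h)) \<and>
     (\<forall>h. ((\<lambda>t. T t h) \<longlongrightarrow> h) (at_right 0))"

definition gen_domain :: "(real \<Rightarrow> 'h::real_normed_vector \<Rightarrow> 'h) \<Rightarrow> 'h set" where
  "gen_domain T = {h. \<exists>k. ((\<lambda>t. (1 / t) *\<^sub>R (T t h - h)) \<longlongrightarrow> k) (at_right 0)}"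

definition gen :: "(real \<Rightarrow> 'h::real_normed_vector \<Rightarrow> 'h) \<Rightarrow> 'h \<Rightarrow> 'h" where
  "gen T h = Lim (at_right 0) (\<lambda>t. (1 / t) *\<^sub>R (T t h - h))"

(* Domain of the n-th power of the operator A with domain D acting in the space X. *)
fun dom_pow :: "'h set \<Rightarrow> 'h set \<Rightarrow> ('h \<Rightarrow> 'h) \<Rightarrow> nat \<Rightarrow> 'h set" where
  "dom_pow X D A 0 = X"
| "dom_pow X D A (Suc n) = {h \<in> D. A h \<in> dom_pow X D A n}"

definition smooth_domain ::
  "'h::real_normed_vector set \<Rightarrow> 'h set \<Rightarrow> ('h \<Rightarrow> 'h) \<Rightarrow> 'h seminormed_space" where
  "smooth_domain X D A =
     \<lparr>points = (\<Inter>n. dom_pow X D A n), seminorm = (\<lambda>n h. \<Sum>m\<le>n. norm ((A ^^ m) h))\<rparr>"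

(* A Hilbert space of functions on the half line is given by an abstract Hilbert space 'h
   together with an evaluation ev; ev h x is only meaningful for x >= 0. A function u belongs to
   the space iff in_space ev u, and elem ev u is then the corresponding element. *)
definition in_space :: "('h \<Rightarrow> real \<Rightarrow> real) \<Rightarrow> (real \<Rightarrow> real) \<Rightarrow> bool" where
  "in_space ev u \<longleftrightarrow> (\<exists>h. \<forall>x\<ge>0. ev h x = u x)"

definition elem :: "('h \<Rightarrow> real \<Rightarrow> real) \<Rightarrow> (real \<Rightarrow> real) \<Rightarrow> 'h" where
  "elem ev u = (THE h. \<forall>x\<ge>0. ev h x = u x)"

definition shift :: "('h \<Rightarrow> real \<Rightarrow> real) \<Rightarrow> real \<Rightarrow> 'h \<Rightarrow> 'h" where
  "shift ev t h = elem ev (\<lambda>x. ev h (t + x))"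

abbreviation domA :: "('h::real_normed_vector \<Rightarrow> real \<Rightarrow> real) \<Rightarrow> 'h set" where
  "domA ev \<equiv> gen_domain (shift ev)"

abbreviation opA :: "('h::real_normed_vector \<Rightarrow> real \<Rightarrow> real) \<Rightarrow> 'h \<Rightarrow> 'h" where
  "opA ev \<equiv> gen (shift ev)"

definition DA_inf :: "('h::real_normed_vector \<Rightarrow> real \<Rightarrow> real) \<Rightarrow> 'h seminormed_space" where
  "DA_inf ev = smooth_domain UNIV (domA ev) (opA ev)"

definition DA0_inf :: "('h::real_normed_vector \<Rightarrow> real \<Rightarrow> real) \<Rightarrow> 'h set \<Rightarrow> 'h seminormed_space" where
  "DA0_inf ev H0 = smooth_domain H0 {h \<in> domA ev \<inter> H0. opA ev h \<in> H0} (opA ev)"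

definition sprod_fun :: "('h \<Rightarrow> real \<Rightarrow> real) \<Rightarrow> 'h \<Rightarrow> 'h \<Rightarrow> real \<Rightarrow> real" where
  "sprod_fun ev f g x = ev f x * integral {0..x} (ev g)"

definition sprod :: "('h \<Rightarrow> real \<Rightarrow> real) \<Rightarrow> 'h \<Rightarrow> 'h \<Rightarrow> 'h" where
  "sprod ev f g = elem ev (sprod_fun ev f g)"

(* In the description of the domain of the generator, the derivative is again an element of
   the space and hence continuous, so differentiability on the half line amounts to C^1.
   Bilinearity of sprod is automatic from its pointwise formula. *)
locale forward_curve_space =
  fixes ev :: "'h::{real_inner, complete_space} \<Rightarrow> real \<Rightarrow> real"
    and H0 :: "'h set"
  assumes separable: "\<exists>D::'h set. countable D \<and> closure D = UNIV"
    and ev_bounded_linear: "\<And>x. x \<ge> 0 \<Longrightarrow> bounded_linear (\<lambda>h. ev h x)"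
    and ev_inject: "\<And>f g. (\<And>x. x \<ge> 0 \<Longrightarrow> ev f x = ev g x) \<Longrightarrow> f = g"
    and ev_continuous: "\<And>h. continuous_on {0..} (ev h)"
    and shift_in_space: "\<And>t h. t \<ge> 0 \<Longrightarrow> in_space ev (\<lambda>x. ev h (t + x))"
    and shift_semigroup: "c0_semigroup (shift ev)"
    and domain_generator: "domA ev =
      {h. \<exists>k. \<forall>x\<ge>0. (ev h has_real_derivative ev k x) (at x within {0..})}"
    and generator_derivative: "\<And>h x. h \<in> domA ev \<Longrightarrow> x \<ge> 0 \<Longrightarrow>
      (ev h has_real_derivative ev (opA ev h) x) (at x within {0..})"
    and H0_subspace: "subspace H0"
    and H0_closed: "closed H0"
    and sprod_in_space: "\<And>f g. f \<in> H0 \<Longrightarrow> g \<in> H0 \<Longrightarrow> in_space ev (sprod_fun ev f g)"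
    and sprod_continuous: "continuous_on (H0 \<times> H0) (\<lambda>(f, g). sprod ev f g)"

(* The map phi into the d-fold product is given by its components phi j, 1 <= j <= d; a curve
   into a finite product is smooth iff its components are. *)
definition vol :: "('h \<Rightarrow> 'b) \<Rightarrow> (nat \<Rightarrow> 'b \<Rightarrow> 'h) \<Rightarrow> nat \<Rightarrow> 'h \<Rightarrow> 'h" where
  "vol l \<phi> j h = \<phi> j (l h)"

definition drift :: "('h::real_normed_vector \<Rightarrow> real \<Rightarrow> real) \<Rightarrow> ('h \<Rightarrow> 'b) \<Rightarrow> nat \<Rightarrow>
    (nat \<Rightarrow> 'b \<Rightarrow> 'h) \<Rightarrow> 'h \<Rightarrow> 'h" where
  "drift ev l d \<phi> h = opA ev h
     + (\<Sum>j\<in>{1..d}. sprod ev (vol l \<phi> j h) (vol l \<phi> j h))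
     - (1/2) *\<^sub>R (\<Sum>j\<in>{1..d}. dir_deriv (DA_inf ev) (vol l \<phi> j) h (vol l \<phi> j h))"

definition D_LA :: "('h::real_normed_vector \<Rightarrow> real \<Rightarrow> real) \<Rightarrow> ('h \<Rightarrow> 'b) \<Rightarrow> nat \<Rightarrow>
    (nat \<Rightarrow> 'b \<Rightarrow> 'h) \<Rightarrow> 'h \<Rightarrow> 'h set" where
  "D_LA ev l d \<phi> h = span ((\<lambda>X. X h) `
     iterated_brackets (DA_inf ev) (insert (drift ev l d \<phi>) (vol l \<phi> ` {1..d})))"

end

theory Submission
  imports Defs
begin

text \<open>Call \<open>P\<close> a jet field if \<open>P h = r A h + Q (l h, l (A h), \<dots>, l (A\<^sup>N h))\<close> with \<open>Q\<close> smooth. The drift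
  (\<open>r = 1\<close>) and the volatilities (\<open>r = 0\<close>) are jet fields, and in a bracket of two jet fields the terms
  \<open>A\<^sup>2 h\<close> cancel; so every iterated bracket except the drift itself is a Banach map, and linear
  independence of such fields at a point persists nearby. Suppose the drift lay in the span of the
  volatilities at \<open>h0\<close>. Then Banach maps \<open>P\<^sub>i\<close> form a basis of the distribution near \<open>h0\<close>, and the drift is
  a combination of them. Differentiating this relation at \<open>h0\<close> in the direction \<open>h\<close> writes \<open>A h\<close> as a
  function of a finite jet of \<open>h\<close> plus an element of the span of the \<open>P\<^sub>i h0\<close>, which bounds
  \<open>\<parallel>A\<^sup>n\<^sup>+\<^sup>1 h\<parallel>\<close> by the \<open>n\<close>-th seminorm of \<open>h\<close> for some \<open>n\<close>. By interpolation \<open>A\<close> is then bounded on the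
  dense subspace \<open>D(A\<^sup>\<infinity>)\<close>, hence everywhere defined.

  The calculus rests on a form of Boman's theorem. If a map preserves smooth curves, its derivatives
  along lines are locally bounded, since otherwise a smooth curve running through short pieces of
  bad lines would have a non-smooth image. Mixed differences are combinations of differences along
  lines, so they are bounded by the product of the steps; this passes to directional derivatives,
  which therefore preserve smooth curves again.\<close>

section \<open>Smooth curves in normed spaces\<close>

text \<open>Smoothness is tested on curves only, so the directional derivatives in a bracket come
  with no continuity, and their preserving smooth curves has to be extracted from the curves. Maps
  into D(A^\<infinity>) are treated one power of \<open>A\<close> at a time in \<open>H\<close>, as
  \<open>A\<close> is closed. The coefficients in drift = sum of c_i P_i depend on the point and
  have no known regularity, so they are frozen at \<open>h0\<close>. The remainder drift - sum of
  c_i P_i vanishes at \<open>h0\<close> and stays in the moving span of the P_i, hence so do its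
  difference quotients; their limit lies in the span at \<open>h0\<close>, since independence is
  stable with uniform bounds on coefficients. The gain of one derivative is a smoothing effect: Q
  takes values in D(A^\<infinity>), so any power of \<open>A\<close> applied to its derivative is
  bounded by a jet of one fixed order, and n is taken above all these orders. This works for the P_i
  because none of them contains a term \<open>A h\<close>; if the drift lies in the span of the
  volatilities at \<open>h0\<close>, such fields span the distribution at \<open>h0\<close>, and
  constant dimension carries this to a neighborhood.\<close>

lemma has_vector_derivative_iff_quotient:
  "(f has_vector_derivative l) (at t) \<longleftrightarrow> ((\<lambda>s. (1 / (s - t)) *\<^sub>R (f s - f t)) \<longlongrightarrow> l) (at t)"
proof -
  have *: "norm ((f s - f t - (s - t) *\<^sub>R l) /\<^sub>R norm (s - t)) = norm ((1 / (s - t)) *\<^sub>R (f s - f t) - l)"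
    if "s \<noteq> t" for s
  proof -
    have "(1 / (s - t)) *\<^sub>R (f s - f t) - l = (1 / (s - t)) *\<^sub>R (f s - f t - (s - t) *\<^sub>R l)"
      using that by (simp add: scaleR_diff_right)
    then show ?thesis by (simp add: divide_inverse)
  qed
  have "(f has_vector_derivative l) (at t) \<longleftrightarrow>
     ((\<lambda>s. (f s - f t - (s - t) *\<^sub>R l) /\<^sub>R norm (s - t)) \<longlongrightarrow> 0) (at t)"
    by (simp add: has_vector_derivative_def has_derivative_within bounded_linear_scaleR_left
        divide_inverse diff_diff_eq)
  also have "\<dots> \<longleftrightarrow> ((\<lambda>s. norm ((f s - f t - (s - t) *\<^sub>R l) /\<^sub>R norm (s - t))) \<longlongrightarrow> 0) (at t)"
    by (simp only: tendsto_norm_zero_iff)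
  also have "\<dots> \<longleftrightarrow> ((\<lambda>s. norm ((1 / (s - t)) *\<^sub>R (f s - f t) - l)) \<longlongrightarrow> 0) (at t)"
    by (rule filterlim_cong[OF refl refl]) (simp only: eventually_at_filter, intro always_eventually allI impI *)
  also have "\<dots> \<longleftrightarrow> ((\<lambda>s. (1 / (s - t)) *\<^sub>R (f s - f t)) \<longlongrightarrow> l) (at t)"
    by (simp only: tendsto_norm_zero_iff Lim_null[symmetric])
  finally show ?thesis .
qed

text \<open>Counting orders of differentiability makes the rules for sums, products and compositions
  plain inductions on the order.\<close>

primrec diff_times :: "nat \<Rightarrow> (real \<Rightarrow> 'a::real_normed_vector) \<Rightarrow> bool" where
  "diff_times 0 c \<longleftrightarrow> True"
| "diff_times (Suc k) c \<longleftrightarrow>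
    (\<exists>c'. (\<forall>t. (c has_vector_derivative c' t) (at t)) \<and> diff_times k c')"

lemma diff_times_SucI:
  "(\<And>t. (c has_vector_derivative c' t) (at t)) \<Longrightarrow> diff_times k c' \<Longrightarrow> diff_times (Suc k) c"
  by auto

definition csmooth :: "(real \<Rightarrow> 'a::real_normed_vector) \<Rightarrow> bool" where
  "csmooth c \<longleftrightarrow> (\<forall>k. diff_times k c)"

definition curve_deriv :: "(real \<Rightarrow> 'a::real_normed_vector) \<Rightarrow> real \<Rightarrow> 'a" where
  "curve_deriv c t = vector_derivative c (at t)"

lemma curve_deriv_eq: "(\<And>t. (c has_vector_derivative c' t) (at t)) \<Longrightarrow> curve_deriv c = c'"
  by (auto simp: curve_deriv_def fun_eq_iff intro: vector_derivative_at)

lemma csmoothI: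
  assumes "\<And>t. (c has_vector_derivative c' t) (at t)" "csmooth c'"
  shows "csmooth c"
  unfolding csmooth_def
proof
  fix k show "diff_times k c" using assms by (cases k) (auto simp: csmooth_def)
qed

lemma csmooth_deriv:
  assumes "csmooth c"
  shows "(c has_vector_derivative curve_deriv c t) (at t)" "csmooth (curve_deriv c)"
proof -
  have ex: "\<exists>c'. (\<forall>t. (c has_vector_derivative c' t) (at t)) \<and> diff_times k c'" for k
    using assms unfolding csmooth_def by (metis diff_times.simps(2))
  have *: "(c has_vector_derivative curve_deriv c t) (at t)" for t
    using ex[of 0] curve_deriv_eq by metis
  then show "(c has_vector_derivative curve_deriv c t) (at t)" .
  show "csmooth (curve_deriv c)"
    unfolding csmooth_def using ex curve_deriv_eq by metis
qed

text \<open>For curves whose derivatives have no closed formula: a class of curves stable under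
  differentiation suffices.\<close>

lemma csmooth_coinduct:
  assumes "P c" and "\<And>c. P c \<Longrightarrow> \<exists>c'. (\<forall>t. (c has_vector_derivative c' t) (at t)) \<and> P c'"
  shows "csmooth c"
proof -
  have "P c \<Longrightarrow> diff_times k c" for k c
  proof (induction k arbitrary: c)
    case (Suc k) then show ?case using assms(2)[of c] by auto
  qed simp
  then show ?thesis using assms(1) by (auto simp: csmooth_def)
qed

lemma csmooth_funpow: "csmooth c \<Longrightarrow> csmooth ((curve_deriv ^^ k) c)"
  by (induction k) (auto intro: csmooth_deriv(2))

lemma csmooth_funpow_deriv:
  "csmooth c \<Longrightarrow> ((curve_deriv ^^ k) c has_vector_derivative (curve_deriv ^^ Suc k) c t) (at t)"
  using csmooth_deriv(1)[OF csmooth_funpow, of c k t] by simp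

text \<open>The form used by \<open>smooth_curve\<close>, which asks for the whole sequence of
  derivatives at once.\<close>

lemma csmooth_iff_sequence:
  "csmooth c \<longleftrightarrow> (\<exists>D. D 0 = c \<and> (\<forall>k t. (D k has_vector_derivative D (Suc k) t) (at t)))"
proof
  assume "csmooth c"
  then show "\<exists>D. D 0 = c \<and> (\<forall>k t. (D k has_vector_derivative D (Suc k) t) (at t))"
    using csmooth_funpow_deriv by (intro exI[of _ "\<lambda>k. (curve_deriv ^^ k) c"]) auto
next
  assume "\<exists>D. D 0 = c \<and> (\<forall>k t. (D k has_vector_derivative D (Suc k) t) (at t))"
  then obtain D where D: "D 0 = c" "\<And>k t. (D k has_vector_derivative D (Suc k) t) (at t)" by blast
  show "csmooth c"
    by (rule csmooth_coinduct[of "\<lambda>c. \<exists>k. c = D k"]) (use D in blast)+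
qed

lemma curve_deriv_funpow_eq:
  assumes "\<And>k t. (D k has_vector_derivative D (Suc k) t) (at t)"
  shows "(curve_deriv ^^ k) (D 0) = D k"
  by (induction k) (use curve_deriv_eq assms in auto)

lemma csmooth_continuous: "csmooth c \<Longrightarrow> isCont c t"
  using csmooth_deriv(1) has_vector_derivative_continuous by blast

lemma csmooth_zero: "csmooth (\<lambda>_. 0)"
  by (rule csmooth_coinduct[of "\<lambda>c. c = (\<lambda>_. 0)"]) (auto intro!: exI[of _ "\<lambda>_. 0"])

lemma csmooth_const [simp]: "csmooth (\<lambda>_. a)"
  by (rule csmoothI[of _ "\<lambda>_. 0"]) (auto intro: csmooth_zero)

lemma csmooth_ident [simp]: "csmooth (\<lambda>t::real. t)"
  by (rule csmoothI[of _ "\<lambda>_. 1"]) auto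

lemma diff_times_add: "diff_times k f \<Longrightarrow> diff_times k g \<Longrightarrow> diff_times k (\<lambda>t. f t + g t)"
proof (induction k arbitrary: f g)
  case (Suc k)
  then obtain f' g' where "\<And>t. (f has_vector_derivative f' t) (at t)" "diff_times k f'"
    "\<And>t. (g has_vector_derivative g' t) (at t)" "diff_times k g'" by auto
  then show ?case
    using Suc.IH by (intro diff_times_SucI[where c' = "\<lambda>t. f' t + g' t"] has_vector_derivative_add)
qed simp

lemma csmooth_add: "csmooth f \<Longrightarrow> csmooth g \<Longrightarrow> csmooth (\<lambda>t. f t + g t)"
  by (simp add: csmooth_def diff_times_add)

lemma (in bounded_linear) diff_times: "diff_times k c \<Longrightarrow> diff_times k (\<lambda>t. f (c t))"
proof (induction k arbitrary: c)
  case (Suc k)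
  then obtain c' where c': "\<And>t. (c has_vector_derivative c' t) (at t)" "diff_times k c'" by auto
  show ?case by (rule diff_times_SucI[OF has_vector_derivative[OF c'(1)] Suc.IH[OF c'(2)]])
qed simp

lemma (in bounded_linear) csmooth: "csmooth c \<Longrightarrow> csmooth (\<lambda>t. f (c t))"
  by (simp add: csmooth_def diff_times)

lemmas csmooth_scaleR_right = bounded_linear.csmooth[OF bounded_linear_scaleR_right]

lemma csmooth_minus: "csmooth f \<Longrightarrow> csmooth (\<lambda>t. - f t)"
  using csmooth_scaleR_right[of f "-1"] by simp

lemma csmooth_diff: "csmooth f \<Longrightarrow> csmooth g \<Longrightarrow> csmooth (\<lambda>t. f t - g t)"
  using csmooth_add[OF _ csmooth_minus, of f g] by simp

lemma csmooth_sum: "(\<And>i. i \<in> I \<Longrightarrow> csmooth (f i)) \<Longrightarrow> csmooth (\<lambda>t. \<Sum>i\<in>I. f i t)"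
  by (induction I rule: infinite_finite_induct) (auto intro: csmooth_add)

lemma diff_times_Suc: "diff_times (Suc k) c \<Longrightarrow> diff_times k c"
  by (induction k arbitrary: c) auto

lemma closed_subspace_derivative:
  assumes "closed S" "subspace S" "\<And>t. f t \<in> S" "(f has_vector_derivative l) (at t)"
  shows "l \<in> S"
proof (rule Lim_in_closed_set[OF assms(1)])
  show "((\<lambda>s. (1 / (s - t)) *\<^sub>R (f s - f t)) \<longlongrightarrow> l) (at t)"
    using assms(4) by (simp add: has_vector_derivative_iff_quotient)
qed (use assms in \<open>auto intro!: always_eventually subspace_scale subspace_diff\<close>)

text \<open>Covers scalar multiplication and also \<open>sprod\<close>, which is bilinear and
  continuous on \<open>H0\<close> only. Closedness keeps the derivatives of the factors inside the
  subspaces.\<close>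

locale subspace_bilinear =
  fixes S :: "'a::real_normed_vector set" and T :: "'b::real_normed_vector set"
    and B :: "'a \<Rightarrow> 'b \<Rightarrow> 'c::real_normed_vector"
  assumes S: "closed S" "subspace S" and T: "closed T" "subspace T"
    and cont: "continuous_on (S \<times> T) (\<lambda>(x, y). B x y)"
    and add_left: "\<And>x x' y. x \<in> S \<Longrightarrow> x' \<in> S \<Longrightarrow> y \<in> T \<Longrightarrow> B (x + x') y = B x y + B x' y"
    and add_right: "\<And>x y y'. x \<in> S \<Longrightarrow> y \<in> T \<Longrightarrow> y' \<in> T \<Longrightarrow> B x (y + y') = B x y + B x y'"
    and scaleR_left: "\<And>r x y. x \<in> S \<Longrightarrow> y \<in> T \<Longrightarrow> B (r *\<^sub>R x) y = r *\<^sub>R B x y"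
    and scaleR_right: "\<And>r x y. x \<in> S \<Longrightarrow> y \<in> T \<Longrightarrow> B x (r *\<^sub>R y) = r *\<^sub>R B x y"
begin

lemma tendsto:
  assumes "(f \<longlongrightarrow> x) F" "(g \<longlongrightarrow> y) F" "\<And>t. f t \<in> S" "\<And>t. g t \<in> T" "x \<in> S" "y \<in> T"
  shows "((\<lambda>t. B (f t) (g t)) \<longlongrightarrow> B x y) F"
proof -
  have "((\<lambda>t. (\<lambda>(x, y). B x y) (f t, g t)) \<longlongrightarrow> (\<lambda>(x, y). B x y) (x, y)) F"
    by (rule continuous_on_tendsto_compose[OF cont tendsto_Pair[OF assms(1,2)]]) (use assms in auto)
  then show ?thesis by simp
qed

text \<open>The quotient of the product is \<open>B\<close> of the quotient of \<open>f\<close> with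
  \<open>g s\<close>, plus \<open>B\<close> of \<open>f t\<close> with the quotient of
  \<open>g\<close>. All arguments and their limits stay in the closed subspaces, where
  \<open>B\<close> is continuous.\<close>

lemma has_vector_derivative:
  assumes f: "(f has_vector_derivative f') (at t)" "\<And>t. f t \<in> S"
    and g: "(g has_vector_derivative g') (at t)" "\<And>t. g t \<in> T"
  shows "((\<lambda>t. B (f t) (g t)) has_vector_derivative B f' (g t) + B (f t) g') (at t)"
proof -
  have f': "f' \<in> S" and g': "g' \<in> T"
    using closed_subspace_derivative[OF S] closed_subspace_derivative[OF T] assms by blast+
  have gc: "(g \<longlongrightarrow> g t) (at t)"
    using has_vector_derivative_continuous[OF g(1)] by (simp add: continuous_within)
  have "((\<lambda>s. B ((1 / (s - t)) *\<^sub>R (f s - f t)) (g s) + B (f t) ((1 / (s - t)) *\<^sub>R (g s - g t)))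
      \<longlongrightarrow> B f' (g t) + B (f t) g') (at t)"
    using f g f' g' S T gc
    by (intro tendsto_add tendsto) (auto simp: has_vector_derivative_iff_quotient subspace_scale subspace_diff)
  moreover have "B ((1 / (s - t)) *\<^sub>R (f s - f t)) (g s) + B (f t) ((1 / (s - t)) *\<^sub>R (g s - g t))
      = (1 / (s - t)) *\<^sub>R (B (f s) (g s) - B (f t) (g t))" for s
  proof -
    have "B (f s - f t) (g s) + B (f t) (g s) = B (f s) (g s)"
      using add_left[of "f s - f t" "f t" "g s"] f g S by (simp add: subspace_diff)
    moreover have "B (f t) (g s - g t) + B (f t) (g t) = B (f t) (g s)"
      using add_right[of "f t" "g s - g t" "g t"] f g T by (simp add: subspace_diff)
    ultimately have "B (f s - f t) (g s) + B (f t) (g s - g t) = B (f s) (g s) - B (f t) (g t)"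
      by (simp add: algebra_simps) (metis add_diff_cancel_left' add_diff_eq add.commute)
    then show ?thesis
      using f g S T by (simp add: scaleR_left scaleR_right subspace_diff flip: scaleR_add_right)
  qed
  ultimately show ?thesis by (simp add: has_vector_derivative_iff_quotient)
qed

lemma diff_times:
  assumes "diff_times k f" "diff_times k g" "\<And>t. f t \<in> S" "\<And>t. g t \<in> T"
  shows "diff_times k (\<lambda>t. B (f t) (g t))"
  using assms
proof (induction k arbitrary: f g)
  case (Suc k)
  then obtain f' g' where f': "\<And>t. (f has_vector_derivative f' t) (at t)" "diff_times k f'"
    and g': "\<And>t. (g has_vector_derivative g' t) (at t)" "diff_times k g'" by auto
  have "f' t \<in> S" "g' t \<in> T" for t
    using closed_subspace_derivative[OF S] closed_subspace_derivative[OF T] Suc.prems f' g' by blast+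
  then have "diff_times k (\<lambda>t. B (f' t) (g t) + B (f t) (g' t))"
    using Suc.prems(3,4) f'(2) g'(2)
    by (intro diff_times_add Suc.IH diff_times_Suc[OF Suc.prems(1)] diff_times_Suc[OF Suc.prems(2)])
  then show ?case
    by (rule diff_times_SucI[OF has_vector_derivative[OF f'(1) Suc.prems(3) g'(1) Suc.prems(4)]])
qed simp

lemma csmooth:
  "csmooth f \<Longrightarrow> csmooth g \<Longrightarrow> (\<And>t. f t \<in> S) \<Longrightarrow> (\<And>t. g t \<in> T) \<Longrightarrow> csmooth (\<lambda>t. B (f t) (g t))"
  by (auto simp: csmooth_def intro: diff_times)

end

lemma subspace_bilinear_scaleR: "subspace_bilinear UNIV UNIV (\<lambda>r (x::'a::real_normed_vector). r *\<^sub>R x)"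
proof
  show "continuous_on (UNIV \<times> UNIV) (\<lambda>(r, x::'a). r *\<^sub>R x)"
    unfolding case_prod_unfold by (intro continuous_on_scaleR continuous_on_fst continuous_on_snd continuous_on_id)
qed (simp_all add: scaleR_add_left scaleR_add_right)

lemma csmooth_scaleR:
  "csmooth r \<Longrightarrow> csmooth f \<Longrightarrow> csmooth (\<lambda>t. r t *\<^sub>R (f t :: 'a::real_normed_vector))"
  by (rule subspace_bilinear.csmooth[OF subspace_bilinear_scaleR]) auto

text \<open>Each differentiation yields a factor r' and an outer curve c' of one order less, so the
  induction runs over the order of \<open>c\<close> with a fixed smooth \<open>r\<close>.\<close>

lemma csmooth_compose:
  assumes "csmooth c" "csmooth r" shows "csmooth (\<lambda>t. c (r t))"
proof -
  have "diff_times k (\<lambda>t. c (r t))" if "diff_times k c" for k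
    using that
  proof (induction k arbitrary: c)
    case (Suc k)
    then obtain c' where c': "\<And>t. (c has_vector_derivative c' t) (at t)" "diff_times k c'" by auto
    have "((\<lambda>t. c (r t)) has_vector_derivative curve_deriv r t *\<^sub>R c' (r t)) (at t)" for t
      using vector_diff_chain_at[OF csmooth_deriv(1)[OF assms(2)] c'(1)] by (simp add: o_def)
    moreover have "diff_times k (\<lambda>t. curve_deriv r t *\<^sub>R c' (r t))"
      using csmooth_deriv(2)[OF assms(2)] Suc.IH[OF c'(2)]
      by (intro subspace_bilinear.diff_times[OF subspace_bilinear_scaleR]) (auto simp: csmooth_def)
    ultimately show ?case by (rule diff_times_SucI)
  qed simp
  with assms show ?thesis by (simp add: csmooth_def)
qed

lemma csmooth_affine: "csmooth c \<Longrightarrow> csmooth (\<lambda>t. c (a * t + b))"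
  using csmooth_compose[of c "\<lambda>t. a * t + b"]
    csmooth_add[OF csmooth_scaleR_right[OF csmooth_ident, of a] csmooth_const, of b] by simp

lemma csmooth_mult: "csmooth r \<Longrightarrow> csmooth f \<Longrightarrow> csmooth (\<lambda>t. r t * (f t :: real))"
  using csmooth_scaleR[of r f] by simp

text \<open>The derivative is a polynomial in f' and 1/f, so order k for 1/f yields order k +
  1.\<close>

lemma csmooth_inverse:
  fixes f :: "real \<Rightarrow> real"
  assumes "csmooth f" "\<And>t. f t \<noteq> 0"
  shows "csmooth (\<lambda>t. inverse (f t))"
proof -
  have d: "((\<lambda>t. inverse (f t)) has_vector_derivative - curve_deriv f t * (inverse (f t) * inverse (f t))) (at t)" for t
    using DERIV_inverse_fun[of f "curve_deriv f t" t] csmooth_deriv(1)[OF assms(1), of t] assms(2)[of t]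
    by (simp add: has_real_derivative_iff_has_vector_derivative power2_eq_square algebra_simps)
  interpret subspace_bilinear UNIV UNIV "\<lambda>r (x::real). r *\<^sub>R x" by (rule subspace_bilinear_scaleR)
  have "diff_times k (\<lambda>t. inverse (f t))" for k
  proof (induction k)
    case (Suc k)
    have "diff_times k (\<lambda>t. - curve_deriv f t * (inverse (f t) * inverse (f t)))"
      using diff_times[OF _ diff_times[OF Suc Suc], of "\<lambda>t. - curve_deriv f t"]
        csmooth_minus[OF csmooth_deriv(2)[OF assms(1)]] by (simp add: csmooth_def)
    with d show ?case by (rule diff_times_SucI)
  qed simp
  then show ?thesis by (simp add: csmooth_def)
qed

section \<open>Curves through prescribed line segments\<close>

text \<open>The powers in the denominator make the family closed under differentiation, up to linear
  combinations; k = 0 is the classical function that is flat at 0.\<close>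

definition exp_flat :: "nat \<Rightarrow> real \<Rightarrow> real" where
  "exp_flat k x = (if x > 0 then exp (- 1 / x) / x ^ k else 0)"

lemma tendsto_exp_flat_0: "(exp_flat k \<longlongrightarrow> 0) (at 0)"
proof -
  have "((\<lambda>x::real. (inverse x) ^ k / exp (inverse x)) \<longlongrightarrow> 0) (at_right 0)"
    by (rule filterlim_compose[OF tendsto_power_div_exp_0 filterlim_inverse_at_top_right])
  then have "(exp_flat k \<longlongrightarrow> 0) (at_right 0)"
    by (rule Lim_transform_eventually)
      (auto simp: eventually_at_filter exp_flat_def exp_minus field_simps power_inverse)
  moreover have "(exp_flat k \<longlongrightarrow> 0) (at_left 0)"
    by (rule Lim_transform_eventually[OF tendsto_const]) (auto simp: eventually_at_filter exp_flat_def)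
  ultimately show ?thesis by (simp add: filterlim_split_at)
qed

lemma exp_flat_has_vector_derivative:
  "(exp_flat k has_vector_derivative exp_flat (k + 2) x - real k * exp_flat (Suc k) x) (at x)"
proof -
  consider "x > 0" | "x < 0" | "x = 0" by linarith
  then show ?thesis
  proof cases
    case 1
    have "((\<lambda>x. exp (- 1 / x) / x ^ k) has_real_derivative
        exp_flat (k + 2) x - real k * exp_flat (Suc k) x) (at x)"
    proof -
      have e: "((\<lambda>x. exp (- 1 / x)) has_real_derivative exp (- 1 / x) / x\<^sup>2) (at x)"
        using 1 by (auto intro!: derivative_eq_intros simp: power2_eq_square)
      have p: "((\<lambda>x. x ^ k) has_real_derivative real k * x ^ (k - 1)) (at x)"
        using DERIV_pow[of k x] by simp
      have nz: "x ^ k \<noteq> 0" using 1 by simp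
      show ?thesis
        by (rule DERIV_cong[OF DERIV_divide[OF e p nz]])
          (use 1 in \<open>cases k; auto simp: exp_flat_def power2_eq_square field_simps\<close>)
    qed
    then show ?thesis
      unfolding has_real_derivative_iff_has_vector_derivative
      by (rule has_vector_derivative_transform_within_open[where S="{0<..}"]) (use 1 in \<open>auto simp: exp_flat_def\<close>)
  next
    case 2
    have "((\<lambda>_. 0) has_vector_derivative (0::real)) (at x)" by simp
    then show ?thesis
      by (rule has_vector_derivative_transform_within_open[where S="{..<0}", THEN has_vector_derivative_eq_rhs])
        (use 2 in \<open>auto simp: exp_flat_def\<close>)
  next
    case 3
    \<comment> \<open>Dividing by s raises the index: away from 0 this quotient is
      \<open>exp_flat (Suc k)\<close>.\<close>
    have "((\<lambda>s. (1 / (s - 0)) *\<^sub>R (exp_flat k s - exp_flat k 0)) \<longlongrightarrow> 0) (at 0)"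
      by (rule Lim_transform_eventually[OF tendsto_exp_flat_0[of "Suc k"]])
        (auto simp: eventually_at_filter exp_flat_def)
    then show ?thesis unfolding has_vector_derivative_iff_quotient 3 by (simp add: exp_flat_def)
  qed
qed

lemma csmooth_exp_flat: "csmooth (exp_flat k)"
proof -
  have "diff_times j (exp_flat k)" for j
  proof (induction j arbitrary: k)
    case (Suc j)
    have "diff_times j (\<lambda>x. exp_flat (k + 2) x + (- real k) *\<^sub>R exp_flat (Suc k) x)"
      by (intro diff_times_add Suc.IH bounded_linear.diff_times[OF bounded_linear_scaleR_right])
    then show ?case
      by (rule diff_times_SucI[rotated]) (use exp_flat_has_vector_derivative[of k] in simp)
  qed simp
  then show ?thesis by (simp add: csmooth_def)
qed

lemma exp_flat_pos: "x > 0 \<Longrightarrow> exp_flat k x > 0" and exp_flat_nonneg: "exp_flat k x \<ge> 0" and exp_flat_0: "x \<le> 0 \<Longrightarrow> exp_flat k x = 0"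
  by (auto simp: exp_flat_def)

lemma smooth_cutoff:
  obtains \<beta> :: "real \<Rightarrow> real" where "csmooth \<beta>" "\<And>x. \<bar>x\<bar> \<le> 1/2 \<Longrightarrow> \<beta> x = 1" "\<And>x. \<bar>x\<bar> \<ge> 1 \<Longrightarrow> \<beta> x = 0"
proof -
  \<comment> \<open>A smooth step, 0 to the left of 0 and 1 to the right of 1. The denominator is
    positive because x and 1 - x are never both \<le> 0.\<close>
  define s where "s x = exp_flat 0 x * inverse (exp_flat 0 x + exp_flat 0 (1 - x))" for x
  have nz: "exp_flat 0 x + exp_flat 0 (1 - x) \<noteq> 0" for x
    using exp_flat_pos[of x 0] exp_flat_pos[of "1 - x" 0] exp_flat_nonneg[of 0 x] exp_flat_nonneg[of 0 "1 - x"]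
    by (cases "x > 0") linarith+
  have refl: "csmooth (\<lambda>x. exp_flat 0 (1 - x))"
    using csmooth_affine[OF csmooth_exp_flat[of 0], of "-1" 1] by simp
  have s: "csmooth s"
    unfolding s_def by (intro csmooth_mult csmooth_inverse csmooth_add csmooth_exp_flat refl nz)
  have s1: "s x = 1" if "x \<ge> 1" for x
    using that exp_flat_pos[of x 0] by (simp add: s_def exp_flat_0)
  have s0: "s x = 0" if "x \<le> 0" for x
    using that by (simp add: s_def exp_flat_0)
  \<comment> \<open>A falling step times a rising one: both arguments are \<ge> 1 for |x| \<le> 1/2,
    and one of them is \<le> 0 for |x| \<ge> 1.\<close>
  show ?thesis
  proof (rule that[of "\<lambda>x. s (-2 * x + 2) * s (2 * x + 2)"])
    show "csmooth (\<lambda>x. s (-2 * x + 2) * s (2 * x + 2))"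
      by (intro csmooth_mult csmooth_affine[OF s])
  next
    fix x :: real assume "\<bar>x\<bar> \<le> 1/2"
    then show "s (-2 * x + 2) * s (2 * x + 2) = 1" by (simp add: s1)
  next
    fix x :: real assume "\<bar>x\<bar> \<ge> 1"
    then consider "-2 * x + 2 \<le> 0" | "2 * x + 2 \<le> 0" by linarith
    then show "s (-2 * x + 2) * s (2 * x + 2) = 0" by cases (simp_all add: s0)
  qed
qed

lemma csmooth_support_bounded:
  assumes "csmooth c" "\<And>x. \<bar>x\<bar> \<ge> 1 \<Longrightarrow> c x = 0"
  shows "\<exists>M. \<forall>x. norm ((curve_deriv ^^ k) c x) \<le> M"
proof -
  let ?D = "\<lambda>k. (curve_deriv ^^ k) c"
  \<comment> \<open>The strict inequality gives an open set, on which vanishing passes to the next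
    derivative; the end points belong to the compact part.\<close>
  have van: "?D k x = 0" if "\<bar>x\<bar> > 1" for x
    using that
  proof (induction k arbitrary: x)
    case (Suc k)
    have "((\<lambda>_. 0) has_vector_derivative 0) (at x)" by simp
    then have "(?D k has_vector_derivative 0) (at x)"
      by (rule has_vector_derivative_transform_within_open[where S="{x. \<bar>x\<bar> > 1}"])
        (use Suc in \<open>auto intro!: open_Collect_less continuous_intros\<close>)
    then show ?case
      using csmooth_funpow_deriv[OF assms(1), of k x] vector_derivative_unique_at by blast
  qed (use assms(2) in simp)
  have "compact (?D k ` {-1..1})"
    by (intro compact_continuous_image continuous_at_imp_continuous_on ballI
        csmooth_continuous csmooth_funpow assms) auto
  then obtain M where M: "\<And>x. x \<in> {-1..1} \<Longrightarrow> norm (?D k x) \<le> M"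
    using compact_imp_bounded bounded_iff by (metis image_eqI)
  have "norm (?D k x) \<le> max M 0" for x
    using M[of x] van[of x] by (cases "\<bar>x\<bar> > 1") (auto simp: le_max_iff_disj abs_le_iff not_less)
  then show ?thesis by blast
qed

text \<open>Summable majorants for every order give uniform convergence of all the termwise derived
  series, hence termwise differentiation at every order.\<close>

lemma csmooth_series:
  fixes g :: "nat \<Rightarrow> nat \<Rightarrow> real \<Rightarrow> 'a::banach"
  assumes der: "\<And>n k t. (g n k has_vector_derivative g n (Suc k) t) (at t)"
    and bd: "\<And>n k t. norm (g n k t) \<le> M n k" and sm: "\<And>k. summable (\<lambda>n. M n k)"
  shows "csmooth (\<lambda>t. \<Sum>n. g n 0 t)"
proof -
  define G where "G k t = (\<Sum>n. g n k t)" for k t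
  have "(G k has_vector_derivative G (Suc k) t) (at t)" for k t
  proof -
    have sm': "summable (\<lambda>n. g n k t)" for k t
      by (rule summable_comparison_test'[OF sm[of k], of 0]) (use bd in auto)
    have ul: "uniform_limit UNIV (\<lambda>n x. \<Sum>i<n. g i (Suc k) x) (G (Suc k)) sequentially"
      unfolding G_def by (rule Weierstrass_m_test[OF bd sm])
    have "\<exists>f. \<forall>x\<in>UNIV. (\<lambda>n. g n k x) sums f x \<and> (f has_derivative (\<lambda>h. h *\<^sub>R G (Suc k) x)) (at x within UNIV)"
    proof (rule has_derivative_series[where f' = "\<lambda>n x h. h *\<^sub>R g n (Suc k) x" and x = 0])
      show "(g n k has_derivative (\<lambda>h. h *\<^sub>R g n (Suc k) x)) (at x within UNIV)" for n x
        using der[of n k x] by (simp add: has_vector_derivative_def)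
      show "\<forall>\<^sub>F n in sequentially. \<forall>x\<in>UNIV. \<forall>h. norm ((\<Sum>i<n. h *\<^sub>R g i (Suc k) x) - h *\<^sub>R G (Suc k) x) \<le> e * norm h"
        if "e > 0" for e
        using uniform_limitD[OF ul that]
      proof (rule eventually_mono, intro ballI allI)
        fix n x h assume *: "\<forall>x\<in>UNIV. dist (\<Sum>i<n. g i (Suc k) x) (G (Suc k) x) < e"
        have "norm ((\<Sum>i<n. h *\<^sub>R g i (Suc k) x) - h *\<^sub>R G (Suc k) x)
            = \<bar>h\<bar> * dist (\<Sum>i<n. g i (Suc k) x) (G (Suc k) x)"
          by (simp add: dist_norm flip: scaleR_sum_right scaleR_diff_right)
        also have "\<dots> \<le> \<bar>h\<bar> * e" using * by (intro mult_left_mono) (auto intro: less_imp_le)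
        finally show "norm ((\<Sum>i<n. h *\<^sub>R g i (Suc k) x) - h *\<^sub>R G (Suc k) x) \<le> e * norm h"
          by (simp add: mult.commute)
      qed
      show "(\<lambda>n. g n k 0) sums G k 0"
        unfolding G_def by (rule summable_sums[OF sm'])
    qed auto
    then obtain f where f: "\<And>x. (\<lambda>n. g n k x) sums f x" "\<And>x. (f has_derivative (\<lambda>h. h *\<^sub>R G (Suc k) x)) (at x)"
      by auto
    have "f = G k" using f(1) by (auto simp: G_def fun_eq_iff intro: sums_unique)
    then show ?thesis using f(2) by (simp add: has_vector_derivative_def)
  qed
  then have "csmooth (G 0)"
    unfolding csmooth_iff_sequence by (intro exI[of _ G]) auto
  then show ?thesis by (simp add: G_def[abs_def])
qed

text \<open>A form of the special curve lemma of convenient calculus: bumps with disjoint supports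
  around the times 2^-n run through the segments. A derivative costs a factor of order 2^n, which
  the factorial decay absorbs, so the curve is smooth also at time 0, where the bumps
  accumulate.\<close>

lemma special_curve:
  fixes a b :: "nat \<Rightarrow> 'a::banach"
  assumes a: "\<And>n. norm (a n) \<le> 1 / fact n" and b: "\<And>n. norm (b n) \<le> 1 / fact n"
  obtains c where "csmooth c"
    "\<And>n t. \<bar>t - (1/2) ^ n\<bar> \<le> (1/2) ^ n / 8 \<Longrightarrow> c t = a n + (t - (1/2) ^ n) *\<^sub>R b n"
proof -
  obtain \<beta> :: "real \<Rightarrow> real" where \<beta>: "csmooth \<beta>" "\<And>x. \<bar>x\<bar> \<le> 1/2 \<Longrightarrow> \<beta> x = 1" "\<And>x. \<bar>x\<bar> \<ge> 1 \<Longrightarrow> \<beta> x = 0"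
    using smooth_cutoff by blast
  define \<gamma> where "\<gamma> x = x * \<beta> x" for x
  have \<gamma>: "csmooth \<gamma>" "\<And>x. \<bar>x\<bar> \<ge> 1 \<Longrightarrow> \<gamma> x = 0"
    unfolding \<gamma>_def using csmooth_mult[OF csmooth_ident \<beta>(1)] \<beta>(3) by auto
  obtain B where B: "\<And>k x. norm ((curve_deriv ^^ k) \<beta> x) \<le> B k"
    using csmooth_support_bounded[OF \<beta>(1,3)] by metis
  obtain C where C: "\<And>k x. norm ((curve_deriv ^^ k) \<gamma> x) \<le> C k"
    using csmooth_support_bounded[OF \<gamma>] by metis
  \<comment> \<open>Bump n lives in |t - 2^-n| < 2^-n / 4 and its cutoff is 1 on the inner half of
    this interval, whence the 1/8 in the claim.\<close>
  define r :: "nat \<Rightarrow> real" where "r n = 4 * 2 ^ n" for n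
  have r1: "r n \<ge> 1" for n using one_le_power[of "2::real" n] by (simp only: r_def, linarith)
  \<comment> \<open>\<open>g n k\<close> is the k-th derivative of the n-th summand. Where the
    cutoff is 1, \<gamma>(r t - 4) / r is t - 2^-n. Writing \<open>r n ^ k / r n\<close> lets k = 0
    obey the same formula.\<close>
  define g where "g n k t = (r n ^ k * (curve_deriv ^^ k) \<beta> (r n * t - 4)) *\<^sub>R a n
      + (r n ^ k / r n * (curve_deriv ^^ k) \<gamma> (r n * t - 4)) *\<^sub>R b n" for n k t
  have "csmooth (\<lambda>t. \<Sum>n. g n 0 t)"
  proof (rule csmooth_series[where g = g])
    fix n k t
    have lin: "((\<lambda>t. r n * t - 4) has_vector_derivative r n) (at t)"
      by (auto intro!: derivative_eq_intros)
    have "((\<lambda>t. (curve_deriv ^^ k) c (r n * t - 4)) has_vector_derivative r n *\<^sub>R (curve_deriv ^^ Suc k) c (r n * t - 4)) (at t)"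
      if "csmooth c" for c :: "real \<Rightarrow> real"
      using vector_diff_chain_at[OF lin csmooth_funpow_deriv[OF that]] by (simp add: o_def)
    from this[OF \<beta>(1)] this[OF \<gamma>(1)]
    show "(g n k has_vector_derivative g n (Suc k) t) (at t)"
      unfolding g_def by (auto intro!: derivative_eq_intros simp: has_real_derivative_iff_has_vector_derivative mult_ac)
    have rk: "r n ^ k / r n \<le> r n ^ k" using r1[of n] by (simp add: divide_le_eq mult_le_cancel_left1)
    have C0: "0 \<le> C k" using order_trans[OF norm_ge_zero C[of k 0]] .
    have "norm (g n k t) \<le> r n ^ k * B k * (1 / fact n) + r n ^ k * C k * (1 / fact n)"
    proof (unfold g_def, rule norm_triangle_le, rule add_mono)
      show "norm ((r n ^ k * (curve_deriv ^^ k) \<beta> (r n * t - 4)) *\<^sub>R a n) \<le> r n ^ k * B k * (1 / fact n)"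
        unfolding norm_scaleR abs_mult using r1[of n] B a order_trans[OF norm_ge_zero B[of k 0]]
        by (intro mult_mono) auto
      show "norm ((r n ^ k / r n * (curve_deriv ^^ k) \<gamma> (r n * t - 4)) *\<^sub>R b n) \<le> r n ^ k * C k * (1 / fact n)"
        unfolding norm_scaleR abs_mult using r1[of n] C b rk C0
        by (intro mult_mono) auto
    qed
    then show "norm (g n k t) \<le> (4 ^ k * (B k + C k)) * (inverse (fact n) * (2 ^ k) ^ n)"
      by (simp add: r_def power_mult_distrib field_simps flip: power_mult)
  next
    show "summable (\<lambda>n. (4 ^ k * (B k + C k)) * (inverse (fact n) * (2 ^ k) ^ n))" for k
      by (intro summable_mult summable_exp)
  qed
  moreover have "(\<Sum>n. g n 0 t) = a n + (t - (1/2) ^ n) *\<^sub>R b n" if t: "\<bar>t - (1/2) ^ n\<bar> \<le> (1/2) ^ n / 8" for n t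
  proof -
    define q :: real where "q = 2 ^ n"
    have q: "q > 0" "(1/2) ^ n = 1 / q" by (auto simp: q_def power_divide)
    have qt: "7/8 \<le> q * t" "q * t \<le> 9/8"
    proof -
      have "\<bar>q * t - 1\<bar> = q * \<bar>t - 1 / q\<bar>"
      proof -
        have "q * t - 1 = q * (t - 1 / q)" using q(1) by (simp add: right_diff_distrib)
        then show ?thesis using q(1) by (simp only: abs_mult abs_of_pos)
      qed
      also have "\<dots> \<le> q * (1 / q / 8)" using t q by (intro mult_left_mono) auto
      finally have "\<bar>q * t - 1\<bar> \<le> 1/8" using q(1) by simp
      then show "7/8 \<le> q * t" "q * t \<le> 9/8" by linarith+
    qed
    have t0: "t > 0" using qt(1) q(1) zero_less_mult_pos[of q t] by linarith
    \<comment> \<open>With q t between 7/8 and 9/8: for m < n, r_m t \<le> 2 q t \<le> 9/4, and for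
      m > n, r_m t \<ge> 8 q t \<ge> 7. Either way r_m t - 4 is outside the support of the
      cutoff.\<close>
    have other: "g m 0 t = 0" if "m \<noteq> n" for m
    proof -
      have "\<bar>r m * t - 4\<bar> \<ge> 1"
      proof (cases "m < n")
        case True
        then have "2 * 2 ^ m \<le> q" unfolding q_def
          by (metis Suc_leI one_le_numeral power_Suc power_increasing)
        then have "2 * 2 ^ m * t \<le> q * t" using t0 by (intro mult_right_mono) auto
        then show ?thesis using qt by (simp add: r_def)
      next
        case False
        then have "2 * q \<le> 2 ^ m" using that unfolding q_def
          by (metis Suc_leI linorder_neqE_nat one_le_numeral power_Suc power_increasing)
        then have "2 * q * t \<le> 2 ^ m * t" using t0 by (intro mult_right_mono) auto
        then show ?thesis using qt by (simp add: r_def)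
      qed
      then show ?thesis using \<beta>(3) \<gamma>(2) by (simp add: g_def)
    qed
    have u: "\<bar>r n * t - 4\<bar> \<le> 1/2" using qt unfolding r_def q_def by linarith
    have "(\<Sum>m. g m 0 t) = (\<Sum>m\<in>{n}. g m 0 t)"
      by (rule suminf_finite) (use other in auto)
    also have "\<dots> = a n + ((r n * t - 4) / r n) *\<^sub>R b n"
      using \<beta>(2)[OF u] by (simp add: g_def \<gamma>_def)
    also have "(r n * t - 4) / r n = t - (1/2) ^ n"
      using q by (simp add: r_def q_def[symmetric] field_simps)
    finally show ?thesis .
  qed
  ultimately show ?thesis using that by blast
qed

lemma curve_deriv_funpow_affine:
  assumes "csmooth c"
  shows "(curve_deriv ^^ k) (\<lambda>t. c (a * t + b)) = (\<lambda>t. a ^ k *\<^sub>R (curve_deriv ^^ k) c (a * t + b))"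
proof -
  let ?D = "\<lambda>k t. a ^ k *\<^sub>R (curve_deriv ^^ k) c (a * t + b)"
  have "(?D k has_vector_derivative ?D (Suc k) t) (at t)" for k t
  proof -
    have lin: "((\<lambda>t. a * t + b) has_vector_derivative a) (at t)" by (auto intro!: derivative_eq_intros)
    from bounded_linear.has_vector_derivative[OF bounded_linear_scaleR_right
        vector_diff_chain_at[OF lin csmooth_funpow_deriv[OF assms]]]
    show ?thesis by (simp add: o_def mult.commute[of a])
  qed
  from curve_deriv_funpow_eq[of ?D, OF this] show ?thesis by simp
qed

lemma curve_deriv_funpow_cong:
  assumes "csmooth c" "csmooth e" "open S" "\<And>t. t \<in> S \<Longrightarrow> c t = e t" "t \<in> S"
  shows "(curve_deriv ^^ k) c t = (curve_deriv ^^ k) e t"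
  using assms(5)
proof (induction k arbitrary: t)
  case (Suc k)
  have "((curve_deriv ^^ k) e has_vector_derivative (curve_deriv ^^ Suc k) c t) (at t)"
    by (rule has_vector_derivative_transform_within_open[OF csmooth_funpow_deriv[OF assms(1)] assms(3) Suc.prems])
      (rule Suc.IH)
  then show ?case
    using csmooth_funpow_deriv[OF assms(2), of k t] vector_derivative_unique_at by blast
qed (use assms(4) in simp)

section \<open>Local bounds for derivatives along lines\<close>

definition smooth_along :: "('a::real_normed_vector \<Rightarrow> 'b::real_normed_vector) \<Rightarrow> bool" where
  "smooth_along f \<longleftrightarrow> (\<forall>c. csmooth c \<longrightarrow> csmooth (\<lambda>t. f (c t)))"

lemma smooth_alongD: "smooth_along f \<Longrightarrow> csmooth c \<Longrightarrow> csmooth (\<lambda>t. f (c t))"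
  by (simp add: smooth_along_def)

lemma csmooth_line: "csmooth (\<lambda>s. x + s *\<^sub>R (v :: 'a::real_normed_vector))"
  by (intro csmooth_add csmooth_const csmooth_scaleR csmooth_ident)

lemma directional_derivative_locally_bounded:
  fixes f :: "'a::banach \<Rightarrow> 'b::real_normed_vector"
  assumes f: "smooth_along f"
  shows "\<exists>r>0. \<exists>C. \<forall>x v. norm (x - x0) < r \<longrightarrow> norm v \<le> 1 \<longrightarrow>
    norm ((curve_deriv ^^ p) (\<lambda>s. f (x + s *\<^sub>R v)) 0) \<le> C"
proof (rule ccontr)
  assume neg: "\<not> ?thesis"
  \<comment> \<open>The curve will pass x_n with velocity v_n / n!, slow enough to be smooth, and
    this speed divides the p-th derivative by (n!)^p. The threshold compensates for that and leaves
    n, so the p-th derivatives of the image at the times 2^-n are unbounded.\<close>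
  have "\<exists>x v. norm (x - x0) < 1 / fact n \<and> norm v \<le> 1 \<and>
      norm ((curve_deriv ^^ p) (\<lambda>s. f (x + s *\<^sub>R v)) 0) > fact n ^ p * real n" for n
    using neg by (metis fact_gt_zero not_less zero_less_divide_1_iff)
  then obtain x v where x: "\<And>n. norm (x n - x0) < 1 / fact n" and v: "\<And>n. norm (v n) \<le> 1"
    and big: "\<And>n. norm ((curve_deriv ^^ p) (\<lambda>s. f (x n + s *\<^sub>R v n)) 0) > fact n ^ p * real n"
    by metis
  obtain c where c: "csmooth c"
    "\<And>n t. \<bar>t - (1/2) ^ n\<bar> \<le> (1/2) ^ n / 8 \<Longrightarrow> c t = (x n - x0) + (t - (1/2) ^ n) *\<^sub>R ((1 / fact n) *\<^sub>R v n)"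
  proof (rule special_curve[of "\<lambda>n. x n - x0" "\<lambda>n. (1 / fact n) *\<^sub>R v n"])
    show "norm (x n - x0) \<le> 1 / fact n" for n using x[of n] by simp
    show "norm ((1 / fact n) *\<^sub>R v n) \<le> 1 / fact n" for n using v[of n] by (simp add: divide_le_cancel)
  qed blast
  define F where "F t = f (x0 + c t)" for t
  have F: "csmooth F"
    unfolding F_def by (rule smooth_alongD[OF f csmooth_add[OF csmooth_const c(1)]])
  have "compact ((curve_deriv ^^ p) F ` {0..1})"
    by (intro compact_continuous_image continuous_at_imp_continuous_on ballI
        csmooth_continuous csmooth_funpow F) auto
  then obtain K where K: "\<And>t. t \<in> {0..1} \<Longrightarrow> norm ((curve_deriv ^^ p) F t) \<le> K"
    using compact_imp_bounded bounded_iff by (metis image_eqI)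
  have "real n < K" for n
  proof -
    define \<tau> :: real where "\<tau> = (1/2) ^ n"
    have \<tau>: "\<tau> > 0" "\<tau> \<le> 1" by (auto simp: \<tau>_def power_le_one)
    let ?h = "\<lambda>s. f (x n + s *\<^sub>R v n)"
    have h: "csmooth ?h" by (rule smooth_alongD[OF f csmooth_line])
    have "(curve_deriv ^^ p) F \<tau> = (curve_deriv ^^ p) (\<lambda>t. ?h (1 / fact n * t + - \<tau> / fact n)) \<tau>"
    proof (rule curve_deriv_funpow_cong[where S = "ball \<tau> (\<tau> / 8)", OF F csmooth_affine[OF h]])
      fix t assume "t \<in> ball \<tau> (\<tau> / 8)"
      then have "\<bar>t - \<tau>\<bar> \<le> \<tau> / 8" by (simp add: dist_real_def abs_minus_commute)
      then have "c t = (x n - x0) + (t - \<tau>) *\<^sub>R ((1 / fact n) *\<^sub>R v n)" using c(2)[of t n] by (simp add: \<tau>_def)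
      then have "x0 + c t = x n + (1 / fact n * t + - \<tau> / fact n) *\<^sub>R v n"
        by (simp add: diff_divide_distrib algebra_simps)
      then show "F t = ?h (1 / fact n * t + - \<tau> / fact n)"
        by (simp only: F_def)
    qed (use \<tau> in auto)
    also have "\<dots> = (1 / fact n) ^ p *\<^sub>R (curve_deriv ^^ p) ?h 0"
      by (subst curve_deriv_funpow_affine[OF h]) simp
    finally have "(1 / fact n) ^ p * norm ((curve_deriv ^^ p) ?h 0) \<le> K"
      using K[of \<tau>] \<tau> by simp
    moreover have "real n < (1 / fact n) ^ p * norm ((curve_deriv ^^ p) ?h 0)"
      using big[of n] by (simp add: power_divide field_simps)
    ultimately show ?thesis by linarith
  qed
  then show False using reals_Archimedean2 less_asym by blast
qed

section \<open>Mixed differences\<close>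

primrec differences :: "'a::real_vector list \<Rightarrow> ('a \<Rightarrow> 'b::real_vector) \<Rightarrow> 'a \<Rightarrow> 'b" where
  "differences [] f x = f x"
| "differences (h # hs) f x = differences hs f (x + h) - differences hs f x"

lemma differences_step: "differences hs (\<lambda>y. f (y + h) - f y) x = differences (h # hs) f x"
  by (induction hs arbitrary: x) (simp_all add: add.commute add.left_commute)

lemma differences_eq_0: "0 \<in> set hs \<Longrightarrow> differences hs f x = 0"
  by (induction hs arbitrary: x) auto

lemma differences_scaleR: "differences hs (\<lambda>y. r *\<^sub>R f y) x = r *\<^sub>R differences hs f x"
  by (induction hs arbitrary: x) (simp_all add: scaleR_diff_right)

lemma tendsto_differences:
  assumes "\<And>y. ((\<lambda>s. f s y) \<longlongrightarrow> (g y :: 'b::real_normed_vector)) F"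
  shows "((\<lambda>s. differences hs (f s) x) \<longlongrightarrow> differences hs g x) F"
  by (induction hs arbitrary: x) (auto intro: assms tendsto_diff)

text \<open>Restricts difference bounds from the plane to the line where the first coordinate is
  0.\<close>

lemma differences_embed:
  "differences (map (Pair 0) hs) f (s, t) = differences hs (\<lambda>t. f (s, t)) t"
  by (induction hs arbitrary: t) simp_all

text \<open>The alternating sum of (-1)^k binom(p, k) F(k), a p-th difference with unit step whose
  sign gives F(0) the coefficient 1.\<close>

primrec unit_diff :: "nat \<Rightarrow> (nat \<Rightarrow> 'b::real_vector) \<Rightarrow> 'b" where
  "unit_diff 0 F = F 0"
| "unit_diff (Suc p) F = unit_diff p F - unit_diff p (\<lambda>k. F (Suc k))"

lemma unit_diff_diff: "unit_diff p (\<lambda>k. F k - G k) = unit_diff p F - unit_diff p G"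
  by (induction p arbitrary: F G) (simp_all add: algebra_simps)

lemma unit_diff_eq_0: "(\<And>k. k \<le> p \<Longrightarrow> F k = 0) \<Longrightarrow> unit_diff p F = 0"
proof (induction p arbitrary: F)
  case (Suc p)
  have "unit_diff p F = 0" "unit_diff p (\<lambda>k. F (Suc k)) = 0"
    by (rule Suc.IH; simp add: Suc.prems)+
  then show ?case by simp
qed simp

lemma unit_diff_eq_first: "(\<And>k. 1 \<le> k \<Longrightarrow> k \<le> p \<Longrightarrow> F k = 0) \<Longrightarrow> unit_diff p F = F 0"
proof (induction p arbitrary: F)
  case (Suc p)
  then have "unit_diff p F = F 0" "unit_diff p (\<lambda>k. F (Suc k)) = 0"
    by (auto intro!: unit_diff_eq_0)
  then show ?case by simp
qed simp

text \<open>For \<open>1 \<le> k\<close> the \<open>k\<close>-th step on the right is \<open>0\<close>, so only \<open>k = 0\<close> survives (an identity of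
  Djokovic). It reduces mixed differences to differences along single lines.\<close>

lemma differences_eq_unit_diff:
  "differences hs f x = unit_diff (length hs)
     (\<lambda>k. differences (map (\<lambda>(h, j). h + real k *\<^sub>R (- (1 / real (Suc j)) *\<^sub>R h)) (zip hs [0..<length hs])) f x)"
proof -
  have "differences (map (\<lambda>(h, j). h + real k *\<^sub>R (- (1 / real (Suc j)) *\<^sub>R h)) (zip hs [0..<length hs])) f x = 0"
    if k: "1 \<le> k" "k \<le> length hs" for k
  proof (rule differences_eq_0)
    obtain j where j: "k = Suc j" using k by (cases k) auto
    have "(hs ! j, j) \<in> set (zip hs [0..<length hs])"
      using k j by (auto simp: set_zip intro!: exI[of _ j])
    moreover have "hs ! j + real k *\<^sub>R (- (1 / real (Suc j)) *\<^sub>R (hs ! j)) = 0" by (simp add: j)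
    ultimately show "0 \<in> set (map (\<lambda>(h, j). h + real k *\<^sub>R (- (1 / real (Suc j)) *\<^sub>R h)) (zip hs [0..<length hs]))"
      by force
  qed
  then have "unit_diff (length hs)
     (\<lambda>k. differences (map (\<lambda>(h, j). h + real k *\<^sub>R (- (1 / real (Suc j)) *\<^sub>R h)) (zip hs [0..<length hs])) f x)
     = differences (map (\<lambda>(h, j). h + real 0 *\<^sub>R (- (1 / real (Suc j)) *\<^sub>R h)) (zip hs [0..<length hs])) f x"
    by (intro unit_diff_eq_first) auto
  also have "map (\<lambda>(h, j). h + real 0 *\<^sub>R (- (1 / real (Suc j)) *\<^sub>R h)) (zip hs [0..<length hs]) = hs"
    by (simp add: case_prod_unfold)
  finally show ?thesis by simp
qed

text \<open>Expanding the mixed difference gives one term per subset of the steps. Each is a unit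
  difference along a single line, whose base point and direction collect the chosen u and v. The
  radii \<rho> and \<beta> grow during the induction by the steps already absorbed.\<close>

lemma norm_unit_diff_differences_le:
  fixes f :: "'a::real_normed_vector \<Rightarrow> 'b::real_normed_vector"
  assumes "\<And>a b. norm (a - z) \<le> \<rho> + (\<Sum>(u, v)\<leftarrow>uvs. norm u) \<Longrightarrow> norm b \<le> \<beta> + (\<Sum>(u, v)\<leftarrow>uvs. norm v) \<Longrightarrow>
      norm (unit_diff p (\<lambda>k. f (a + real k *\<^sub>R b))) \<le> M"
    and "norm (a - z) \<le> \<rho>" "norm b \<le> \<beta>"
  shows "norm (unit_diff p (\<lambda>k. differences (map (\<lambda>(u, v). u + real k *\<^sub>R v) uvs) f (a + real k *\<^sub>R b)))
    \<le> 2 ^ length uvs * M"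
  using assms
proof (induction uvs arbitrary: a b \<rho> \<beta>)
  case (Cons uv uvs)
  obtain u v where uv: "uv = (u, v)" by force
  let ?F = "\<lambda>a b. unit_diff p (\<lambda>k. differences (map (\<lambda>(u, v). u + real k *\<^sub>R v) uvs) f (a + real k *\<^sub>R b))"
  have pos: "0 \<le> norm u" "0 \<le> norm v" by auto
  have bd: "norm (unit_diff p (\<lambda>k. f (a + real k *\<^sub>R b))) \<le> M"
    if "norm (a - z) \<le> (\<rho> + norm u) + (\<Sum>(u, v)\<leftarrow>uvs. norm u)" "norm b \<le> (\<beta> + norm v) + (\<Sum>(u, v)\<leftarrow>uvs. norm v)" for a b
    using Cons.prems(1)[of a b] that by (simp add: uv add.assoc)
  have "norm ((a + u) - z) \<le> \<rho> + norm u" "norm (b + v) \<le> \<beta> + norm v"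
    using Cons.prems(2,3) norm_triangle_ineq[of "a - z" u] norm_triangle_ineq[of b v]
    by (simp_all add: algebra_simps)
  then have 1: "norm (?F (a + u) (b + v)) \<le> 2 ^ length uvs * M" by (intro Cons.IH bd)
  have 2: "norm (?F a b) \<le> 2 ^ length uvs * M"
    by (rule Cons.IH[of "\<rho> + norm u" "\<beta> + norm v", OF bd]) (use Cons.prems(2,3) pos in linarith)+
  have "unit_diff p (\<lambda>k. differences (map (\<lambda>(u, v). u + real k *\<^sub>R v) (uv # uvs)) f (a + real k *\<^sub>R b))
      = ?F (a + u) (b + v) - ?F a b"
    by (simp add: uv flip: unit_diff_diff) (simp add: algebra_simps)
  also have "norm \<dots> \<le> 2 ^ length uvs * M + 2 ^ length uvs * M"
    using norm_triangle_ineq4 1 2 by (meson add_mono order_trans)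
  finally show ?case by (simp add: mult_ac)
qed simp

text \<open>A mean value estimate: each unit difference is an increment over length 1 of a lower
  derivative, so the induction trades differences for derivatives.\<close>

lemma norm_unit_diff_le:
  fixes g :: "real \<Rightarrow> 'b::real_normed_vector"
  assumes "csmooth g" "\<And>t. 0 \<le> t \<Longrightarrow> t \<le> real p \<Longrightarrow> norm ((curve_deriv ^^ p) g t) \<le> M"
  shows "norm (unit_diff p (\<lambda>k. g (real k))) \<le> M"
  using assms
proof (induction p arbitrary: g)
  case (Suc p)
  define g1 where "g1 t = g t - g (t + 1)" for t
  let ?D = "\<lambda>k t. (curve_deriv ^^ k) g t - (curve_deriv ^^ k) g (t + 1)"
  have shift: "((\<lambda>t. (curve_deriv ^^ k) g (t + 1)) has_vector_derivative (curve_deriv ^^ Suc k) g (t + 1)) (at t)" for k t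
  proof -
    have "((\<lambda>t. t + 1) has_vector_derivative 1) (at t)" by (auto intro!: derivative_eq_intros)
    from vector_diff_chain_at[OF this csmooth_funpow_deriv[OF Suc.prems(1)]]
    show ?thesis by (simp add: o_def)
  qed
  have D: "(?D k has_vector_derivative ?D (Suc k) t) (at t)" for k t
    by (intro has_vector_derivative_diff csmooth_funpow_deriv[OF Suc.prems(1)] shift)
  have g1: "csmooth g1" unfolding csmooth_iff_sequence by (rule exI[of _ ?D]) (use D in \<open>auto simp: g1_def\<close>)
  have eq: "(curve_deriv ^^ p) g1 = ?D p" using curve_deriv_funpow_eq[of ?D, OF D] by (simp add: g1_def[abs_def])
  have "norm ((curve_deriv ^^ p) g1 t) \<le> M" if t: "0 \<le> t" "t \<le> real p" for t
  proof -
    have "norm ((curve_deriv ^^ p) g (t + 1) - (curve_deriv ^^ p) g t) \<le> M * norm (t + 1 - t)"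
    proof (rule differentiable_bound[where S = "{t..t+1}" and f' = "\<lambda>x h. h *\<^sub>R (curve_deriv ^^ Suc p) g x"])
      show "((curve_deriv ^^ p) g has_derivative (\<lambda>h. h *\<^sub>R (curve_deriv ^^ Suc p) g x)) (at x within {t..t + 1})" for x
        using csmooth_funpow_deriv[OF Suc.prems(1), of p x] has_derivative_at_withinI
        unfolding has_vector_derivative_def by blast
      show "onorm (\<lambda>h. h *\<^sub>R (curve_deriv ^^ Suc p) g x) \<le> M" if "x \<in> {t..t + 1}" for x
        using Suc.prems(2)[of x] t that by (simp add: onorm_scaleR_left onorm_id)
    qed auto
    then show ?thesis by (simp add: eq norm_minus_commute)
  qed
  from Suc.IH[OF g1 this] show ?case by (simp add: g1_def unit_diff_diff add.commute)
qed simp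

text \<open>A stand-in for local boundedness of all derivatives that mentions no derivative. It
  therefore passes to limits of difference quotients, and for functions of a real variable it
  implies smoothness.\<close>

definition bounded_differences :: "('a::real_normed_vector \<Rightarrow> 'b::real_normed_vector) \<Rightarrow> bool" where
  "bounded_differences f \<longleftrightarrow> (\<forall>x0 p. \<exists>r>0. \<exists>C\<ge>0. \<forall>x hs. length hs = p \<longrightarrow> norm (x - x0) < r \<longrightarrow>
     (\<forall>h\<in>set hs. norm h < r) \<longrightarrow> norm (differences hs f x) \<le> C * prod_list (map norm hs))"

text \<open>Rescaling a unit-speed line to the direction b multiplies p-th derivatives by
  |b|^p.\<close>

lemma smooth_along_line_difference_bound:
  fixes f :: "'a::banach \<Rightarrow> 'b::real_normed_vector"
  assumes f: "smooth_along f"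
  shows "\<exists>r>0. \<exists>C\<ge>0. \<forall>a b. norm (a - x0) + real p * norm b < r \<longrightarrow>
    norm (unit_diff p (\<lambda>k. f (a + real k *\<^sub>R b))) \<le> C * norm b ^ p"
proof -
  obtain r C where r: "r > 0" and C: "\<And>x v. norm (x - x0) < r \<Longrightarrow> norm v \<le> 1 \<Longrightarrow>
    norm ((curve_deriv ^^ p) (\<lambda>s. f (x + s *\<^sub>R v)) 0) \<le> C"
    using directional_derivative_locally_bounded[OF f] by metis
  have "norm (unit_diff p (\<lambda>k. f (a + real k *\<^sub>R b))) \<le> C * norm b ^ p"
    if ab: "norm (a - x0) + real p * norm b < r" for a b
  proof -
    \<comment> \<open>For b = 0 division by 0 gives v = 0, and both facts below persist.\<close>
    define v where "v = (1 / norm b) *\<^sub>R b"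
    have v: "norm v \<le> 1" "norm b *\<^sub>R v = b" by (auto simp: v_def)
    show ?thesis
    proof (rule norm_unit_diff_le)
      show sm: "csmooth (\<lambda>s. f (a + s *\<^sub>R b))" by (rule smooth_alongD[OF f csmooth_line])
      fix t :: real assume t: "0 \<le> t" "t \<le> real p"
      let ?h = "\<lambda>s. f ((a + t *\<^sub>R b) + s *\<^sub>R v)"
      have h: "csmooth ?h" by (rule smooth_alongD[OF f csmooth_line])
      have eq: "(\<lambda>s. f (a + s *\<^sub>R b)) = (\<lambda>s. ?h (norm b * s + - (norm b * t)))"
      proof
        fix s
        have "(norm b * s + - (norm b * t)) *\<^sub>R v = (s - t) *\<^sub>R (norm b *\<^sub>R v)"
          by (simp add: algebra_simps)
        then show "f (a + s *\<^sub>R b) = ?h (norm b * s + - (norm b * t))"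
          by (simp only: v(2)) (simp add: algebra_simps)
      qed
      have "(curve_deriv ^^ p) (\<lambda>s. f (a + s *\<^sub>R b)) t = norm b ^ p *\<^sub>R (curve_deriv ^^ p) ?h 0"
        unfolding eq by (subst curve_deriv_funpow_affine[OF h]) simp
      moreover have "norm (a + t *\<^sub>R b - x0) < r"
      proof -
        have "norm (a + t *\<^sub>R b - x0) \<le> norm (a - x0) + t * norm b"
          using norm_triangle_ineq[of "a - x0" "t *\<^sub>R b"] t by (simp add: algebra_simps)
        also have "\<dots> \<le> norm (a - x0) + real p * norm b" using t by (simp add: mult_right_mono)
        finally show ?thesis using ab by simp
      qed
      ultimately show "norm ((curve_deriv ^^ p) (\<lambda>s. f (a + s *\<^sub>R b)) t) \<le> C * norm b ^ p"
        using mult_left_mono[OF C[OF _ v(1)], of "a + t *\<^sub>R b" "norm b ^ p"] by (simp add: mult.commute)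
    qed
  qed
  moreover have "0 \<le> C" by (rule order_trans[OF norm_ge_zero C[of x0 0]]) (use r in auto)
  ultimately show ?thesis using r by blast
qed

text \<open>Djokovic's identity reduces the mixed difference to lines. This first bound sees only
  the largest step; subdivision turns it into the product of the steps.\<close>

lemma smooth_along_difference_bound:
  fixes f :: "'a::banach \<Rightarrow> 'b::real_normed_vector"
  assumes f: "smooth_along f"
  shows "\<exists>r>0. \<exists>C\<ge>0. \<forall>x hs \<delta>. length hs = p \<longrightarrow> norm (x - x0) < r \<longrightarrow> \<delta> < r \<longrightarrow>
     (\<forall>h\<in>set hs. norm h \<le> \<delta>) \<longrightarrow> norm (differences hs f x) \<le> C * \<delta> ^ p"
proof -
  obtain r C where r: "r > 0" and C0: "C \<ge> 0" and C: "\<And>a b. norm (a - x0) + real p * norm b < r \<Longrightarrow>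
    norm (unit_diff p (\<lambda>k. f (a + real k *\<^sub>R b))) \<le> C * norm b ^ p"
    using smooth_along_line_difference_bound[OF f] by metis
  \<comment> \<open>Makes room for the base point (s), its displacement by the u (p s), and p steps
    in a direction of norm at most p s.\<close>
  define s where "s = r / (1 + real p + real p * real p)"
  have den: "1 + real p + real p * real p > 0" by (simp add: add_pos_nonneg)
  have "s * (1 + real p + real p * real p) = r" using den by (simp add: s_def)
  then have s: "s > 0" "s + real p * s + real p * (real p * s) = r"
    using r den by (simp add: s_def, simp add: algebra_simps)
  have "norm (differences hs f x) \<le> (2 ^ p * C * real p ^ p) * \<delta> ^ p"
    if hs: "length hs = p" "norm (x - x0) < s" "\<delta> < s" "\<forall>h\<in>set hs. norm h \<le> \<delta>" for x hs \<delta>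
  proof -
    define uvs where "uvs = map (\<lambda>(h, j). (h, - (1 / real (Suc j)) *\<^sub>R h)) (zip hs [0..<length hs])"
    have len: "length uvs = p" by (simp add: uvs_def hs)
    have uv: "norm u \<le> \<delta>" "norm v \<le> \<delta>" if uvm: "(u, v) \<in> set uvs" for u v
    proof -
      obtain j where u: "u \<in> set hs" and v: "v = - (1 / real (Suc j)) *\<^sub>R u"
        using uvm by (auto simp: uvs_def dest: set_zip_leftD)
      show "norm u \<le> \<delta>" using hs u by blast
      have "norm v \<le> 1 * norm u" unfolding v norm_scaleR by (rule mult_right_mono) auto
      then show "norm v \<le> \<delta>" using \<open>norm u \<le> \<delta>\<close> by simp
    qed
    have su: "(\<Sum>(u, v)\<leftarrow>uvs. norm u) \<le> real p * \<delta>" and sv: "(\<Sum>(u, v)\<leftarrow>uvs. norm v) \<le> real p * \<delta>"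
      using sum_list_mono[of uvs "\<lambda>(u, v). norm u" "\<lambda>_. \<delta>"] sum_list_mono[of uvs "\<lambda>(u, v). norm v" "\<lambda>_. \<delta>"] uv
      by (auto simp: sum_list_triv len)
    have *: "norm (unit_diff p (\<lambda>k. differences (map (\<lambda>(u, v). u + real k *\<^sub>R v) uvs) f (x + real k *\<^sub>R 0)))
        \<le> 2 ^ length uvs * (C * (real p * \<delta>) ^ p)"
    proof (rule norm_unit_diff_differences_le[where z = x0 and \<rho> = "norm (x - x0)" and \<beta> = 0])
      fix a b :: 'a assume a: "norm (a - x0) \<le> norm (x - x0) + (\<Sum>(u, v)\<leftarrow>uvs. norm u)"
        and b: "norm b \<le> 0 + (\<Sum>(u, v)\<leftarrow>uvs. norm v)"
      have b': "norm b \<le> real p * \<delta>" using b sv by simp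
      have "real p * \<delta> \<le> real p * s" using hs by (intro mult_left_mono) auto
      moreover have "real p * norm b \<le> real p * (real p * s)" using b' calculation by (intro mult_left_mono) auto
      ultimately have "norm (a - x0) + real p * norm b < r" using a su hs(2) s(2) by linarith
      then have "norm (unit_diff p (\<lambda>k. f (a + real k *\<^sub>R b))) \<le> C * norm b ^ p" by (rule C)
      also have "\<dots> \<le> C * (real p * \<delta>) ^ p" using C0 b' by (intro mult_left_mono power_mono) auto
      finally show "norm (unit_diff p (\<lambda>k. f (a + real k *\<^sub>R b))) \<le> C * (real p * \<delta>) ^ p" .
    qed auto
    have "differences hs f x = unit_diff p (\<lambda>k. differences (map (\<lambda>(u, v). u + real k *\<^sub>R v) uvs) f x)"
      using differences_eq_unit_diff[of hs f x] by (simp add: hs uvs_def o_def case_prod_unfold)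
    then show ?thesis using * by (simp add: len power_mult_distrib mult_ac)
  qed
  then show ?thesis using s C0 by (intro exI[of _ s] conjI exI[of _ "2 ^ p * C * real p ^ p"]) auto
qed

text \<open>A difference with step n h telescopes into n differences with step h at shifted base
  points.\<close>

lemma norm_differences_subdivide:
  fixes f :: "'a::real_normed_vector \<Rightarrow> 'b::real_normed_vector"
  assumes "\<And>y. norm (y - x) \<le> (\<Sum>(n, h)\<leftarrow>ps. real n * norm h) \<Longrightarrow> norm (differences (map snd ps) f y) \<le> M"
  shows "norm (differences (map (\<lambda>(n, h). real n *\<^sub>R h) ps) f x) \<le> real (prod_list (map fst ps)) * M"
  using assms
proof (induction ps arbitrary: f x)
  case (Cons q ps)
  obtain n h where q: "q = (n, h)" by force
  let ?d = "differences (map (\<lambda>(n, h). real n *\<^sub>R h) ps)"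
  let ?g = "\<lambda>y. f (y + h) - f y"
  have step: "norm (?d ?g (x + real j *\<^sub>R h)) \<le> real (prod_list (map fst ps)) * M" if "j < n" for j
  proof (rule Cons.IH)
    fix y assume y: "norm (y - (x + real j *\<^sub>R h)) \<le> (\<Sum>(n, h)\<leftarrow>ps. real n * norm h)"
    have "norm (y - x) \<le> norm (y - (x + real j *\<^sub>R h)) + real j * norm h"
      using norm_triangle_ineq[of "y - (x + real j *\<^sub>R h)" "real j *\<^sub>R h"] by simp
    also have "\<dots> \<le> (\<Sum>(n, h)\<leftarrow>ps. real n * norm h) + real n * norm h"
      using y that by (intro add_mono mult_right_mono) auto
    finally have "norm (differences (map snd (q # ps)) f y) \<le> M"
      by (intro Cons.prems) (simp add: q)
    then show "norm (differences (map snd ps) ?g y) \<le> M" by (simp only: differences_step) (simp add: q)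
  qed
  have "?d f (x + real m *\<^sub>R h) - ?d f x = (\<Sum>j<m. ?d ?g (x + real j *\<^sub>R h))" for m
  proof (induction m)
    case (Suc m)
    have "x + real (Suc m) *\<^sub>R h = (x + real m *\<^sub>R h) + h" by (simp add: algebra_simps)
    then have "?d f (x + real (Suc m) *\<^sub>R h) - ?d f (x + real m *\<^sub>R h) = ?d ?g (x + real m *\<^sub>R h)"
      by (simp only: differences_step) simp
    with Suc show ?case by (simp only: sum.lessThan_Suc) (simp add: algebra_simps)
  qed simp
  then have "differences (map (\<lambda>(n, h). real n *\<^sub>R h) (q # ps)) f x = (\<Sum>j<n. ?d ?g (x + real j *\<^sub>R h))"
    by (simp add: q)
  also have "norm \<dots> \<le> (\<Sum>j<n. real (prod_list (map fst ps)) * M)"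
    using step by (intro sum_norm_le) auto
  finally show ?case by (simp add: q mult_ac)
qed simp

text \<open>All steps are cut into pieces no longer than the shortest step \<delta>. The number of
  small boxes is at most the product of the 2 |h| / \<delta>, and each contributes C \<delta>^p, so
  the powers of \<delta> cancel.\<close>

lemma smooth_along_bounded_differences:
  fixes f :: "'a::banach \<Rightarrow> 'b::real_normed_vector"
  assumes f: "smooth_along f"
  shows "bounded_differences f"
  unfolding bounded_differences_def
proof (intro allI)
  fix x0 p
  obtain r C where r: "r > 0" and C0: "C \<ge> 0"
    and C: "\<And>x hs \<delta>. length hs = p \<Longrightarrow> norm (x - x0) < r \<Longrightarrow> \<delta> < r \<Longrightarrow>
     (\<forall>h\<in>set hs. norm h \<le> \<delta>) \<Longrightarrow> norm (differences hs f x) \<le> C * \<delta> ^ p"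
    using smooth_along_difference_bound[OF f] by metis
  define s where "s = r / (1 + real p)"
  have "s * (1 + real p) = r" by (simp add: s_def)
  then have s: "s > 0" "s + real p * s = r" using r by (simp add: s_def, simp add: algebra_simps)
  have "norm (differences hs f x) \<le> (2 ^ p * C) * prod_list (map norm hs)"
    if hs: "length hs = p" "norm (x - x0) < s" "\<forall>h\<in>set hs. norm h < s" for x hs
  proof (cases "0 \<in> set hs")
    case True
    then show ?thesis using C0 by (auto simp: differences_eq_0 intro!: mult_nonneg_nonneg prod_list_nonneg)
  next
    case False
    \<comment> \<open>The entry r / 2 keeps \<delta> below r and the minimum defined for an empty
      list; nonzero steps make \<delta> positive.\<close>
    define \<delta> where "\<delta> = Min (insert (r / 2) (norm ` set hs))"
    have \<delta>: "\<delta> > 0" "\<delta> < r" "\<And>h. h \<in> set hs \<Longrightarrow> \<delta> \<le> norm h"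
    proof -
      show "\<delta> > 0" unfolding \<delta>_def using r False by (subst Min_gr_iff) auto
      have "\<delta> \<le> r / 2" unfolding \<delta>_def by (rule Min_le) auto
      then show "\<delta> < r" using r by simp
    qed (auto simp: \<delta>_def)
    define N where "N h = nat \<lceil>norm h / \<delta>\<rceil>" for h :: 'a
    have N: "real (N h) * \<delta> \<ge> norm h" "real (N h) * \<delta> \<le> 2 * norm h" "N h > 0" if "h \<in> set hs" for h
    proof -
      have ge: "norm h / \<delta> \<ge> 1" using \<delta> that by simp
      have eq: "real (N h) = of_int \<lceil>norm h / \<delta>\<rceil>" using ge unfolding N_def by (subst of_nat_nat) linarith+
      have "real (N h) \<ge> norm h / \<delta>" "real (N h) \<le> norm h / \<delta> + 1" unfolding eq by linarith+
      then show "real (N h) * \<delta> \<ge> norm h" "real (N h) * \<delta> \<le> 2 * norm h" "N h > 0"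
        using \<delta>(1) \<delta>(3)[OF that] ge by (auto simp: field_simps intro!: gr0I)
    qed
    have Nnz: "N h \<noteq> 0" if "h \<in> set hs" for h using N(3)[OF that] by simp
    define ps where "ps = map (\<lambda>h. (N h, (1 / real (N h)) *\<^sub>R h)) hs"
    have snd: "\<forall>h\<in>set (map snd ps). norm h \<le> \<delta>"
      using N by (auto simp: ps_def field_simps)
    have ps: "map (\<lambda>(n, h). real n *\<^sub>R h) ps = hs"
      unfolding ps_def map_map by (rule map_idI) (simp add: Nnz)
    have "(\<Sum>(n, h)\<leftarrow>ps. real n * norm h) = (\<Sum>h\<leftarrow>hs. norm h)"
      unfolding ps_def map_map by (rule arg_cong[where f = sum_list], rule map_cong) (simp_all add: Nnz)
    also have "\<dots> \<le> (\<Sum>h\<leftarrow>hs. s)" by (rule sum_list_mono) (use hs(3) in \<open>auto intro: less_imp_le\<close>)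
    finally have sum: "(\<Sum>(n, h)\<leftarrow>ps. real n * norm h) \<le> real p * s" by (simp add: sum_list_triv hs)
    have "norm (differences (map (\<lambda>(n, h). real n *\<^sub>R h) ps) f x) \<le> real (prod_list (map fst ps)) * (C * \<delta> ^ p)"
    proof (rule norm_differences_subdivide)
      fix y assume "norm (y - x) \<le> (\<Sum>(n, h)\<leftarrow>ps. real n * norm h)"
      then have "norm (y - x0) < r"
        using norm_triangle_ineq[of "y - x" "x - x0"] sum hs(2) s(2) by simp
      then show "norm (differences (map snd ps) f y) \<le> C * \<delta> ^ p"
        by (intro C snd \<delta>(2)) (simp_all add: ps_def hs)
    qed
    also have "real (prod_list (map fst ps)) * (C * \<delta> ^ p) = C * (real (prod_list (map fst ps)) * \<delta> ^ p)" by simp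
    also have "\<dots> \<le> C * (2 ^ p * prod_list (map norm hs))"
    proof (rule mult_left_mono[OF _ C0])
      show "real (prod_list (map fst ps)) * \<delta> ^ p \<le> 2 ^ p * prod_list (map norm hs)"
      proof -
      have "real (prod_list (map N hs)) * \<delta> ^ length hs \<le> 2 ^ length hs * prod_list (map norm hs)"
        using N(2) \<delta>(1)
      proof (induction hs)
        case (Cons h hs)
        have "(real (N h) * \<delta>) * (real (prod_list (map N hs)) * \<delta> ^ length hs)
          \<le> (2 * norm h) * (2 ^ length hs * prod_list (map norm hs))"
          by (rule mult_mono) (use Cons in auto)
        then show ?case by (simp add: mult_ac)
      qed simp
      then show ?thesis by (simp add: ps_def hs o_def)
      qed
    qed
    finally show ?thesis by (simp add: ps mult_ac)
  qed
  then show "\<exists>r>0. \<exists>C\<ge>0. \<forall>x hs. length hs = p \<longrightarrow> norm (x - x0) < r \<longrightarrow>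
     (\<forall>h\<in>set hs. norm h < r) \<longrightarrow> norm (differences hs f x) \<le> C * prod_list (map norm hs)"
    using s C0 by (intro exI[of _ s] conjI exI[of _ "2 ^ p * C"]) auto
qed

section \<open>Directional derivatives of maps preserving smooth curves\<close>

lemma has_vector_derivative_iff_offset:
  "(f has_vector_derivative l) (at t) \<longleftrightarrow> ((\<lambda>s. (1 / s) *\<^sub>R (f (t + s) - f t)) \<longlongrightarrow> l) (at 0)"
  unfolding has_vector_derivative_iff_quotient
  using LIM_offset_zero[where f = "\<lambda>s. (1 / (s - t)) *\<^sub>R (f s - f t)" and a = t and L = l]
    LIM_offset_zero_cancel[where f = "\<lambda>s. (1 / (s - t)) *\<^sub>R (f s - f t)" and a = t and L = l] by auto

text \<open>A p-th difference of (f(y + s e) - f y) / s is a (p + 1)-st difference of f divided by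
  s. Its bound contains |s e|, so it is uniform in s and survives the limit.\<close>

lemma bounded_differences_directional:
  fixes f :: "'a::real_normed_vector \<Rightarrow> 'b::real_normed_vector"
  assumes f: "bounded_differences f"
    and F: "\<And>x. ((\<lambda>s. (1 / s) *\<^sub>R (f (x + s *\<^sub>R e) - f x)) \<longlongrightarrow> F x) (at 0)"
  shows "bounded_differences F"
  unfolding bounded_differences_def
proof (intro allI)
  fix x0 p
  obtain r C where r: "r > 0" "C \<ge> 0" and C: "\<And>x hs. length hs = Suc p \<Longrightarrow> norm (x - x0) < r \<Longrightarrow>
     \<forall>h\<in>set hs. norm h < r \<Longrightarrow> norm (differences hs f x) \<le> C * prod_list (map norm hs)"
    using f unfolding bounded_differences_def by metis
  have "norm (differences hs F x) \<le> (C * norm e) * prod_list (map norm hs)"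
    if hs: "length hs = p" "norm (x - x0) < r" "\<forall>h\<in>set hs. norm h < r" for x hs
  proof (rule Lim_norm_ubound)
    show "((\<lambda>s. differences hs (\<lambda>y. (1 / s) *\<^sub>R (f (y + s *\<^sub>R e) - f y)) x) \<longlongrightarrow> differences hs F x) (at 0)"
      by (rule tendsto_differences[OF F])
    have "((\<lambda>s. norm (s *\<^sub>R e)) \<longlongrightarrow> 0) (at 0)" by (auto intro!: tendsto_eq_intros)
    then have "\<forall>\<^sub>F s in at 0. norm (s *\<^sub>R e) < r" using r by (simp add: order_tendstoD)
    moreover have "\<forall>\<^sub>F s in at 0. s \<noteq> (0::real)" by (simp add: eventually_at_filter)
    ultimately show "\<forall>\<^sub>F s in at 0. norm (differences hs (\<lambda>y. (1 / s) *\<^sub>R (f (y + s *\<^sub>R e) - f y)) x)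
        \<le> (C * norm e) * prod_list (map norm hs)"
    proof eventually_elim
      case (elim s)
      define Y where "Y = differences (s *\<^sub>R e # hs) f x"
      have "norm Y \<le> C * prod_list (map norm (s *\<^sub>R e # hs))"
        unfolding Y_def by (rule C) (use elim hs in auto)
      moreover have "differences hs (\<lambda>y. (1 / s) *\<^sub>R (f (y + s *\<^sub>R e) - f y)) x
          = (1 / s) *\<^sub>R Y"
        by (simp only: differences_scaleR differences_step Y_def)
      ultimately show ?case using elim by (simp add: divide_le_eq mult_ac)
    qed
  qed simp
  then show "\<exists>r>0. \<exists>C\<ge>0. \<forall>x hs. length hs = p \<longrightarrow> norm (x - x0) < r \<longrightarrow>
     (\<forall>h\<in>set hs. norm h < r) \<longrightarrow> norm (differences hs F x) \<le> C * prod_list (map norm hs)"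
    using r by (intro exI[of _ r] conjI exI[of _ "C * norm e"]) auto
qed

text \<open>The difference quotients \<open>q h\<close> form a Cauchy net: \<open>q h\<close> and \<open>q (h / n)\<close> differ by
  \<open>O(h)\<close>, and suitable \<open>x / n\<close> and \<open>y / m\<close> have a ratio arbitrarily close to 1.\<close>

lemma bounded_differences_differentiable:
  fixes D :: "real \<Rightarrow> 'b::{real_normed_vector, complete_space}"
  assumes "bounded_differences D"
  shows "\<exists>l. (D has_vector_derivative l) (at t)"
proof -
  obtain r1 C1 where r1: "r1 > 0" "C1 \<ge> 0" and C1: "\<And>x hs. length hs = 1 \<Longrightarrow> norm (x - t) < r1 \<Longrightarrow>
     \<forall>h\<in>set hs. norm h < r1 \<Longrightarrow> norm (differences hs D x) \<le> C1 * prod_list (map norm hs)"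
    using assms unfolding bounded_differences_def by metis
  obtain r2 C2 where r2: "r2 > 0" "C2 \<ge> 0" and C2: "\<And>x hs. length hs = 2 \<Longrightarrow> norm (x - t) < r2 \<Longrightarrow>
     \<forall>h\<in>set hs. norm h < r2 \<Longrightarrow> norm (differences hs D x) \<le> C2 * prod_list (map norm hs)"
    using assms unfolding bounded_differences_def by metis
  define r where "r = min r1 r2 / 2"
  have r: "r > 0" "2 * r \<le> r1" "2 * r \<le> r2" using r1 r2 by (auto simp: r_def)
  define \<phi> where "\<phi> a = D (t + a) - D t" for a
  define q where "q a = (1 / a) *\<^sub>R \<phi> a" for a
  have B1: "norm (\<phi> a - \<phi> b) \<le> C1 * \<bar>a - b\<bar>" if "\<bar>a\<bar> < r" "\<bar>b\<bar> < r" for a b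
    using C1[of "[a - b]" "t + b"] that r by (simp add: \<phi>_def algebra_simps)
  have \<phi>0: "\<phi> 0 = 0" by (simp add: \<phi>_def)
  have B2: "norm (\<phi> (a + b) - \<phi> a - \<phi> b) \<le> C2 * (\<bar>a\<bar> * \<bar>b\<bar>)" if "\<bar>a\<bar> < r" "\<bar>b\<bar> < r" for a b
    using C2[of "[a, b]" t] that r by (simp add: \<phi>_def algebra_simps)
  \<comment> \<open>By the second differences \<phi> is additive up to C2 |a| |b|; adding a up n
    times accumulates a defect quadratic in n |a|.\<close>
  have K1: "norm (\<phi> (real n * a) - real n *\<^sub>R \<phi> a) \<le> C2 * (real n * \<bar>a\<bar>)\<^sup>2" if "real n * \<bar>a\<bar> < r" for n a
    using that
  proof (induction n)
    case (Suc n)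
    have na: "real n * \<bar>a\<bar> < r" using Suc.prems by (simp add: algebra_simps)
    show ?case
    proof (cases "n = 0")
      case False
      then have a: "\<bar>a\<bar> \<le> real n * \<bar>a\<bar>" by (simp add: mult_le_cancel_right1)
      have "norm (\<phi> (real n * a + a) - \<phi> (real n * a) - \<phi> a) \<le> C2 * (\<bar>real n * a\<bar> * \<bar>a\<bar>)"
        by (rule B2) (use na a in \<open>auto simp: abs_mult\<close>)
      then have "norm (\<phi> (real (Suc n) * a) - \<phi> (real n * a) - \<phi> a) \<le> C2 * ((real n * \<bar>a\<bar>) * \<bar>a\<bar>)"
        by (simp add: algebra_simps abs_mult)
      moreover have "\<phi> (real (Suc n) * a) - real (Suc n) *\<^sub>R \<phi> a
          = (\<phi> (real (Suc n) * a) - \<phi> (real n * a) - \<phi> a) + (\<phi> (real n * a) - real n *\<^sub>R \<phi> a)"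
        by (simp add: algebra_simps)
      ultimately have "norm (\<phi> (real (Suc n) * a) - real (Suc n) *\<^sub>R \<phi> a)
          \<le> C2 * ((real n * \<bar>a\<bar>) * \<bar>a\<bar>) + C2 * (real n * \<bar>a\<bar>)\<^sup>2"
        using norm_triangle_mono[OF _ Suc.IH[OF na]] by metis
      also have "\<dots> = C2 * ((real n * \<bar>a\<bar>) * \<bar>a\<bar> + (real n * \<bar>a\<bar>)\<^sup>2)" by (simp add: algebra_simps)
      also have "\<dots> \<le> C2 * (real (Suc n) * \<bar>a\<bar>)\<^sup>2"
        using r2 by (intro mult_left_mono) (auto simp: power2_eq_square algebra_simps)
      finally show ?thesis .
    qed (use r2 in simp)
  qed (simp add: \<phi>0)
  have quot: "norm ((1 / x) *\<^sub>R Y) \<le> C2 * \<bar>x\<bar>" if "norm Y \<le> C2 * \<bar>x\<bar>\<^sup>2" "x \<noteq> 0" for x and Y :: 'b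
    using that by (simp add: divide_le_eq power2_eq_square mult_ac)
  have K2: "norm (q x - q (x / real n)) \<le> C2 * \<bar>x\<bar>" if "\<bar>x\<bar> < r" "x \<noteq> 0" "n > 0" for x n
  proof -
    have "norm (\<phi> x - real n *\<^sub>R \<phi> (x / real n)) \<le> C2 * \<bar>x\<bar>\<^sup>2"
      using K1[of n "x / real n"] that by simp
    moreover have "q x - q (x / real n) = (1 / x) *\<^sub>R (\<phi> x - real n *\<^sub>R \<phi> (x / real n))"
      using that by (simp add: q_def scaleR_diff_right)
    ultimately show ?thesis using quot that(2) by simp
  qed
  have K3: "norm (q x - q y) \<le> C2 * (\<bar>x\<bar> + \<bar>y\<bar>)" if x: "\<bar>x\<bar> < r" and y: "\<bar>y\<bar> < r" and xy: "x * y > 0" for x y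
  proof -
    have nz: "x \<noteq> 0" "y \<noteq> 0" "x / y > 0" "y / x > 0" using xy by (auto simp: zero_less_mult_iff zero_less_divide_iff)
    have "norm (q x - q y) \<le> C2 * (\<bar>x\<bar> + \<bar>y\<bar>) + 2 * C1 * (y / x) * inverse (real (Suc m))" for m
    proof -
      \<comment> \<open>This integer makes b / a = n (y / x) / (m + 1) at least 1 and at most 1 + (y
        / x) / (m + 1).\<close>
      define n where "n = nat \<lceil>real (Suc m) * (x / y)\<rceil>"
      have pos: "real (Suc m) * (x / y) > 0" using nz(3) by (intro mult_pos_pos) auto
      then have n_eq: "real n = of_int \<lceil>real (Suc m) * (x / y)\<rceil>"
        unfolding n_def by (subst of_nat_nat) linarith+
      have n: "real n \<ge> real (Suc m) * (x / y)" "real n \<le> real (Suc m) * (x / y) + 1"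
        unfolding n_eq by linarith+
      then have n0: "n > 0" using pos by (cases n) auto
      define a b where "a = x / real n" and "b = y / real (Suc m)"
      have ab: "a \<noteq> 0" "b \<noteq> 0" using nz n0 by (auto simp: a_def b_def)
      have "\<bar>a\<bar> \<le> \<bar>x\<bar>" "\<bar>b\<bar> \<le> \<bar>y\<bar>"
        using n0 by (auto simp: a_def b_def divide_le_eq mult_le_cancel_left1)
      then have abr: "\<bar>a\<bar> < r" "\<bar>b\<bar> < r" using x y by auto
      have ba: "b / a = real n * (y / x) * inverse (real (Suc m))"
        using nz n0 by (simp add: a_def b_def field_simps)
      have "b / a \<ge> real (Suc m) * (x / y) * ((y / x) * inverse (real (Suc m)))"
        unfolding ba mult.assoc by (rule mult_right_mono[OF n(1), unfolded mult.assoc]) (use nz(4) in \<open>auto intro!: mult_nonneg_nonneg less_imp_le[OF nz(4)] simp del: times_divide_eq_left\<close>)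
      then have ge: "b / a \<ge> 1" using nz by simp
      have "b / a \<le> (real (Suc m) * (x / y) + 1) * ((y / x) * inverse (real (Suc m)))"
        unfolding ba mult.assoc by (rule mult_right_mono[OF n(2), unfolded mult.assoc]) (use nz(4) in \<open>auto intro!: mult_nonneg_nonneg less_imp_le[OF nz(4)] simp del: times_divide_eq_left\<close>)
      moreover have "real (Suc m) * (x / y) * ((y / x) * inverse (real (Suc m))) = 1" using nz by simp
      ultimately have le: "b / a \<le> 1 + (y / x) * inverse (real (Suc m))" by (simp only: distrib_right mult_1)
      have rat: "\<bar>a - b\<bar> / \<bar>a\<bar> \<le> (y / x) * inverse (real (Suc m))"
      proof -
        have "\<bar>a - b\<bar> / \<bar>a\<bar> = \<bar>1 - b / a\<bar>" using ab by (simp flip: abs_divide add: diff_divide_distrib)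
        then show ?thesis using ge le by simp
      qed
      have "q a - q b = (1 / a) *\<^sub>R (\<phi> a - \<phi> b) + ((b - a) / a) *\<^sub>R ((1 / b) *\<^sub>R \<phi> b)"
        using ab by (simp add: q_def algebra_simps diff_divide_distrib)
      also have "norm \<dots> \<le> (1 / \<bar>a\<bar>) * (C1 * \<bar>a - b\<bar>) + (\<bar>b - a\<bar> / \<bar>a\<bar>) * ((1 / \<bar>b\<bar>) * (C1 * \<bar>b\<bar>))"
      proof (rule norm_triangle_le, rule add_mono)
        show "norm ((1 / a) *\<^sub>R (\<phi> a - \<phi> b)) \<le> (1 / \<bar>a\<bar>) * (C1 * \<bar>a - b\<bar>)"
          unfolding norm_scaleR by (rule mult_mono) (use B1 abr in auto)
        show "norm (((b - a) / a) *\<^sub>R ((1 / b) *\<^sub>R \<phi> b)) \<le> (\<bar>b - a\<bar> / \<bar>a\<bar>) * ((1 / \<bar>b\<bar>) * (C1 * \<bar>b\<bar>))"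
          unfolding norm_scaleR using B1[of b 0] abr r1(2) r(1) by (intro mult_mono) (auto simp: \<phi>0)
      qed
      also have "\<dots> = 2 * C1 * (\<bar>a - b\<bar> / \<bar>a\<bar>)" using ab by (simp add: abs_minus_commute)
      also have "\<dots> \<le> 2 * C1 * ((y / x) * inverse (real (Suc m)))" using rat r1 by (intro mult_left_mono) auto
      finally have 3: "norm (q a - q b) \<le> 2 * C1 * ((y / x) * inverse (real (Suc m)))" .
      have 1: "norm (q x - q a) \<le> C2 * \<bar>x\<bar>" unfolding a_def using K2 x nz n0 by blast
      have 2: "norm (q y - q b) \<le> C2 * \<bar>y\<bar>" unfolding b_def using K2 y nz by blast
      have "q x - q y = (q x - q a) + ((q a - q b) - (q y - q b))" by simp
      then have "norm (q x - q y) \<le> norm (q x - q a) + (norm (q a - q b) + norm (q y - q b))"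
        using norm_triangle_ineq norm_triangle_ineq4 by (metis add_left_mono order_trans)
      then show ?thesis using 1 2 3 by (simp add: algebra_simps)
    qed
    moreover have "(\<lambda>m. C2 * (\<bar>x\<bar> + \<bar>y\<bar>) + 2 * C1 * (y / x) * inverse (real (Suc m))) \<longlonglongrightarrow> C2 * (\<bar>x\<bar> + \<bar>y\<bar>) + 2 * C1 * (y / x) * 0"
      by (intro tendsto_intros LIMSEQ_inverse_real_of_nat)
    ultimately show ?thesis using LIMSEQ_le_const by fastforce
  qed
  \<comment> \<open>Opposite signs are compared by reflection: \<phi>(x) + \<phi>(-x) is, up to
    sign, a second difference, as \<phi>(0) = 0.\<close>
  have K4: "norm (q x - q (- x)) \<le> C2 * \<bar>x\<bar>" if "\<bar>x\<bar> < r" "x \<noteq> 0" for x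
  proof -
    have "norm (\<phi> x + \<phi> (- x)) \<le> C2 * \<bar>x\<bar>\<^sup>2"
      using B2[of x "- x"] that by (simp add: \<phi>0 norm_minus_commute power2_eq_square algebra_simps)
        (metis add.commute diff_minus_eq_add norm_minus_cancel minus_diff_eq minus_minus)
    moreover have "q x - q (- x) = (1 / x) *\<^sub>R (\<phi> x + \<phi> (- x))" by (simp add: q_def algebra_simps)
    ultimately show ?thesis using quot that(2) by simp
  qed
  have K: "norm (q x - q y) \<le> 2 * C2 * (\<bar>x\<bar> + \<bar>y\<bar>)" if "\<bar>x\<bar> < r" "\<bar>y\<bar> < r" "x \<noteq> 0" "y \<noteq> 0" for x y
  proof (cases "x * y > 0")
    case True
    have "0 \<le> C2 * (\<bar>x\<bar> + \<bar>y\<bar>)" using r2(2) by simp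
    then show ?thesis using K3[OF that(1,2) True] by linarith
  next
    case False
    moreover have "x * y \<noteq> 0" using that by simp
    ultimately have "- x * y > 0" by (simp only: mult_minus_left)
    then have "norm (q (- x) - q y) \<le> C2 * (\<bar>x\<bar> + \<bar>y\<bar>)" using K3[of "- x" y] that by simp
    moreover have "norm (q x - q y) \<le> norm (q x - q (- x)) + norm (q (- x) - q y)"
      using norm_triangle_ineq[of "q x - q (- x)" "q (- x) - q y"] by simp
    ultimately have "norm (q x - q y) \<le> C2 * \<bar>x\<bar> + C2 * (\<bar>x\<bar> + \<bar>y\<bar>)" using K4[of x] that by linarith
    moreover have "0 \<le> C2 * \<bar>y\<bar>" using r2 by simp
    ultimately show ?thesis by (simp add: algebra_simps)
  qed
  define z where "z n = (r / 2) * inverse (real (Suc n))" for n :: nat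
  have z: "\<bar>z n\<bar> < r" "z n \<noteq> 0" for n
  proof -
    have "(r / 2) * inverse (real (Suc n)) \<le> (r / 2) * 1"
      using r(1) by (intro mult_left_mono) (auto simp: inverse_le_1_iff)
    moreover have "z n > 0" using r(1) by (simp add: z_def)
    ultimately show "\<bar>z n\<bar> < r" "z n \<noteq> 0" using r(1) unfolding z_def by linarith+
  qed
  have "z \<longlonglongrightarrow> (r / 2) * 0" unfolding z_def by (intro tendsto_intros LIMSEQ_inverse_real_of_nat)
  then have z0: "z \<longlonglongrightarrow> 0" by simp
  have "Cauchy (\<lambda>n. q (z n))"
  proof (rule CauchyI)
    fix e :: real assume e: "e > 0"
    have "(\<lambda>n. 2 * C2 * (\<bar>z n\<bar> + \<bar>z n\<bar>)) \<longlonglongrightarrow> 2 * C2 * (\<bar>0\<bar> + \<bar>0\<bar>)" by (intro tendsto_intros z0)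
    then have "\<forall>\<^sub>F n in sequentially. 2 * C2 * (\<bar>z n\<bar> + \<bar>z n\<bar>) < e" by (rule order_tendstoD) (use e in simp)
    then obtain M where M: "\<And>n. n \<ge> M \<Longrightarrow> 2 * C2 * (\<bar>z n\<bar> + \<bar>z n\<bar>) < e" by (auto simp: eventually_sequentially)
    show "\<exists>M. \<forall>m\<ge>M. \<forall>n\<ge>M. norm (q (z m) - q (z n)) < e"
    proof (intro exI[of _ M] allI impI)
      fix m n assume mn: "M \<le> m" "M \<le> n"
      have "norm (q (z m) - q (z n)) \<le> 2 * C2 * (\<bar>z m\<bar> + \<bar>z n\<bar>)" by (intro K z)
      moreover have "2 * (2 * C2 * (\<bar>z m\<bar> + \<bar>z n\<bar>)) = 2 * C2 * (\<bar>z m\<bar> + \<bar>z m\<bar>) + 2 * C2 * (\<bar>z n\<bar> + \<bar>z n\<bar>)"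
        by (simp add: algebra_simps)
      ultimately show "norm (q (z m) - q (z n)) < e" using M[OF mn(1)] M[OF mn(2)] by linarith
    qed
  qed
  then obtain l where l: "(\<lambda>n. q (z n)) \<longlonglongrightarrow> l" using Cauchy_convergent_iff convergent_def by blast
  have ql: "norm (q x - l) \<le> 2 * C2 * \<bar>x\<bar>" if "\<bar>x\<bar> < r" "x \<noteq> 0" for x
  proof (rule LIMSEQ_le)
    show "(\<lambda>n. norm (q x - q (z n))) \<longlonglongrightarrow> norm (q x - l)" by (intro tendsto_intros l)
    have "(\<lambda>n. 2 * C2 * (\<bar>x\<bar> + \<bar>z n\<bar>)) \<longlonglongrightarrow> 2 * C2 * (\<bar>x\<bar> + \<bar>0\<bar>)" by (intro tendsto_intros z0)
    then show "(\<lambda>n. 2 * C2 * (\<bar>x\<bar> + \<bar>z n\<bar>)) \<longlonglongrightarrow> 2 * C2 * \<bar>x\<bar>" by simp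
  qed (use K that z in blast)
  have "((\<lambda>s. q s - l) \<longlongrightarrow> 0) (at 0)"
  proof (rule Lim_null_comparison)
    have "((\<lambda>x. 2 * C2 * \<bar>x\<bar>) \<longlongrightarrow> 2 * C2 * \<bar>0\<bar>) (at (0::real))" by (intro tendsto_intros)
    then show "((\<lambda>x. 2 * C2 * \<bar>x\<bar>) \<longlongrightarrow> 0) (at (0::real))" by simp
    show "\<forall>\<^sub>F x in at 0. norm (q x - l) \<le> 2 * C2 * \<bar>x\<bar>"
      using ql r(1) by (auto simp: eventually_at intro!: exI[of _ r])
  qed
  then have "(q \<longlongrightarrow> l) (at 0)" by (simp only: Lim_null[symmetric])
  then have "(D has_vector_derivative l) (at t)"
    unfolding has_vector_derivative_iff_offset by (simp add: q_def[abs_def] \<phi>_def)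
  then show ?thesis by blast
qed

text \<open>The derivative is the directional derivative in direction 1, so the class is stable
  under differentiation.\<close>

lemma csmooth_if_bounded_differences:
  fixes D :: "real \<Rightarrow> 'b::{real_normed_vector, complete_space}"
  assumes "bounded_differences D"
  shows "csmooth D"
proof (rule csmooth_coinduct[of bounded_differences, OF assms])
  fix c :: "real \<Rightarrow> 'b" assume c: "bounded_differences c"
  then obtain c' where c': "\<And>t. (c has_vector_derivative c' t) (at t)"
    using bounded_differences_differentiable by metis
  have "bounded_differences c'"
    by (rule bounded_differences_directional[OF c, where e = 1])
      (use c' in \<open>simp add: has_vector_derivative_iff_offset\<close>)
  with c' show "\<exists>c'. (\<forall>t. (c has_vector_derivative c' t) (at t)) \<and> bounded_differences c'" by blast
qed

definition directional :: "('a::real_normed_vector \<Rightarrow> 'b::real_normed_vector) \<Rightarrow> 'a \<Rightarrow> 'a \<Rightarrow> 'b" where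
  "directional f x v = curve_deriv (\<lambda>s. f (x + s *\<^sub>R v)) 0"

lemma directional_has_vector_derivative:
  assumes "smooth_along f"
  shows "((\<lambda>s. f (x + s *\<^sub>R v)) has_vector_derivative directional f x v) (at 0)"
  unfolding directional_def by (intro csmooth_deriv smooth_alongD[OF assms] csmooth_line)

text \<open>The expression is the s-derivative at s = 0 of G(s, t) = f(x(t) + s v(t)), and G
  preserves smooth curves of the plane. Bounded differences pass from G to this derivative, then to
  the line s = 0, where they imply smoothness.\<close>

lemma csmooth_directional:
  fixes f :: "'a::banach \<Rightarrow> 'b::{real_normed_vector, complete_space}"
  assumes f: "smooth_along f" and x: "csmooth x" and v: "csmooth v"
  shows "csmooth (\<lambda>t. directional f (x t) (v t))"
proof -
  define G where "G p = f (x (snd p) + fst p *\<^sub>R v (snd p))" for p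
  have G: "smooth_along G"
    unfolding smooth_along_def
  proof (intro allI impI)
    fix c :: "real \<Rightarrow> real \<times> real" assume c: "csmooth c"
    note c1 = bounded_linear.csmooth[OF bounded_linear_fst c] and c2 = bounded_linear.csmooth[OF bounded_linear_snd c]
    show "csmooth (\<lambda>t. G (c t))"
      unfolding G_def
      by (intro smooth_alongD[OF f] csmooth_add csmooth_scaleR csmooth_compose[OF x] csmooth_compose[OF v] c1 c2)
  qed
  have F: "bounded_differences (\<lambda>p. directional G p (1, 0))"
    by (rule bounded_differences_directional[OF smooth_along_bounded_differences[OF G], where e = "(1, 0)"])
      (use directional_has_vector_derivative[OF G, of _ "(1, 0)", unfolded has_vector_derivative_iff_offset] in \<open>simp flip: zero_prod_def\<close>)
  have "bounded_differences (\<lambda>t. directional G (0, t) (1, 0))"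
    unfolding bounded_differences_def
  proof (intro allI)
    fix t0 p
    obtain r C where r: "r > 0" "C \<ge> 0" and C: "\<And>x hs. length hs = p \<Longrightarrow> norm (x - (0, t0)) < r \<Longrightarrow>
     \<forall>h\<in>set hs. norm h < r \<Longrightarrow> norm (differences hs (\<lambda>p. directional G p (1, 0)) x) \<le> C * prod_list (map norm hs)"
      using F unfolding bounded_differences_def by metis
    have "norm (differences hs (\<lambda>t. directional G (0, t) (1, 0)) t) \<le> C * prod_list (map norm hs)"
      if "length hs = p" "norm (t - t0) < r" "\<forall>h\<in>set hs. norm h < r" for t and hs :: "real list"
      using C[of "map (Pair 0) hs" "(0, t)"] that by (simp add: differences_embed o_def real_norm_def[abs_def])
    with r show "\<exists>r>0. \<exists>C\<ge>0. \<forall>x hs. length hs = p \<longrightarrow> norm (x - t0) < r \<longrightarrow> (\<forall>h\<in>set hs. norm h < r) \<longrightarrow>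
        norm (differences hs (\<lambda>t. directional G (0, t) (1, 0)) x) \<le> C * prod_list (map norm hs)" by blast
  qed
  from csmooth_if_bounded_differences[OF this] show ?thesis by (simp add: directional_def G_def)
qed

lemma smooth_along_local_Lipschitz:
  fixes f :: "'a::banach \<Rightarrow> 'b::real_normed_vector"
  assumes "smooth_along f"
  obtains r C where "r > 0" "C \<ge> 0" "\<And>h. norm h < r \<Longrightarrow> norm (f (x + h) - f x) \<le> C * norm h"
proof -
  obtain r C where r: "r > 0" "C \<ge> 0" and C: "\<And>y hs. length hs = 1 \<Longrightarrow> norm (y - x) < r \<Longrightarrow>
     \<forall>h\<in>set hs. norm h < r \<Longrightarrow> norm (differences hs f y) \<le> C * prod_list (map norm hs)"
    using smooth_along_bounded_differences[OF assms] unfolding bounded_differences_def by metis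
  have "norm (f (x + h) - f x) \<le> C * norm h" if "norm h < r" for h
    using C[of "[h]" x] that r by simp
  with r that show ?thesis by blast
qed

lemma smooth_along_isCont:
  fixes f :: "'a::banach \<Rightarrow> 'b::real_normed_vector"
  assumes "smooth_along f"
  shows "isCont f x"
proof -
  obtain r C where r: "r > 0" and C: "\<And>h. norm h < r \<Longrightarrow> norm (f (x + h) - f x) \<le> C * norm h"
    using smooth_along_local_Lipschitz[OF assms, of x] by blast
  have "((\<lambda>h. f (x + h) - f x) \<longlongrightarrow> 0) (at 0)"
  proof (rule Lim_null_comparison)
    show "\<forall>\<^sub>F h in at 0. norm (f (x + h) - f x) \<le> C * norm h"
      using C r by (auto simp: eventually_at intro!: exI[of _ r])
    have "((\<lambda>h::'a. C * norm h) \<longlongrightarrow> C * norm (0::'a)) (at 0)" by (intro tendsto_intros)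
    then show "((\<lambda>h::'a. C * norm h) \<longlongrightarrow> 0) (at 0)" by simp
  qed
  then show ?thesis unfolding isCont_iff by (simp only: Lim_null[symmetric])
qed

lemma directional_bound:
  fixes f :: "'a::banach \<Rightarrow> 'b::real_normed_vector"
  assumes f: "smooth_along f"
  shows "\<exists>C\<ge>0. \<forall>v. norm (directional f x v) \<le> C * norm v"
proof -
  obtain r C where r: "r > 0" and C0: "C \<ge> 0"
    and C: "\<And>h. norm h < r \<Longrightarrow> norm (f (x + h) - f x) \<le> C * norm h"
    using smooth_along_local_Lipschitz[OF f, of x] by blast
  have "norm (directional f x v) \<le> C * norm v" for v
  proof (rule Lim_norm_ubound)
    show "((\<lambda>s. (1 / s) *\<^sub>R (f (x + s *\<^sub>R v) - f x)) \<longlongrightarrow> directional f x v) (at 0)"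
      using directional_has_vector_derivative[OF f, of x v] by (simp add: has_vector_derivative_iff_offset)
    have "((\<lambda>s. norm (s *\<^sub>R v)) \<longlongrightarrow> 0) (at 0)" by (auto intro!: tendsto_eq_intros)
    then have "\<forall>\<^sub>F s in at 0. norm (s *\<^sub>R v) < r" using r by (simp add: order_tendstoD)
    moreover have "\<forall>\<^sub>F s in at 0. s \<noteq> (0::real)" by (simp add: eventually_at_filter)
    ultimately show "\<forall>\<^sub>F s in at 0. norm ((1 / s) *\<^sub>R (f (x + s *\<^sub>R v) - f x)) \<le> C * norm v"
    proof eventually_elim
      case (elim s)
      then show ?case using C[of "s *\<^sub>R v"] by (simp add: divide_le_eq mult_ac)
    qed
  qed simp
  with C0 show ?thesis by blast
qed

section \<open>Integration and uniform boundedness in complete spaces\<close>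

text \<open>A type variable of sort \<open>real_normed_vector\<close> and \<open>complete_space\<close> is not of the class
  \<open>banach\<close> required by the integration theory; a copy of the type is.\<close>

typedef 'a banach_copy = "UNIV :: 'a set" morphisms of_banach_copy to_banach_copy by simp

setup_lifting type_definition_banach_copy

instantiation banach_copy :: (real_normed_vector) real_normed_vector
begin
lift_definition zero_banach_copy :: "'a banach_copy" is 0 .
lift_definition plus_banach_copy :: "'a banach_copy \<Rightarrow> 'a banach_copy \<Rightarrow> 'a banach_copy" is "(+)" .
lift_definition minus_banach_copy :: "'a banach_copy \<Rightarrow> 'a banach_copy \<Rightarrow> 'a banach_copy" is "(-)" .
lift_definition uminus_banach_copy :: "'a banach_copy \<Rightarrow> 'a banach_copy" is uminus .
lift_definition scaleR_banach_copy :: "real \<Rightarrow> 'a banach_copy \<Rightarrow> 'a banach_copy" is scaleR .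
lift_definition norm_banach_copy :: "'a banach_copy \<Rightarrow> real" is norm .
lift_definition dist_banach_copy :: "'a banach_copy \<Rightarrow> 'a banach_copy \<Rightarrow> real" is dist .
lift_definition sgn_banach_copy :: "'a banach_copy \<Rightarrow> 'a banach_copy" is sgn .
definition uniformity_banach_copy :: "('a banach_copy \<times> 'a banach_copy) filter" where
  "uniformity_banach_copy = (INF e\<in>{0<..}. principal {(x, y). dist x y < e})"
definition open_banach_copy :: "'a banach_copy set \<Rightarrow> bool" where
  "open_banach_copy U \<longleftrightarrow> (\<forall>x\<in>U. \<forall>\<^sub>F (x', y) in uniformity. x' = x \<longrightarrow> y \<in> U)"
instance
proof
  fix x y z :: "'a banach_copy" and a b :: real and U :: "'a banach_copy set"
  show "x + y + z = x + (y + z)" by transfer (rule add.assoc)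
  show "x + y = y + x" by transfer (rule add.commute)
  show "0 + x = x" by transfer (rule add_0)
  show "- x + x = 0" by transfer (rule left_minus)
  show "x - y = x + - y" by transfer (rule diff_conv_add_uminus)
  show "a *\<^sub>R (x + y) = a *\<^sub>R x + a *\<^sub>R y" by transfer (rule scaleR_add_right)
  show "(a + b) *\<^sub>R x = a *\<^sub>R x + b *\<^sub>R x" by transfer (rule scaleR_add_left)
  show "a *\<^sub>R b *\<^sub>R x = (a * b) *\<^sub>R x" by transfer (rule scaleR_scaleR)
  show "1 *\<^sub>R x = x" by transfer (rule scaleR_one)
  show "dist x y = norm (x - y)" by transfer (rule dist_norm)
  show "sgn x = inverse (norm x) *\<^sub>R x" by transfer (rule sgn_div_norm)
  show "norm x = 0 \<longleftrightarrow> x = 0" by transfer (rule norm_eq_zero)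
  show "norm (x + y) \<le> norm x + norm y" by transfer (rule norm_triangle_ineq)
  show "norm (a *\<^sub>R x) = \<bar>a\<bar> * norm x" by transfer (rule norm_scaleR)
qed (simp_all add: uniformity_banach_copy_def open_banach_copy_def)
end

instance banach_copy :: ("{real_normed_vector, complete_space}") complete_space
proof
  fix X :: "nat \<Rightarrow> 'a banach_copy" assume "Cauchy X"
  then have "Cauchy (\<lambda>n. of_banach_copy (X n))" by (simp add: Cauchy_def dist_banach_copy.rep_eq)
  then obtain l where "(\<lambda>n. of_banach_copy (X n)) \<longlonglongrightarrow> l" using Cauchy_convergent_iff convergent_def by blast
  then have "X \<longlonglongrightarrow> to_banach_copy l" by (simp add: lim_sequentially dist_banach_copy.rep_eq to_banach_copy_inverse)
  then show "convergent X" by (auto simp: convergent_def)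
qed

instance banach_copy :: ("{real_normed_vector, complete_space}") banach ..

lemma integrable_continuous_complete:
  fixes f :: "real \<Rightarrow> 'a::{real_normed_vector, complete_space}"
  assumes "continuous_on {a..b} f"
  shows "f integrable_on {a..b}"
proof -
  have lin: "bounded_linear (of_banach_copy :: 'a banach_copy \<Rightarrow> 'a)"
    by (rule bounded_linear_intro[where K = 1]) (simp_all add: plus_banach_copy.rep_eq scaleR_banach_copy.rep_eq norm_banach_copy.rep_eq)
  have "bounded_linear (to_banach_copy :: 'a \<Rightarrow> 'a banach_copy)"
    by (rule bounded_linear_intro[where K = 1])
      (simp_all add: plus_banach_copy.abs_eq scaleR_banach_copy.abs_eq norm_banach_copy.abs_eq eq_onp_same_args)
  then have "(\<lambda>x. to_banach_copy (f x)) integrable_on {a..b}"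
    by (rule integrable_continuous_real[OF bounded_linear.continuous_on[OF _ assms]])
  from integrable_linear[OF this lin] show ?thesis by (simp add: o_def to_banach_copy_inverse)
qed

text \<open>The explicit tail bound is what counts: it keeps the gliding hump large and the smooth
  approximation close.\<close>

lemma geometric_Cauchy:
  fixes X :: "nat \<Rightarrow> 'a::{real_normed_vector, complete_space}"
  assumes r: "0 \<le> r" "r < 1" and X: "\<And>n. norm (X (Suc n) - X n) \<le> K * r ^ n"
  shows "\<exists>x. X \<longlonglongrightarrow> x \<and> (\<forall>n. norm (x - X n) \<le> K * r ^ n / (1 - r))"
proof -
  have K: "K \<ge> 0" using order_trans[OF norm_ge_zero X[of 0]] by simp
  have d: "norm (X (n + k) - X n) \<le> K * r ^ n * (1 - r ^ k) / (1 - r)" for n k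
  proof (induction k)
    case (Suc k)
    have "norm (X (n + Suc k) - X n) \<le> norm (X (Suc (n + k)) - X (n + k)) + norm (X (n + k) - X n)"
      using norm_triangle_ineq[of "X (Suc (n + k)) - X (n + k)" "X (n + k) - X n"] by simp
    also have "\<dots> \<le> K * r ^ (n + k) + K * r ^ n * (1 - r ^ k) / (1 - r)"
      using X Suc by (intro add_mono)
    also have "\<dots> = K * r ^ n * (1 - r ^ Suc k) / (1 - r)"
      using r(2) by (simp add: power_add field_simps)
    finally show ?case .
  qed simp
  have d': "norm (X (n + k) - X n) \<le> K * r ^ n / (1 - r)" for n k
  proof -
    have "K * r ^ n * (1 - r ^ k) \<le> K * r ^ n * 1" using K r by (intro mult_left_mono) auto
    then have "K * r ^ n * (1 - r ^ k) / (1 - r) \<le> K * r ^ n * 1 / (1 - r)"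
      using r(2) by (intro divide_right_mono) auto
    then show ?thesis using d[of n k] by simp
  qed
  have "(\<lambda>n. 2 * (K * r ^ n / (1 - r))) \<longlonglongrightarrow> 2 * (K * 0 / (1 - r))"
    using r by (intro tendsto_intros LIMSEQ_power_zero) auto
  then have p0: "(\<lambda>n. 2 * (K * r ^ n / (1 - r))) \<longlonglongrightarrow> 0" by simp
  have "Cauchy X"
  proof (rule CauchyI)
    fix e :: real assume "e > 0"
    then obtain M where M: "2 * (K * r ^ M / (1 - r)) < e"
      using order_tendstoD(2)[OF p0] by (auto simp: eventually_sequentially)
    show "\<exists>M. \<forall>m\<ge>M. \<forall>n\<ge>M. norm (X m - X n) < e"
    proof (intro exI[of _ M] allI impI)
      fix m n assume "M \<le> m" "M \<le> n"
      then have "norm (X m - X M) \<le> K * r ^ M / (1 - r)" "norm (X n - X M) \<le> K * r ^ M / (1 - r)"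
        using d'[of M "m - M"] d'[of M "n - M"] by simp_all
      then show "norm (X m - X n) < e"
        using norm_triangle_ineq4[of "X m - X M" "X n - X M"] M by simp
    qed
  qed
  then obtain x where x: "X \<longlonglongrightarrow> x" using Cauchy_convergent_iff convergent_def by blast
  have "norm (x - X n) \<le> K * r ^ n / (1 - r)" for n
  proof (rule LIMSEQ_le_const2)
    show "(\<lambda>k. norm (X (k + n) - X n)) \<longlonglongrightarrow> norm (x - X n)"
      by (intro tendsto_intros LIMSEQ_ignore_initial_segment[OF x])
  qed (use d'[of n] in \<open>auto simp: add.commute\<close>)
  with x show ?thesis by blast
qed

text \<open>Sokal's gliding hump: since one of \<open>x + \<xi>\<close> and \<open>x - \<xi>\<close> has an image of norm at least
  that of \<open>T \<xi>\<close>, the partial sums of \<open>\<Sum> \<plusminus> \<xi>\<^sub>n\<close> can be steered to have large images.\<close>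

lemma uniform_boundedness:
  fixes T :: "'i \<Rightarrow> 'a::{real_normed_vector, complete_space} \<Rightarrow> 'b::real_normed_vector"
  assumes lin: "\<And>i. i \<in> I \<Longrightarrow> bounded_linear (T i)"
    and pw: "\<And>x. \<exists>M. \<forall>i\<in>I. norm (T i x) \<le> M"
  shows "\<exists>M\<ge>0. \<forall>i\<in>I. \<forall>x. norm (T i x) \<le> M * norm x"
proof (rule ccontr)
  assume neg: "\<not> ?thesis"
  have "\<exists>i\<in>I. onorm (T i) > 4 ^ n" for n
  proof (rule ccontr)
    assume "\<not> (\<exists>i\<in>I. onorm (T i) > 4 ^ n)"
    then have "norm (T i x) \<le> 4 ^ n * norm x" if "i \<in> I" for i x
      using onorm[OF lin[OF that], of x] that by (meson mult_right_mono norm_ge_zero not_le order_trans)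
    moreover have "(0::real) \<le> 4 ^ n" by simp
    ultimately show False using neg by blast
  qed
  then obtain i where i: "\<And>n. i n \<in> I" and big: "\<And>n. onorm (T (i n)) > 4 ^ n" by metis
  define N where "N n = onorm (T (i n))" for n
  have N: "N n > 4 ^ n" "N n > 0" for n using big[of n] less_trans[OF zero_less_power[of "4::real" n] big[of n]] by (auto simp: N_def)
  have blin: "bounded_linear (T (i n))" for n using lin i by blast
  \<comment> \<open>With radii 3^-n the tail after stage n is at most (1/2) 3^-n. An image of size
    (2/3) N 3^-n thus keeps (1/6) N 3^-n in the limit, which is unbounded as N > 4^n.\<close>
  have "\<exists>\<xi>. norm \<xi> = (1/3) ^ n \<and> norm (T (i n) \<xi>) \<ge> 2/3 * N n * (1/3) ^ n" for n
  proof -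
    have "\<exists>x. norm (T (i n) x) > 2/3 * N n * norm x"
    proof (rule ccontr)
      assume "\<not> (\<exists>x. norm (T (i n) x) > 2/3 * N n * norm x)"
      then have "onorm (T (i n)) \<le> 2/3 * N n"
        using N(2)[of n] by (intro onorm_bound) (auto simp: not_less)
      then show False using N(2)[of n] by (simp add: N_def)
    qed
    then obtain x where x: "norm (T (i n) x) > 2/3 * N n * norm x" by blast
    interpret bounded_linear "T (i n)" by (rule blin)
    have nz: "norm x > 0" using x by (auto simp: zero)
    show ?thesis
    proof (intro exI[of _ "((1/3) ^ n / norm x) *\<^sub>R x"] conjI)
      show "norm (((1/3) ^ n / norm x) *\<^sub>R x) = (1/3) ^ n" using nz by simp
      have "2/3 * N n * (1/3) ^ n = ((1/3) ^ n / norm x) * (2/3 * N n * norm x)" using nz by simp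
      also have "\<dots> \<le> ((1/3) ^ n / norm x) * norm (T (i n) x)"
        using x by (intro mult_left_mono) auto
      also have "\<dots> = norm (T (i n) (((1/3) ^ n / norm x) *\<^sub>R x))" by (simp add: scaleR)
      finally show "2/3 * N n * (1/3) ^ n \<le> norm (T (i n) (((1/3) ^ n / norm x) *\<^sub>R x))" .
    qed
  qed
  then obtain \<xi> where \<xi>: "\<And>n. norm (\<xi> n) = (1/3) ^ n" "\<And>n. norm (T (i n) (\<xi> n)) \<ge> 2/3 * N n * (1/3) ^ n"
    by metis
  have "\<exists>z. norm (z - x) \<le> (1/3) ^ n \<and> norm (T (i n) z) \<ge> 2/3 * N n * (1/3) ^ n" for n x
  proof -
    interpret bounded_linear "T (i n)" by (rule blin)
    have "2 * norm (T (i n) (\<xi> n)) = norm (T (i n) (x + \<xi> n) - T (i n) (x - \<xi> n))"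
      by (simp add: add diff scaleR_2[symmetric])
    also have "\<dots> \<le> norm (T (i n) (x + \<xi> n)) + norm (T (i n) (x - \<xi> n))" by (rule norm_triangle_ineq4)
    finally have "norm (T (i n) (\<xi> n)) \<le> norm (T (i n) (x + \<xi> n)) \<or> norm (T (i n) (\<xi> n)) \<le> norm (T (i n) (x - \<xi> n))"
      by linarith
    then show ?thesis
    proof
      assume "norm (T (i n) (\<xi> n)) \<le> norm (T (i n) (x + \<xi> n))"
      then show ?thesis using \<xi>[of n] by (intro exI[of _ "x + \<xi> n"]) simp
    next
      assume "norm (T (i n) (\<xi> n)) \<le> norm (T (i n) (x - \<xi> n))"
      then show ?thesis using \<xi>[of n] by (intro exI[of _ "x - \<xi> n"]) simp
    qed
  qed
  then have ex: "\<exists>z. norm (z - x) \<le> (1/3) ^ n \<and> norm (T (i n) z) \<ge> 2/3 * N n * (1/3) ^ n" for n x by blast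
  define step where "step n x = (SOME z. norm (z - x) \<le> (1/3) ^ n \<and> norm (T (i n) z) \<ge> 2/3 * N n * (1/3) ^ n)" for n x
  have nx: "norm (step n x - x) \<le> (1/3) ^ n" "norm (T (i n) (step n x)) \<ge> 2/3 * N n * (1/3) ^ n" for n x
    using someI_ex[OF ex[of x n]] by (simp_all add: step_def)
  define X where "X = rec_nat (step 0 0) (\<lambda>n x. step (Suc n) x)"
  have X0: "X 0 = step 0 0" and XS: "X (Suc n) = step (Suc n) (X n)" for n by (simp_all add: X_def)
  have Xbig: "norm (T (i n) (X n)) \<ge> 2/3 * N n * (1/3) ^ n" for n
    using nx(2)[of n] by (cases n) (simp_all only: X0 XS)
  have "norm (X (Suc n) - X n) \<le> (1/3) * (1/3) ^ n" for n
    using nx(1)[of "Suc n" "X n"] by (simp only: XS power_Suc)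
  from geometric_Cauchy[OF _ _ this] obtain x where x: "\<And>n. norm (x - X n) \<le> (1/3) * (1/3) ^ n / (1 - 1/3)"
    by auto
  have xn: "norm (x - X n) \<le> 1/2 * (1/3) ^ n" for n using x[of n] by simp
  obtain M where M: "\<And>j. j \<in> I \<Longrightarrow> norm (T j x) \<le> M" using pw[of x] by blast
  have "1/6 * (4/3) ^ n \<le> M" for n
  proof -
    interpret bounded_linear "T (i n)" by (rule blin)
    have "norm (T (i n) (X n)) \<le> norm (T (i n) x) + norm (T (i n) (x - X n))"
      using norm_triangle_ineq4[of "T (i n) x" "T (i n) (x - X n)"] by (simp add: diff)
    moreover have "norm (T (i n) (x - X n)) \<le> N n * (1/2 * (1/3) ^ n)"
      by (rule order_trans[OF onorm[OF blin]], unfold N_def[symmetric], rule mult_left_mono[OF xn])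
        (use N(2)[of n] in simp)
    moreover note Xbig[of n] M[OF i[of n]]
    ultimately have "1/6 * (N n * (1/3) ^ n) \<le> M" by (simp add: algebra_simps)
    moreover have "4 ^ n * (1/3) ^ n \<le> N n * (1/3) ^ n" using N(1)[of n] by (intro mult_right_mono) auto
    moreover have "(4::real) ^ n * (1/3) ^ n = (4/3) ^ n" by (simp flip: power_mult_distrib)
    ultimately show ?thesis by linarith
  qed
  then have "(4/3) ^ n \<le> 6 * M" for n by (simp add: field_simps)
  moreover obtain n where "6 * M < (4/3) ^ n" using real_arch_pow[of "4/3" "6 * M"] by auto
  ultimately show False by (meson not_less)
qed

section \<open>The shift semigroup and its generator\<close>

lemma has_vector_derivative_shift_within:
  assumes "(f has_real_derivative D) (at (s + x) within {0..})" "(\<lambda>s. s + x) ` T \<subseteq> {0..}"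
  shows "((\<lambda>s. f (s + x)) has_vector_derivative D) (at s within T)"
proof -
  have "((\<lambda>s. s + x) has_real_derivative 1) (at s within T)" by (auto intro!: derivative_eq_intros)
  from DERIV_image_chain[OF DERIV_subset[OF assms] this]
  show ?thesis by (simp add: o_def has_real_derivative_iff_has_vector_derivative)
qed

context forward_curve_space
begin

abbreviation "S \<equiv> shift ev"
abbreviation "A \<equiv> opA ev"

lemma ev_elem:
  assumes "in_space ev u" "x \<ge> 0"
  shows "ev (elem ev u) x = u x"
proof -
  obtain h where h: "\<And>x. x \<ge> 0 \<Longrightarrow> ev h x = u x" using assms(1) by (auto simp: in_space_def)
  have "elem ev u = h" unfolding elem_def
    by (rule the_equality) (use h ev_inject in auto)
  with h assms(2) show ?thesis by simp
qed

lemma ev_shift: "t \<ge> 0 \<Longrightarrow> x \<ge> 0 \<Longrightarrow> ev (S t h) x = ev h (t + x)"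
  unfolding shift_def by (rule ev_elem[OF shift_in_space])

lemma ev_simps:
  assumes "x \<ge> 0"
  shows "ev (a + b) x = ev a x + ev b x" "ev (a - b) x = ev a x - ev b x"
    "ev (r *\<^sub>R a) x = r * ev a x" "ev 0 x = 0"
proof -
  interpret bounded_linear "\<lambda>h. ev h x" by (rule ev_bounded_linear[OF assms])
  show "ev (a + b) x = ev a x + ev b x" "ev (a - b) x = ev a x - ev b x"
    "ev (r *\<^sub>R a) x = r * ev a x" "ev 0 x = 0"
    by (simp_all add: add diff scaleR zero)
qed

lemma shift_linear: "t \<ge> 0 \<Longrightarrow> bounded_linear (S t)"
  and shift_0: "S 0 h = h"
  and shift_add: "s \<ge> 0 \<Longrightarrow> t \<ge> 0 \<Longrightarrow> S (s + t) h = S s (S t h)"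
  and shift_tendsto: "((\<lambda>t. S t h) \<longlongrightarrow> h) (at_right 0)"
  using shift_semigroup by (auto simp: c0_semigroup_def)

text \<open>Otherwise some t_n tend to 0 with the norms of S(t_n) unbounded, although S(t_n) h
  converges to h for every h, against uniform boundedness.\<close>

lemma shift_locally_bounded:
  "\<exists>\<delta> C. \<delta> > 0 \<and> C \<ge> 0 \<and> (\<forall>t h. 0 \<le> t \<longrightarrow> t \<le> \<delta> \<longrightarrow> norm (S t h) \<le> C * norm h)"
proof (rule ccontr)
  assume neg: "\<not> ?thesis"
  have "\<exists>t. 0 \<le> t \<and> t \<le> inverse (real (Suc n)) \<and> (\<exists>h. norm (S t h) > real n * norm h)" for n
  proof -
    have "inverse (real (Suc n)) > 0" "real n \<ge> 0" by auto
    then show ?thesis using neg by (meson not_le)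
  qed
  then obtain t where t0: "\<And>n. 0 \<le> t n" and t: "\<And>n. t n \<le> inverse (real (Suc n))"
    and big: "\<And>n. \<exists>h. norm (S (t n) h) > real n * norm h" by metis
  have tlim: "t \<longlonglongrightarrow> 0"
    by (rule tendsto_sandwich[OF _ _ tendsto_const LIMSEQ_inverse_real_of_nat])
      (use t0 t in \<open>auto intro: always_eventually\<close>)
  have cont: "(\<lambda>n. S (t n) h) \<longlonglongrightarrow> h" for h
  proof -
    have "((\<lambda>t. S t h) \<longlongrightarrow> h) (at 0 within {0..})"
      unfolding tendsto_def
    proof (intro allI impI)
      fix U assume U: "open U" "h \<in> U"
      have "\<forall>\<^sub>F t in at_right 0. S t h \<in> U" using topological_tendstoD[OF shift_tendsto U] .
      then show "\<forall>\<^sub>F t in at 0 within {0..}. S t h \<in> U"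
        by (auto simp: eventually_at_filter elim!: eventually_mono)
    qed
    \<comment> \<open>The times t_n may be 0, so the limit at 0+ is upgraded to continuity at
      0.\<close>
    then have "continuous (at 0 within {0..}) (\<lambda>t. S t h)" by (simp add: continuous_within shift_0)
    then show ?thesis
      using tlim t0 by (simp add: continuous_within_sequentially o_def shift_0)
  qed
  have "\<exists>M\<ge>0. \<forall>n\<in>UNIV. \<forall>h. norm (S (t n) h) \<le> M * norm h"
  proof (rule uniform_boundedness)
    show "\<exists>M. \<forall>n\<in>UNIV. norm (S (t n) h) \<le> M" for h
      using convergent_imp_Bseq[of "\<lambda>n. S (t n) h"] cont[of h] by (auto simp: convergent_def Bseq_def)
  qed (use shift_linear t0 in auto)
  then obtain M where M: "\<And>n h. norm (S (t n) h) \<le> M * norm h" by blast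
  obtain n where n: "M \<le> real n" using real_arch_simple by blast
  obtain h where "norm (S (t n) h) > real n * norm h" using big by blast
  moreover have "M * norm h \<le> real n * norm h" using n by (rule mult_right_mono) simp
  ultimately show False using M[of n h] by linarith
qed

text \<open>A horizon fixed once and for all, up to which the semigroup is uniformly bounded and all
  its integrals are taken.\<close>

definition tmax :: real where
  "tmax = (SOME \<delta>. \<exists>C. \<delta> > 0 \<and> C \<ge> 0 \<and> (\<forall>t h. 0 \<le> t \<longrightarrow> t \<le> \<delta> \<longrightarrow> norm (S t h) \<le> C * norm h))"

definition bound :: real where
  "bound = (SOME C. tmax > 0 \<and> C \<ge> 0 \<and> (\<forall>t h. 0 \<le> t \<longrightarrow> t \<le> tmax \<longrightarrow> norm (S t h) \<le> C * norm h))"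

lemma tmax_pos: "tmax > 0" and bound_nonneg: "bound \<ge> 0"
  and shift_bound: "0 \<le> t \<Longrightarrow> t \<le> tmax \<Longrightarrow> norm (S t h) \<le> bound * norm h"
proof -
  have "\<exists>C. tmax > 0 \<and> C \<ge> 0 \<and> (\<forall>t h. 0 \<le> t \<longrightarrow> t \<le> tmax \<longrightarrow> norm (S t h) \<le> C * norm h)"
    unfolding tmax_def by (rule someI_ex[OF shift_locally_bounded])
  from someI_ex[OF this] show "tmax > 0" "bound \<ge> 0" "0 \<le> t \<Longrightarrow> t \<le> tmax \<Longrightarrow> norm (S t h) \<le> bound * norm h"
    by (auto simp: bound_def)
qed

lemma shift_near: "e > 0 \<Longrightarrow> \<exists>\<eta>>0. \<forall>t. 0 \<le> t \<longrightarrow> t < \<eta> \<longrightarrow> norm (S t h - h) < e"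
proof -
  assume e: "e > 0"
  have "\<forall>\<^sub>F t in at_right 0. dist (S t h) h < e" using shift_tendsto e by (rule tendstoD)
  then obtain \<eta> where \<eta>: "\<eta> > 0" "\<And>t. 0 < t \<Longrightarrow> t < \<eta> \<Longrightarrow> dist (S t h) h < e"
    by (auto simp: eventually_at_right_field)
  have "norm (S t h - h) < e" if "0 \<le> t" "t < \<eta>" for t
    using \<eta>(2)[of t] that e by (cases "t = 0") (simp_all add: shift_0 dist_norm)
  with \<eta>(1) show ?thesis by blast
qed

lemma continuous_on_shift: "continuous_on {0..tmax} (\<lambda>s. S s h)"
  unfolding continuous_on_iff
proof (intro ballI allI impI)
  fix s e :: real assume s: "s \<in> {0..tmax}" and e: "e > 0"
  have e': "e / (bound + 1) > 0" using e bound_nonneg by simp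
  obtain \<eta> where \<eta>: "\<eta> > 0" "\<And>t. 0 \<le> t \<Longrightarrow> t < \<eta> \<Longrightarrow> norm (S t h - h) < e / (bound + 1)"
    using shift_near[OF e'] by blast
  have key: "norm (S a h - S b h) < e" if "0 \<le> b" "b \<le> a" "a \<le> tmax" "a - b < \<eta>" for a b
  proof -
    interpret bounded_linear "S b" by (rule shift_linear) (use that in simp)
    have "S a h - S b h = S b (S (a - b) h - h)"
      using shift_add[of b "a - b" h] that by (simp add: diff)
    also have "norm \<dots> \<le> bound * norm (S (a - b) h - h)" by (rule shift_bound) (use that in auto)
    also have "\<dots> \<le> bound * (e / (bound + 1))"
      using \<eta>(2)[of "a - b"] that bound_nonneg by (intro mult_left_mono) auto
    also have "\<dots> < e" using e bound_nonneg by (simp add: field_simps)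
    finally show ?thesis .
  qed
  show "\<exists>d>0. \<forall>x'\<in>{0..tmax}. dist x' s < d \<longrightarrow> dist (S x' h) (S s h) < e"
  proof (intro exI[of _ \<eta>] conjI ballI impI \<eta>(1))
    fix x assume x: "x \<in> {0..tmax}" "dist x s < \<eta>"
    show "dist (S x h) (S s h) < e"
    proof (cases "s \<le> x")
      case True
      then show ?thesis using key[of s x] x s by (auto simp: dist_norm dist_real_def)
    next
      case False
      then show ?thesis using key[of x s] x s by (auto simp: dist_norm dist_real_def norm_minus_commute)
    qed
  qed
qed

lemma shift_integrable: "0 \<le> t \<Longrightarrow> t \<le> tmax \<Longrightarrow> (\<lambda>s. S s h) integrable_on {0..t}"
  by (rule integrable_continuous_complete, rule continuous_on_subset[OF continuous_on_shift]) auto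

section \<open>Integrals of the semigroup\<close>

definition I :: "real \<Rightarrow> 'h \<Rightarrow> 'h" where
  "I t h = integral {0..t} (\<lambda>s. S s h)"

lemma has_integral_I: "0 \<le> t \<Longrightarrow> t \<le> tmax \<Longrightarrow> ((\<lambda>s. S s h) has_integral I t h) {0..t}"
  unfolding I_def by (rule integrable_integral[OF shift_integrable])

lemma I_eqI:
  assumes "0 \<le> t" "t \<le> tmax" "\<And>s. 0 \<le> s \<Longrightarrow> s \<le> t \<Longrightarrow> f s = S s h" "(f has_integral i) {0..t}"
  shows "I t h = i"
proof -
  have "((\<lambda>s. S s h) has_integral i) {0..t}"
    by (rule has_integral_eq[OF _ assms(4)]) (use assms(3) in auto)
  then show ?thesis using has_integral_I[OF assms(1,2)] has_integral_unique by blast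
qed

lemma ev_I:
  assumes "0 \<le> t" "t \<le> tmax" "x \<ge> 0"
  shows "((\<lambda>s. ev h (s + x)) has_integral ev (I t h) x) {0..t}"
  by (rule has_integral_eq[OF _ has_integral_linear[OF has_integral_I[OF assms(1,2)] ev_bounded_linear[OF assms(3)]]])
    (use assms in \<open>auto simp: ev_shift\<close>)

lemma I_bound: "0 \<le> t \<Longrightarrow> t \<le> tmax \<Longrightarrow> norm (I t h) \<le> bound * t * norm h"
  using has_integral_bound_real[OF _ finite.emptyI has_integral_I[of t h], of "bound * norm h"]
    shift_bound bound_nonneg by (simp add: mult_ac)

lemma I_linear:
  assumes t: "0 \<le> t" "t \<le> tmax" shows "bounded_linear (I t)"
proof (rule bounded_linear_intro[where K = "bound * t"])
  fix a b :: 'h and r :: real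
  show "I t (a + b) = I t a + I t b"
    by (rule I_eqI[OF t _ has_integral_add[OF has_integral_I[OF t] has_integral_I[OF t]]])
      (simp add: bounded_linear.linear linear_add shift_linear)
  show "I t (r *\<^sub>R a) = r *\<^sub>R I t a"
    by (rule I_eqI[OF t _ has_integral_cmul[OF has_integral_I[OF t]]])
      (simp add: bounded_linear.linear linear_scale shift_linear)
  show "norm (I t a) \<le> norm a * (bound * t)" using I_bound[OF t, of a] by (simp add: mult_ac)
qed

lemma I_average_near:
  assumes "e > 0"
  shows "\<exists>\<eta>>0. \<eta> \<le> tmax \<and> (\<forall>t. 0 < t \<longrightarrow> t < \<eta> \<longrightarrow> norm ((1 / t) *\<^sub>R I t h - h) < e)"
proof -
  obtain \<eta> where \<eta>: "\<eta> > 0" "\<And>t. 0 \<le> t \<Longrightarrow> t < \<eta> \<Longrightarrow> norm (S t h - h) < e / 2"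
    using shift_near[of "e / 2" h] assms by auto
  have "norm ((1 / t) *\<^sub>R I t h - h) < e" if t: "0 < t" "t < min \<eta> tmax" for t
  proof -
    have "((\<lambda>s. S s h - h) has_integral (I t h - t *\<^sub>R h)) {0..t}"
      using has_integral_diff[OF has_integral_I[of t h] has_integral_const_real[of h 0 t]] t by simp
    from has_integral_bound_real[OF _ finite.emptyI this, of "e / 2"]
    have "norm (I t h - t *\<^sub>R h) \<le> e / 2 * t"
      using \<eta>(2) t assms by (simp add: less_imp_le)
    moreover have "(1 / t) *\<^sub>R I t h - h = (1 / t) *\<^sub>R (I t h - t *\<^sub>R h)"
      using t by (simp add: scaleR_diff_right)
    ultimately have "norm ((1 / t) *\<^sub>R I t h - h) \<le> e / 2" using t by (simp add: divide_le_eq)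
    then show ?thesis using assms by simp
  qed
  then show ?thesis using \<eta>(1) tmax_pos by (intro exI[of _ "min \<eta> tmax"]) auto
qed

lemma I_average_tendsto: "((\<lambda>t. (1 / t) *\<^sub>R I t h) \<longlongrightarrow> h) (at_right 0)"
proof (rule tendstoI)
  fix e :: real assume "e > 0"
  then obtain \<eta> where "\<eta> > 0" "\<And>t. 0 < t \<Longrightarrow> t < \<eta> \<Longrightarrow> norm ((1 / t) *\<^sub>R I t h - h) < e"
    using I_average_near by metis
  then show "\<forall>\<^sub>F t in at_right 0. dist ((1 / t) *\<^sub>R I t h) h < e"
    by (auto simp: eventually_at_right_field dist_norm)
qed

text \<open>Evaluations separate points and commute with the integral, so the identity is the real
  fundamental theorem of calculus for \<open>ev h\<close>.\<close>

lemma shift_diff_eq_I: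
  assumes h: "h \<in> domA ev" and t: "0 \<le> t" "t \<le> tmax"
  shows "S t h - h = I t (A h)"
proof (rule ev_inject)
  fix x :: real assume x: "x \<ge> 0"
  have "((\<lambda>s. ev (A h) (s + x)) has_integral (ev h (t + x) - ev h (0 + x))) {0..t}"
  proof (rule fundamental_theorem_of_calculus[OF t(1)])
    fix s assume s: "s \<in> {0..t}"
    show "((\<lambda>s. ev h (s + x)) has_vector_derivative ev (A h) (s + x)) (at s within {0..t})"
      by (rule has_vector_derivative_shift_within[OF generator_derivative[OF h]]) (use s x in auto)
  qed
  from has_integral_unique[OF this ev_I[OF t x]]
  show "ev (S t h - h) x = ev (I t (A h)) x" using x t by (simp add: ev_simps ev_shift)
qed

text \<open>Together with \<open>shift_diff_eq_I\<close> this describes the generator by an equation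
  between bounded operators, from which linearity and closedness are read off.\<close>

lemma generatorI:
  assumes "\<And>t. 0 \<le> t \<Longrightarrow> t \<le> tmax \<Longrightarrow> S t h - h = I t k"
  shows "h \<in> domA ev" "A h = k"
proof -
  have lim: "((\<lambda>t. (1 / t) *\<^sub>R (S t h - h)) \<longlongrightarrow> k) (at_right 0)"
  proof (rule Lim_transform_eventually[OF I_average_tendsto[of k]])
    show "\<forall>\<^sub>F t in at_right 0. (1 / t) *\<^sub>R I t k = (1 / t) *\<^sub>R (S t h - h)"
      using assms tmax_pos by (auto simp: eventually_at_right_field intro!: exI[of _ tmax])
  qed
  then show "h \<in> domA ev" by (auto simp: gen_domain_def)
  show "A h = k" unfolding gen_def by (rule tendsto_Lim[OF _ lim]) simp
qed

lemma generator_closed: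
  assumes F: "F \<noteq> bot" and h: "\<forall>\<^sub>F n in F. f n \<in> domA ev" "(f \<longlongrightarrow> h) F" "((\<lambda>n. A (f n)) \<longlongrightarrow> k) F"
  shows "h \<in> domA ev" "A h = k"
proof -
  have "S t h - h = I t k" if t: "0 \<le> t" "t \<le> tmax" for t
  proof (rule tendsto_unique[OF F])
    show "((\<lambda>n. S t (f n) - f n) \<longlongrightarrow> S t h - h) F"
      by (intro tendsto_diff bounded_linear.tendsto[OF shift_linear] h t)
    show "((\<lambda>n. S t (f n) - f n) \<longlongrightarrow> I t k) F"
      by (rule Lim_transform_eventually[OF bounded_linear.tendsto[OF I_linear[OF t] h(3)]])
        (use h(1) in \<open>auto elim!: eventually_mono simp: shift_diff_eq_I t\<close>)
  qed
  note * = this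
  show "h \<in> domA ev" using * by (rule generatorI(1))
  show "A h = k" using * by (rule generatorI(2))
qed

lemma generator_linear:
  assumes "h \<in> domA ev" "g \<in> domA ev"
  shows "a *\<^sub>R h + b *\<^sub>R g \<in> domA ev" "A (a *\<^sub>R h + b *\<^sub>R g) = a *\<^sub>R A h + b *\<^sub>R A g"
proof -
  have "S t (a *\<^sub>R h + b *\<^sub>R g) - (a *\<^sub>R h + b *\<^sub>R g) = I t (a *\<^sub>R A h + b *\<^sub>R A g)"
    if t: "0 \<le> t" "t \<le> tmax" for t
  proof -
    interpret s: bounded_linear "S t" by (rule shift_linear[OF t(1)])
    interpret i: bounded_linear "I t" by (rule I_linear[OF t])
    show ?thesis
      using shift_diff_eq_I[OF assms(1) t] shift_diff_eq_I[OF assms(2) t]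
      by (simp add: s.add s.scaleR i.add i.scaleR flip: scaleR_diff_right) (simp add: algebra_simps)
  qed
  note * = this
  show "a *\<^sub>R h + b *\<^sub>R g \<in> domA ev" using * by (rule generatorI(1))
  show "A (a *\<^sub>R h + b *\<^sub>R g) = a *\<^sub>R A h + b *\<^sub>R A g" using * by (rule generatorI(2))
qed

lemma derivative_unique:
  assumes "(f has_real_derivative a) (at x within {0..})" "(f has_real_derivative b) (at x within {0..})" "x \<ge> 0"
  shows "a = b"
proof (rule vector_derivative_unique_within)
  have "at_right x \<le> at x within {0..}" by (rule at_le) (use assms(3) in auto)
  moreover have "at_right x \<noteq> bot" by simp
  ultimately show "at x within {0..} \<noteq> bot" using bot.extremum_unique by metis
qed (use assms in \<open>simp_all add: has_real_derivative_iff_has_vector_derivative\<close>)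

lemma generator_derivativeI:
  assumes "\<And>x. x \<ge> 0 \<Longrightarrow> (ev h has_real_derivative ev k x) (at x within {0..})"
  shows "h \<in> domA ev" "A h = k"
proof -
  show h: "h \<in> domA ev" unfolding domain_generator using assms by blast
  show "A h = k"
    by (rule ev_inject, rule derivative_unique[OF generator_derivative[OF h] assms]) auto
qed

lemma primitive_derivative:
  assumes "continuous_on {0..} f" "y \<ge> 0"
  shows "((\<lambda>y. integral {0..y} f) has_real_derivative f y) (at y within {0..})"
proof -
  have "((\<lambda>y. integral {0..y} f) has_vector_derivative f y) (at y within {0..y+1})"
    by (rule integral_has_vector_derivative[OF continuous_on_subset[OF assms(1)]]) (use assms(2) in auto)
  moreover have "at y within {0..y+1} = at y within {0..}"
    by (rule at_within_nhd[of _ "{..<y+1}"]) auto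
  ultimately show ?thesis by (simp add: has_real_derivative_iff_has_vector_derivative)
qed

text \<open>Evaluated at y, \<open>I t h\<close> is P(t + y) - P(y) for a primitive P of the
  continuous function \<open>ev h\<close>, so one order of differentiability is gained.\<close>

lemma generator_I:
  assumes t: "0 \<le> t" "t \<le> tmax"
  shows "I t h \<in> domA ev" "A (I t h) = S t h - h"
proof -
  have "(ev (I t h) has_real_derivative ev (S t h - h) x) (at x within {0..})" if x: "x \<ge> 0" for x
  proof -
    let ?P = "\<lambda>y. integral {0..y} (ev h)"
    have P: "(?P has_real_derivative ev h y) (at y within {0..})" if "y \<ge> 0" for y
      by (rule primitive_derivative[OF ev_continuous that])
    have eq: "ev (I t h) y = ?P (t + y) - ?P y" if y: "y \<ge> 0" for y
    proof (rule has_integral_unique[OF ev_I[OF t y]])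
      have "((\<lambda>s. ev h (s + y)) has_integral (?P (t + y) - ?P (0 + y))) {0..t}"
      proof (rule fundamental_theorem_of_calculus[OF t(1)])
        fix s assume s: "s \<in> {0..t}"
        show "((\<lambda>s. ?P (s + y)) has_vector_derivative ev h (s + y)) (at s within {0..t})"
          by (rule has_vector_derivative_shift_within[OF P]) (use s y in auto)
      qed
      then show "((\<lambda>s. ev h (s + y)) has_integral (?P (t + y) - ?P y)) {0..t}" by simp
    qed
    have "((\<lambda>y. ?P (y + t)) has_vector_derivative ev h (x + t)) (at x within {0..})"
      by (rule has_vector_derivative_shift_within[OF P]) (use t x in auto)
    then have "((\<lambda>y. ?P (t + y)) has_real_derivative ev h (t + x)) (at x within {0..})"
      by (simp add: add.commute has_real_derivative_iff_has_vector_derivative)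
    from DERIV_diff[OF this P[OF x]]
    have "((\<lambda>y. ?P (t + y) - ?P y) has_real_derivative ev (S t h - h) x) (at x within {0..})"
      using x t by (simp add: ev_simps ev_shift)
    then show ?thesis
      by (rule has_field_derivative_transform_within[where d = 1]) (use x eq in auto)
  qed
  note * = this
  show "I t h \<in> domA ev" using * by (rule generator_derivativeI(1))
  show "A (I t h) = S t h - h" using * by (rule generator_derivativeI(2))
qed

text \<open>The integral of (t - s) S(s) h over [0, t] written as an iterated integral: the
  second-order Taylor remainder.\<close>

definition J :: "real \<Rightarrow> 'h \<Rightarrow> 'h" where
  "J t h = integral {0..t} (\<lambda>s. I s h)"

lemma has_integral_J:
  assumes t: "0 \<le> t" "t \<le> tmax" shows "((\<lambda>s. I s h) has_integral J t h) {0..t}"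
  unfolding J_def
proof (rule integrable_integral, rule integrable_continuous_complete)
  show "continuous_on {0..t} (\<lambda>s. I s h)"
    unfolding continuous_on_iff
  proof (intro ballI allI impI)
    fix s e :: real assume s: "s \<in> {0..t}" and e: "e > 0"
    have key: "norm (I b h - I a h) \<le> bound * norm h * (b - a)" if "0 \<le> a" "a \<le> b" "b \<le> tmax" for a b
    proof -
      have "(\<lambda>s. S s h) integrable_on {a..b}"
        by (rule integrable_continuous_complete, rule continuous_on_subset[OF continuous_on_shift]) (use that in auto)
      then obtain j where j: "((\<lambda>s. S s h) has_integral j) {a..b}" by blast
      have "((\<lambda>s. S s h) has_integral (I a h + j)) (cbox 0 b)"
      proof (rule has_integral_split[where k = 1 and c = a])
        have "cbox 0 b \<inter> {x. x \<bullet> 1 \<le> a} = {0..a}" "cbox 0 b \<inter> {x. x \<bullet> 1 \<ge> a} = {a..b}" using that by auto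
        then show "((\<lambda>s. S s h) has_integral I a h) (cbox 0 b \<inter> {x. x \<bullet> 1 \<le> a})"
          "((\<lambda>s. S s h) has_integral j) (cbox 0 b \<inter> {x. x \<bullet> 1 \<ge> a})"
          using has_integral_I[of a h] j that by simp_all
      qed simp
      then have "((\<lambda>s. S s h) has_integral (I a h + j)) {0..b}" by simp
      then have "I b h = I a h + j" using has_integral_unique[OF has_integral_I[of b h]] that by simp
      then have "((\<lambda>s. S s h) has_integral (I b h - I a h)) {a..b}" using j by simp
      from has_integral_bound_real[OF _ finite.emptyI this, of "bound * norm h"]
      show ?thesis using shift_bound bound_nonneg that by simp
    qed
    define K where "K = bound * norm h + 1"
    have K: "K > 0" "bound * norm h \<le> K" using bound_nonneg by (auto simp: K_def add_nonneg_pos)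
    show "\<exists>d>0. \<forall>x'\<in>{0..t}. dist x' s < d \<longrightarrow> dist (I x' h) (I s h) < e"
    proof (intro exI[of _ "e / K"] conjI ballI impI)
      fix x assume x: "x \<in> {0..t}" "dist x s < e / K"
      have "norm (I x h - I s h) \<le> bound * norm h * \<bar>x - s\<bar>"
      proof (cases "s \<le> x")
        case True then show ?thesis using key[of s x] s x t by auto
      next
        case False then show ?thesis using key[of x s] s x t by (auto simp: norm_minus_commute abs_if)
      qed
      also have "\<dots> \<le> K * \<bar>x - s\<bar>" by (rule mult_right_mono[OF K(2)]) simp
      also have "\<dots> < e" using x K(1) by (simp add: dist_real_def field_simps)
      finally show "dist (I x h) (I s h) < e" by (simp add: dist_norm)
    qed (use e K in simp)
  qed
qed

lemma J_eqI:
  assumes "0 \<le> t" "t \<le> tmax" "\<And>s. 0 \<le> s \<Longrightarrow> s \<le> t \<Longrightarrow> f s = I s h" "(f has_integral i) {0..t}"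
  shows "J t h = i"
proof -
  have "((\<lambda>s. I s h) has_integral i) {0..t}"
    by (rule has_integral_eq[OF _ assms(4)]) (use assms(3) in auto)
  then show ?thesis using has_integral_J[OF assms(1,2)] has_integral_unique by blast
qed

lemma J_bound:
  assumes "0 \<le> t" "t \<le> tmax" shows "norm (J t h) \<le> bound * t\<^sup>2 * norm h"
proof -
  have "norm (I s h) \<le> bound * t * norm h" if "s \<in> {0..t}" for s
    by (rule order_trans[OF I_bound]) (use that assms bound_nonneg in \<open>auto intro!: mult_right_mono mult_left_mono\<close>)
  then show ?thesis
    using has_integral_bound_real[OF _ finite.emptyI has_integral_J[OF assms], of "bound * t * norm h"] assms bound_nonneg
    by (simp add: power2_eq_square mult_ac)
qed

lemma J_linear:
  assumes t: "0 \<le> t" "t \<le> tmax" shows "bounded_linear (J t)"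
proof (rule bounded_linear_intro[where K = "bound * t\<^sup>2"])
  fix a b :: 'h and r :: real
  show "J t (a + b) = J t a + J t b"
    by (rule J_eqI[OF t _ has_integral_add[OF has_integral_J[OF t] has_integral_J[OF t]]])
      (use t in \<open>simp add: bounded_linear.linear linear_add I_linear\<close>)
  show "J t (r *\<^sub>R a) = r *\<^sub>R J t a"
    by (rule J_eqI[OF t _ has_integral_cmul[OF has_integral_J[OF t]]])
      (use t in \<open>simp add: bounded_linear.linear linear_scale I_linear\<close>)
  show "norm (J t a) \<le> norm a * (bound * t\<^sup>2)" using J_bound[OF t, of a] by (simp add: mult_ac)
qed

text \<open>Taylor's formula \<open>u(x + t) = u(x) + t u'(x) + \<integral>\<^sub>0\<^sup>t (t - s) u''(x + s) ds\<close> exhibits \<open>u'\<close> as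
  an element of the space as soon as \<open>u\<close> and \<open>u''\<close> are.\<close>

lemma second_derivative:
  assumes g: "\<And>x. x \<ge> 0 \<Longrightarrow> (ev u has_real_derivative g x) (at x within {0..})"
    and w: "\<And>x. x \<ge> 0 \<Longrightarrow> (g has_real_derivative ev w x) (at x within {0..})"
    and t: "0 < t" "t \<le> tmax"
  shows "u \<in> domA ev" "A u \<in> domA ev" "A (A u) = w" "A u = (1 / t) *\<^sub>R (S t u - u - J t w)"
proof -
  have t': "0 \<le> t" using t by simp
  have FTC: "((\<lambda>s. f' (s + x)) has_integral (f (r + x) - f x)) {0..r}"
    if "0 \<le> r" "x \<ge> 0" and f: "\<And>x. x \<ge> 0 \<Longrightarrow> (f has_real_derivative f' x) (at x within {0..})" for f f' x r
  proof -
    have "((\<lambda>s. f' (s + x)) has_integral (f (r + x) - f (0 + x))) {0..r}"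
    proof (rule fundamental_theorem_of_calculus[OF that(1)])
      fix s assume s: "s \<in> {0..r}"
      show "((\<lambda>s. f (s + x)) has_vector_derivative f' (s + x)) (at s within {0..r})"
        by (rule has_vector_derivative_shift_within[OF f]) (use s that(2) in auto)
    qed
    then show ?thesis by simp
  qed
  define k where "k = (1 / t) *\<^sub>R (S t u - u - J t w)"
  have k: "ev k x = g x" if x: "x \<ge> 0" for x
  proof -
    have I: "ev (I s w) x = g (s + x) - g x" if "0 \<le> s" "s \<le> tmax" for s
      using has_integral_unique[OF ev_I[OF that x] FTC[OF that(1) x w]] by simp
    have "((\<lambda>s. ev (I s w) x) has_integral ev (J t w) x) {0..t}"
      using has_integral_linear[OF has_integral_J[OF t' t(2)] ev_bounded_linear[OF x]] by (simp add: o_def)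
    then have "((\<lambda>s. g (s + x) - g x) has_integral ev (J t w) x) {0..t}"
      by (rule has_integral_eq[rotated]) (use I t in auto)
    moreover have "((\<lambda>s. g (s + x) - g x) has_integral (ev u (t + x) - ev u x - t * g x)) {0..t}"
      using has_integral_diff[OF FTC[OF t' x g] has_integral_const_real[of "g x" 0 t]] t by simp
    ultimately have "ev (J t w) x = ev u (t + x) - ev u x - t * g x" by (rule has_integral_unique)
    then show ?thesis using t x by (simp add: k_def ev_simps ev_shift)
  qed
  have d1: "(ev u has_real_derivative ev k x) (at x within {0..})" if "x \<ge> 0" for x
    using g[OF that] k[OF that] by simp
  have d2: "(ev k has_real_derivative ev w x) (at x within {0..})" if "x \<ge> 0" for x
    by (rule has_field_derivative_transform_within[OF w[OF that], where d = 1]) (use k that in auto)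
  note u = generator_derivativeI[of u k, OF d1] and v = generator_derivativeI[of k w, OF d2]
  show "u \<in> domA ev" "A u \<in> domA ev" "A (A u) = w" using u v by auto
  show "A u = (1 / t) *\<^sub>R (S t u - u - J t w)" using u by (simp add: k_def)
qed

lemma generator_Taylor:
  assumes "u \<in> domA ev" "A u \<in> domA ev" "0 < t" "t \<le> tmax"
  shows "A u = (1 / t) *\<^sub>R (S t u - u - J t (A (A u)))"
  by (rule second_derivative(4)[where g = "ev (A u)"]) (use assms generator_derivative in auto)

text \<open>An inequality of Landau-Kolmogorov type from Taylor's formula. The free t makes the
  coefficient of \<open>A (A u)\<close> as small as desired.\<close>

lemma generator_interpolation:
  assumes "u \<in> domA ev" "A u \<in> domA ev" "0 < t" "t \<le> tmax"
  shows "norm (A u) \<le> ((bound + 1) / t) * norm u + (bound * t) * norm (A (A u))"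
proof -
  have "norm (S t u - u - J t (A (A u))) \<le> norm (S t u) + norm u + norm (J t (A (A u)))"
    by (meson add_mono norm_triangle_ineq4 order_refl order_trans)
  also have "\<dots> \<le> bound * norm u + norm u + bound * t\<^sup>2 * norm (A (A u))"
    using shift_bound[of t u] J_bound[of t "A (A u)"] assms by (intro add_mono) auto
  finally have "norm ((1 / t) *\<^sub>R (S t u - u - J t (A (A u))))
      \<le> (1 / t) * (bound * norm u + norm u + bound * t\<^sup>2 * norm (A (A u)))"
    unfolding norm_scaleR using assms by (simp add: divide_right_mono)
  also have "\<dots> = ((bound + 1) / t) * norm u + (bound * t) * norm (A (A u))"
    using assms(3) by (simp add: field_simps power2_eq_square)
  finally show ?thesis using generator_Taylor[OF assms] by simp
qed

end

section \<open>Smooth vectors of the generator\<close>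

lemma has_curve_derivative_normed:
  "has_curve_derivative (normed_space_on UNIV norm) c l t \<longleftrightarrow> (c has_vector_derivative l) (at t)"
  unfolding has_curve_derivative_def has_vector_derivative_iff_quotient normed_space_on_def
  by (simp add: tendsto_norm_zero_iff Lim_null[symmetric])

lemma smooth_curve_normed: "smooth_curve (normed_space_on UNIV norm) c \<longleftrightarrow> csmooth c"
  unfolding smooth_curve_def csmooth_iff_sequence has_curve_derivative_normed
  by (simp add: normed_space_on_def)

lemma dom_pow_iff:
  "h \<in> dom_pow X D B n \<longleftrightarrow> (\<forall>m<n. (B ^^ m) h \<in> D) \<and> (B ^^ n) h \<in> X"
proof (induction n arbitrary: h)
  case (Suc n)
  have shift: "(B ^^ Suc m) h = (B ^^ m) (B h)" for m by (simp add: funpow_swap1)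
  have "(\<forall>m<Suc n. (B ^^ m) h \<in> D) \<longleftrightarrow> h \<in> D \<and> (\<forall>m<n. (B ^^ Suc m) h \<in> D)"
    by (metis Suc_less_eq funpow_0 gr0_conv_Suc not_gr_zero zero_less_Suc)
  then show ?case by (simp only: dom_pow.simps mem_Collect_eq Suc shift conj_assoc)
qed simp

context forward_curve_space
begin

abbreviation "Dinf \<equiv> points (DA_inf ev)"
abbreviation "D0inf \<equiv> points (DA0_inf ev H0)"

lemma Dinf_iff: "h \<in> Dinf \<longleftrightarrow> (\<forall>m. (A ^^ m) h \<in> domA ev)"
  by (auto simp: DA_inf_def smooth_domain_def dom_pow_iff)

lemma Dinf_domain: "h \<in> Dinf \<Longrightarrow> h \<in> domA ev"
  using Dinf_iff funpow_0 by metis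

lemma D0inf_iff: "h \<in> D0inf \<longleftrightarrow> h \<in> Dinf \<and> (\<forall>m. (A ^^ m) h \<in> H0)"
proof -
  have "h \<in> D0inf \<longleftrightarrow> (\<forall>n. (\<forall>m<n. (A ^^ m) h \<in> domA ev \<and> (A ^^ m) h \<in> H0 \<and> (A ^^ Suc m) h \<in> H0) \<and> (A ^^ n) h \<in> H0)"
    by (auto simp: DA0_inf_def smooth_domain_def dom_pow_iff)
  then show ?thesis unfolding Dinf_iff by blast
qed

lemma seminorm_Dinf: "seminorm (DA_inf ev) n h = (\<Sum>m\<le>n. norm ((A ^^ m) h))"
  by (simp add: DA_inf_def smooth_domain_def)

lemma generator_subspace: "subspace (domA ev)"
proof (rule subspaceI)
  show z: "0 \<in> domA ev" by (rule generatorI(1)[where k = 0]) (simp_all add: shift_linear I_linear linear_0 bounded_linear.linear)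
  show "x + y \<in> domA ev" if "x \<in> domA ev" "y \<in> domA ev" for x y
    using generator_linear(1)[OF that, of 1 1] by simp
  show "c *\<^sub>R x \<in> domA ev" if "x \<in> domA ev" for c x
    using generator_linear(1)[OF that z, of c 0] by simp
qed

lemma generator_scaleR: "h \<in> domA ev \<Longrightarrow> A (c *\<^sub>R h) = c *\<^sub>R A h"
  using generator_linear(2)[of h h c 0] by simp

text \<open>Off \<open>domA ev\<close> the value of \<open>A\<close> is an unspecified
  \<open>Lim\<close>, so linearity of a power requires all lower powers to stay in the
  domain.\<close>

lemma power_domain_linear:
  assumes "\<forall>i<k. (A ^^ i) h \<in> domA ev" "\<forall>i<k. (A ^^ i) g \<in> domA ev"
  shows "\<forall>i<k. (A ^^ i) (a *\<^sub>R h + b *\<^sub>R g) \<in> domA ev"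
    "(A ^^ k) (a *\<^sub>R h + b *\<^sub>R g) = a *\<^sub>R (A ^^ k) h + b *\<^sub>R (A ^^ k) g"
proof -
  have "(\<forall>i<k. (A ^^ i) (a *\<^sub>R h + b *\<^sub>R g) \<in> domA ev)
      \<and> (A ^^ k) (a *\<^sub>R h + b *\<^sub>R g) = a *\<^sub>R (A ^^ k) h + b *\<^sub>R (A ^^ k) g"
    using assms
  proof (induction k)
    case (Suc k)
    then show ?case using generator_linear[of "(A ^^ k) h" "(A ^^ k) g" a b] by (auto simp: less_Suc_eq)
  qed simp
  then show "\<forall>i<k. (A ^^ i) (a *\<^sub>R h + b *\<^sub>R g) \<in> domA ev"
    "(A ^^ k) (a *\<^sub>R h + b *\<^sub>R g) = a *\<^sub>R (A ^^ k) h + b *\<^sub>R (A ^^ k) g" by auto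
qed

lemma power_0: "(A ^^ k) 0 = 0"
  by (induction k) (use generator_scaleR[OF subspace_0[OF generator_subspace], of 0] in auto)

lemma power_domain_subspace: "subspace {h. \<forall>i<k. (A ^^ i) h \<in> domA ev}"
proof (rule subspaceI)
  show "0 \<in> {h. \<forall>i<k. (A ^^ i) h \<in> domA ev}" by (simp add: power_0 subspace_0[OF generator_subspace])
  show "x + y \<in> {h. \<forall>i<k. (A ^^ i) h \<in> domA ev}"
    if "x \<in> {h. \<forall>i<k. (A ^^ i) h \<in> domA ev}" "y \<in> {h. \<forall>i<k. (A ^^ i) h \<in> domA ev}" for x y
    using power_domain_linear(1)[of k x y 1 1] that by simp
  show "c *\<^sub>R x \<in> {h. \<forall>i<k. (A ^^ i) h \<in> domA ev}" if "x \<in> {h. \<forall>i<k. (A ^^ i) h \<in> domA ev}" for c x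
    using power_domain_linear(1)[of k x x c 0] that by simp
qed

lemma Dinf_subspace: "subspace Dinf"
proof -
  have "Dinf = (\<Inter>k. {h. \<forall>i<k. (A ^^ i) h \<in> domA ev})" unfolding set_eq_iff INT_iff mem_Collect_eq Dinf_iff using lessI by blast
  then show ?thesis using power_domain_subspace by (auto intro!: subspace_Inter)
qed

lemma power_linear:
  assumes "h \<in> Dinf" "g \<in> Dinf"
  shows "(A ^^ k) (h + g) = (A ^^ k) h + (A ^^ k) g" "(A ^^ k) (h - g) = (A ^^ k) h - (A ^^ k) g"
  using power_domain_linear(2)[of k h g 1 1] power_domain_linear(2)[of k h g 1 "-1"] assms
  by (auto simp: Dinf_iff)

lemma power_scaleR: "h \<in> Dinf \<Longrightarrow> (A ^^ k) (r *\<^sub>R h) = r *\<^sub>R (A ^^ k) h"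
  using power_domain_linear(2)[of k h h r 0] by (auto simp: Dinf_iff)

lemma power_sum:
  "(\<And>i. i \<in> N \<Longrightarrow> f i \<in> Dinf) \<Longrightarrow> (A ^^ k) (\<Sum>i\<in>N. f i) = (\<Sum>i\<in>N. (A ^^ k) (f i))"
proof (induction N rule: infinite_finite_induct)
  case (insert x F)
  then show ?case using subspace_sum[OF Dinf_subspace, of F f] by (simp add: power_linear)
qed (simp_all add: power_0)

lemma power_Dinf: "h \<in> Dinf \<Longrightarrow> (A ^^ k) h \<in> Dinf"
  unfolding Dinf_iff by (metis comp_apply funpow_add)

lemma generator_Dinf: "h \<in> Dinf \<Longrightarrow> A h \<in> Dinf"
  using power_Dinf[of h 1] by simp

lemma Dinf_quotient:
  assumes "\<And>s. c s \<in> Dinf"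
  shows "(1 / (s - t)) *\<^sub>R (c s - c t) \<in> Dinf"
    "(A ^^ m) ((1 / (s - t)) *\<^sub>R (c s - c t)) = (1 / (s - t)) *\<^sub>R ((A ^^ m) (c s) - (A ^^ m) (c t))"
  using assms subspace_diff[OF Dinf_subspace, of "c s" "c t"]
  by (auto simp: power_linear power_scaleR intro: subspace_scale[OF Dinf_subspace])

lemma has_curve_derivative_Dinf:
  assumes c: "\<And>s. c s \<in> Dinf"
  shows "has_curve_derivative (DA_inf ev) c l t \<longleftrightarrow>
    l \<in> Dinf \<and> (\<forall>m. ((\<lambda>s. (A ^^ m) (c s)) has_vector_derivative (A ^^ m) l) (at t))"
proof -
  have "(\<forall>n. ((\<lambda>s. seminorm (DA_inf ev) n ((1 / (s - t)) *\<^sub>R (c s - c t) - l)) \<longlongrightarrow> 0) (at t)) \<longleftrightarrow>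
      (\<forall>m. ((\<lambda>s. (A ^^ m) (c s)) has_vector_derivative (A ^^ m) l) (at t))"
    if l: "l \<in> Dinf"
  proof -
    let ?q = "\<lambda>m s. (1 / (s - t)) *\<^sub>R ((A ^^ m) (c s) - (A ^^ m) (c t)) - (A ^^ m) l"
    have eq: "seminorm (DA_inf ev) n ((1 / (s - t)) *\<^sub>R (c s - c t) - l) = (\<Sum>m\<le>n. norm (?q m s))" for n s
    proof -
      have "(A ^^ m) ((1 / (s - t)) *\<^sub>R (c s - c t) - l) = ?q m s" for m
        using power_linear(2)[OF Dinf_quotient(1)[where c = c and s = s and t = t, OF c] l, of m]
          Dinf_quotient(2)[where c = c and s = s and t = t and m = m, OF c] by simp
      then show ?thesis unfolding seminorm_Dinf by simp
    qed
    have vd: "((\<lambda>s. (A ^^ m) (c s)) has_vector_derivative (A ^^ m) l) (at t) \<longleftrightarrow> ((\<lambda>s. norm (?q m s)) \<longlongrightarrow> 0) (at t)" for m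
      unfolding has_vector_derivative_iff_quotient tendsto_norm_zero_iff Lim_null[symmetric] ..
    show ?thesis unfolding eq vd
    proof (intro iffI allI)
      fix k assume lim: "\<forall>n. ((\<lambda>s. \<Sum>m\<le>n. norm (?q m s)) \<longlongrightarrow> 0) (at t)"
      show "((\<lambda>s. norm (?q k s)) \<longlongrightarrow> 0) (at t)"
      proof (rule Lim_null_comparison)
        show "((\<lambda>s. \<Sum>m\<le>k. norm (?q m s)) \<longlongrightarrow> 0) (at t)" using lim by blast
        have "norm (norm (?q k s)) \<le> (\<Sum>m\<le>k. norm (?q m s))" for s
          using member_le_sum[of k "{..k}" "\<lambda>m. norm (?q m s)"] by simp
        then show "\<forall>\<^sub>F s in at t. norm (norm (?q k s)) \<le> (\<Sum>m\<le>k. norm (?q m s))" by simp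
      qed
    next
      fix n assume "\<forall>m. ((\<lambda>s. norm (?q m s)) \<longlongrightarrow> 0) (at t)"
      then show "((\<lambda>s. \<Sum>m\<le>n. norm (?q m s)) \<longlongrightarrow> 0) (at t)" by (intro tendsto_null_sum) auto
    qed
  qed
  then show ?thesis unfolding has_curve_derivative_def by blast
qed

text \<open>Closedness of \<open>A\<close>, applied to difference quotients, gives A (L m) = L (m +
  1); derivatives taken in \<open>H\<close> thus lie in D(A^\<infinity>) by themselves.\<close>

lemma Dinf_closed_derivative:
  assumes c: "\<And>s. c s \<in> Dinf" and L: "\<And>m. ((\<lambda>s. (A ^^ m) (c s)) has_vector_derivative L m) (at t)"
  shows "L 0 \<in> Dinf" "(A ^^ m) (L 0) = L m"
proof -
  have step: "L m \<in> domA ev \<and> A (L m) = L (Suc m)" for m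
  proof -
    have *: "A ((1 / (s - t)) *\<^sub>R ((A ^^ m) (c s) - (A ^^ m) (c t)))
        = (1 / (s - t)) *\<^sub>R ((A ^^ Suc m) (c s) - (A ^^ Suc m) (c t))" for s
      using Dinf_quotient(2)[where c = c and s = s and t = t and m = m, OF c]
        Dinf_quotient(2)[where c = c and s = s and t = t and m = "Suc m", OF c] by simp
    have **: "(1 / (s - t)) *\<^sub>R ((A ^^ m) (c s) - (A ^^ m) (c t)) \<in> domA ev" for s
      using Dinf_quotient(1)[where c = c and s = s and t = t, OF c]
        Dinf_quotient(2)[where c = c and s = s and t = t and m = m, OF c] unfolding Dinf_iff by metis
    show ?thesis
      using generator_closed[of "at t" "\<lambda>s. (1 / (s - t)) *\<^sub>R ((A ^^ m) (c s) - (A ^^ m) (c t))" "L m" "L (Suc m)"]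
        L[of m] L[of "Suc m"] unfolding * has_vector_derivative_iff_quotient
      using ** by (auto intro: always_eventually)
  qed
  show eq: "(A ^^ m) (L 0) = L m" for m by (induction m) (use step in auto)
  show "L 0 \<in> Dinf" unfolding Dinf_iff eq using step by blast
qed

text \<open>The derivatives found separately for each power fit together by closedness of
  \<open>A\<close>, so smoothness in the Frechet space splits into conditions in
  \<open>H\<close>.\<close>

lemma smooth_curve_Dinf:
  "smooth_curve (DA_inf ev) c \<longleftrightarrow> (\<forall>t. c t \<in> Dinf) \<and> (\<forall>m. csmooth (\<lambda>t. (A ^^ m) (c t)))"
proof (intro iffI conjI allI)
  assume "smooth_curve (DA_inf ev) c"
  then obtain D where D: "D 0 = c" "\<And>k t. D k t \<in> Dinf"
    "\<And>k t. has_curve_derivative (DA_inf ev) (D k) (D (Suc k) t) t" unfolding smooth_curve_def by blast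
  show "c t \<in> Dinf" for t using D by blast
  show "csmooth (\<lambda>t. (A ^^ m) (c t))" for m
    unfolding csmooth_iff_sequence
  proof (intro exI[of _ "\<lambda>k t. (A ^^ m) (D k t)"] conjI allI)
    show "((\<lambda>t. (A ^^ m) (D k t)) has_vector_derivative (A ^^ m) (D (Suc k) t)) (at t)" for k t
      using D(3) has_curve_derivative_Dinf[of "D k", OF D(2)] by blast
  qed (simp add: D(1))
next
  assume "(\<forall>t. c t \<in> Dinf) \<and> (\<forall>m. csmooth (\<lambda>t. (A ^^ m) (c t)))"
  then have c: "\<And>t. c t \<in> Dinf" and sm: "\<And>m. csmooth (\<lambda>t. (A ^^ m) (c t))" by auto
  define D where "D k m = (curve_deriv ^^ k) (\<lambda>t. (A ^^ m) (c t))" for k m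
  have D0: "D 0 m = (\<lambda>t. (A ^^ m) (c t))" for m by (simp add: D_def)
  have DS: "(D k m has_vector_derivative D (Suc k) m t) (at t)" for k m t
    using csmooth_funpow_deriv[OF sm] by (simp add: D_def)
  have inv: "(\<forall>t. D k 0 t \<in> Dinf) \<and> (\<forall>m t. (A ^^ m) (D k 0 t) = D k m t)" for k
  proof (induction k)
    case (Suc k)
    have d: "((\<lambda>s. (A ^^ m) (D k 0 s)) has_vector_derivative D (Suc k) m t) (at t)" for m t
    proof -
      have "(\<lambda>s. (A ^^ m) (D k 0 s)) = D k m" using Suc by auto
      then show ?thesis using DS by simp
    qed
    show ?case
    proof (intro conjI allI)
      show "D (Suc k) 0 t \<in> Dinf" "(A ^^ m) (D (Suc k) 0 t) = D (Suc k) m t" for m t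
        using Suc Dinf_closed_derivative[of "D k 0" "\<lambda>m. D (Suc k) m t" t, OF _ d] by auto
    qed
  qed (simp add: D0 c)
  show "smooth_curve (DA_inf ev) c"
    unfolding smooth_curve_def
  proof (rule exI[of _ "\<lambda>k. D k 0"], intro conjI allI)
    show "D 0 0 = c" by (simp add: D0)
    show "D k 0 t \<in> Dinf" for k t using inv by blast
    have "(\<lambda>s. (A ^^ m) (D k 0 s)) = D k m" for k m using inv by auto
    then show "has_curve_derivative (DA_inf ev) (D k 0) (D (Suc k) 0 t) t" for k t
      using inv DS by (subst has_curve_derivative_Dinf) auto
  qed
qed

lemma smooth_curve_D0inf:
  assumes "smooth_curve (DA0_inf ev H0) c"
  shows "c t \<in> D0inf" "smooth_curve (DA_inf ev) c"
proof -
  have "has_curve_derivative (DA_inf ev) c l t" if "has_curve_derivative (DA0_inf ev H0) c l t" for c l t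
    using that D0inf_iff unfolding has_curve_derivative_def DA_inf_def DA0_inf_def smooth_domain_def by auto
  with assms show "c t \<in> D0inf" "smooth_curve (DA_inf ev) c"
    unfolding smooth_curve_def using D0inf_iff by (metis, metis)
qed

text \<open>Stated power by power, so that the calculus between normed spaces applies to maps into
  the Frechet space.\<close>

definition smooth_into :: "('x::real_normed_vector \<Rightarrow> 'h) \<Rightarrow> bool" where
  "smooth_into Q \<longleftrightarrow> (\<forall>x. Q x \<in> Dinf) \<and> (\<forall>m. smooth_along (\<lambda>x. (A ^^ m) (Q x)))"

lemma smooth_into_smooth_along: "smooth_into Q \<Longrightarrow> smooth_along Q"
  unfolding smooth_into_def by (metis (no_types, lifting) ext funpow_0)

lemma smooth_into_iff:
  "smooth_into Q \<longleftrightarrow> (\<forall>x. Q x \<in> Dinf) \<and> (\<forall>c. csmooth c \<longrightarrow> smooth_curve (DA_inf ev) (\<lambda>t. Q (c t)))"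
  unfolding smooth_into_def smooth_curve_Dinf smooth_along_def by auto

lemma smooth_into_D0inf:
  assumes "smooth_map (normed_space_on UNIV norm) UNIV (DA0_inf ev H0) Q"
  shows "Q x \<in> D0inf" "smooth_into Q"
proof -
  show Q: "Q x \<in> D0inf" for x using assms unfolding smooth_map_def by auto
  show "smooth_into Q"
    unfolding smooth_into_iff
  proof (intro conjI allI impI)
    show "Q x \<in> Dinf" for x using Q D0inf_iff by blast
    show "smooth_curve (DA_inf ev) (\<lambda>t. Q (c t))" if "csmooth c" for c
      by (rule smooth_curve_D0inf(2)) (use assms that in \<open>auto simp: smooth_map_def smooth_curve_normed o_def\<close>)
  qed
qed

section \<open>Density of the smooth vectors and interpolation between powers of the
  generator\<close>

lemma generator_I_commute:
  assumes "h \<in> domA ev" "0 \<le> t" "t \<le> tmax" shows "A (I t h) = I t (A h)"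
  using generator_I(2)[OF assms(2,3), of h] shift_diff_eq_I[OF assms] by simp

lemma power_average:
  assumes t: "0 \<le> t" "t \<le> tmax" and h: "\<forall>i<n. (A ^^ i) h \<in> domA ev"
  shows "\<forall>i\<le>n. (A ^^ i) (r *\<^sub>R I t h) = r *\<^sub>R I t ((A ^^ i) h)" "\<forall>i<Suc n. (A ^^ i) (r *\<^sub>R I t h) \<in> domA ev"
proof -
  have dom: "r *\<^sub>R I t k \<in> domA ev" for k using generator_I(1)[OF t] subspace_scale[OF generator_subspace] by blast
  have eq: "i \<le> n \<Longrightarrow> (A ^^ i) (r *\<^sub>R I t h) = r *\<^sub>R I t ((A ^^ i) h)" for i
    by (induction i) (use h t generator_I(1)[OF t] in \<open>auto simp: generator_scaleR generator_I_commute\<close>)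
  then show "\<forall>i\<le>n. (A ^^ i) (r *\<^sub>R I t h) = r *\<^sub>R I t ((A ^^ i) h)" by blast
  show "\<forall>i<Suc n. (A ^^ i) (r *\<^sub>R I t h) \<in> domA ev" using eq dom by (auto simp: less_Suc_eq_le)
qed

text \<open>The smooth approximation of \<open>h\<close> is an infinite product of averages
  \<open>1/t \<integral>\<^sub>0\<^sup>t S(s) ds\<close> with rapidly decreasing \<open>t\<close>, each gaining one order of regularity.\<close>

lemma Dinf_dense:
  assumes e: "e > 0"
  shows "\<exists>g\<in>Dinf. norm (g - h) \<le> e"
proof -
  let ?P = "\<lambda>n h. \<forall>i<n. (A ^^ i) h \<in> domA ev"
  \<comment> \<open>The budget (e / 2) 2^-n sums to e. Stage n controls the powers i \<le> n,
    exactly those defined at \<open>f n\<close>.\<close>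
  have "\<exists>f. \<forall>n. (?P n (f n) \<and> (n = 0 \<longrightarrow> f n = h)) \<and>
      (\<forall>i\<le>n. norm ((A ^^ i) (f (Suc n)) - (A ^^ i) (f n)) \<le> (e / 2) * (1/2) ^ n)"
  proof (rule dependent_nat_choice)
    fix x n assume x: "?P n x \<and> (n = 0 \<longrightarrow> x = h)"
    have pos: "(e / 2) * (1/2) ^ n > 0" using e by simp
    have ev1: "\<forall>\<^sub>F t in at_right 0. dist ((1 / t) *\<^sub>R I t k) k < (e / 2) * (1/2) ^ n" for k
      by (rule tendstoD[OF I_average_tendsto pos])
    have "\<forall>\<^sub>F t in at_right 0. \<forall>i\<in>{..n}. dist ((1 / t) *\<^sub>R I t ((A ^^ i) x)) ((A ^^ i) x) < (e / 2) * (1/2) ^ n"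
      by (rule eventually_ball_finite) (use ev1 in auto)
    moreover have "\<forall>\<^sub>F t in at_right 0. 0 < t \<and> t \<le> tmax"
      using tmax_pos by (auto simp: eventually_at_right_field intro!: exI[of _ tmax])
    ultimately have "\<forall>\<^sub>F t in at_right (0::real). (\<forall>i\<in>{..n}. dist ((1 / t) *\<^sub>R I t ((A ^^ i) x)) ((A ^^ i) x) < (e / 2) * (1/2) ^ n)
        \<and> 0 < t \<and> t \<le> tmax" by eventually_elim auto
    then obtain t where t: "0 < t" "t \<le> tmax"
      "\<And>i. i \<le> n \<Longrightarrow> dist ((1 / t) *\<^sub>R I t ((A ^^ i) x)) ((A ^^ i) x) < (e / 2) * (1/2) ^ n"
      using eventually_happens trivial_limit_at_right_real by (metis (no_types, lifting) atMost_iff)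
    note pa = power_average[of t n x "1 / t"]
    show "\<exists>y. (?P (Suc n) y \<and> (Suc n = 0 \<longrightarrow> y = h)) \<and>
        (\<forall>i\<le>n. norm ((A ^^ i) y - (A ^^ i) x) \<le> (e / 2) * (1/2) ^ n)"
      using pa t x by (intro exI[of _ "(1 / t) *\<^sub>R I t x"]) (auto simp: dist_norm less_imp_le)
  qed auto
  then obtain f where f: "\<And>n. ?P n (f n)" "f 0 = h"
    "\<And>n i. i \<le> n \<Longrightarrow> norm ((A ^^ i) (f (Suc n)) - (A ^^ i) (f n)) \<le> (e / 2) * (1/2) ^ n" by metis
  \<comment> \<open>For the i-th power the sequence starts at index i, where this power becomes
    available.\<close>
  have "\<exists>l. (\<lambda>n. (A ^^ i) (f (n + i))) \<longlonglongrightarrow> l \<and> (\<forall>n. norm (l - (A ^^ i) (f (n + i)))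
      \<le> (e / 2) * (1/2) ^ i * (1/2) ^ n / (1 - 1/2))" for i :: nat
  proof (rule geometric_Cauchy)
    show "norm ((A ^^ i) (f (Suc n + i)) - (A ^^ i) (f (n + i))) \<le> (e / 2) * (1/2) ^ i * (1/2) ^ n" for n
      using f(3)[of i "n + i"] by (simp add: power_add mult_ac)
  qed simp_all
  then obtain L where L: "\<And>i. (\<lambda>n. (A ^^ i) (f (n + i))) \<longlonglongrightarrow> L i"
    "\<And>i n. norm (L i - (A ^^ i) (f (n + i))) \<le> (e / 2) * (1/2) ^ i * (1/2) ^ n / (1 - 1/2)" by metis
  have Llim: "(\<lambda>n. (A ^^ i) (f n)) \<longlonglongrightarrow> L i" for i using L(1)[of i] by (rule LIMSEQ_offset)
  have "L i \<in> domA ev \<and> A (L i) = L (Suc i)" for i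
  proof -
    have "\<forall>\<^sub>F n in sequentially. (A ^^ i) (f n) \<in> domA ev"
      using f(1) by (auto simp: eventually_sequentially intro!: exI[of _ "Suc i"])
    then show ?thesis using generator_closed[OF sequentially_bot _ Llim[of i], of "L (Suc i)"] Llim[of "Suc i"] by simp
  qed
  moreover from this have "(A ^^ i) (L 0) = L i" for i by (induction i) auto
  ultimately have "L 0 \<in> Dinf" unfolding Dinf_iff by metis
  moreover have "norm (L 0 - h) \<le> e" using L(2)[of 0 0] f(2) by simp
  ultimately show ?thesis by blast
qed

text \<open>The second-order inequality at A^n h bounds |A^(n+1) h| by M |A^n h| plus a small
  multiple of |A^(n+2) h|. The induction hypothesis turns the first term into a fraction of the left
  side.\<close>

lemma power_interpolation:
  "\<forall>\<epsilon>>0. \<exists>K\<ge>0. \<forall>h\<in>Dinf. \<forall>i\<le>n. norm ((A ^^ i) h) \<le> \<epsilon> * norm ((A ^^ Suc n) h) + K * norm h"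
proof (induction n)
  case 0
  show ?case by (intro allI impI exI[of _ 1]) auto
next
  case (Suc n)
  have top: "\<exists>K\<ge>0. \<forall>h\<in>Dinf. norm ((A ^^ Suc n) h) \<le> \<epsilon> * norm ((A ^^ Suc (Suc n)) h) + K * norm h" if \<epsilon>: "\<epsilon> > 0" for \<epsilon>
  proof -
    \<comment> \<open>Makes the coefficient of the top power at most \<epsilon> / 2, which the
      absorption below doubles to \<epsilon>.\<close>
    define t where "t = min tmax (\<epsilon> / (2 * (bound + 1)))"
    have t: "0 < t" "t \<le> tmax" "bound * t \<le> \<epsilon> / 2"
    proof -
      show "0 < t" "t \<le> tmax" using tmax_pos \<epsilon> bound_nonneg by (auto simp: t_def)
      have "bound * t \<le> (bound + 1) * (\<epsilon> / (2 * (bound + 1)))"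
        using \<open>0 < t\<close> bound_nonneg by (intro mult_mono) (auto simp: t_def)
      also have "\<dots> = \<epsilon> / 2" using bound_nonneg by (simp add: field_simps)
      finally show "bound * t \<le> \<epsilon> / 2" .
    qed
    define M where "M = (bound + 1) / t"
    have M: "M > 0" using t bound_nonneg by (simp add: M_def)
    \<comment> \<open>With 1 / (2 M) as the new \<epsilon>, the term M |A^n h| contributes half of
      |A^(n+1) h|, which moves to the left.\<close>
    have M2: "1 / (2 * M) > 0" using M by simp
    from Suc.IH[rule_format, OF M2] obtain K where K0: "K \<ge> 0" "\<forall>h\<in>Dinf. \<forall>i\<le>n.
        norm ((A ^^ i) h) \<le> (1 / (2 * M)) * norm ((A ^^ Suc n) h) + K * norm h" by blast
    note K = K0(1) K0(2)[rule_format]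
    have "norm ((A ^^ Suc n) h) \<le> \<epsilon> * norm ((A ^^ Suc (Suc n)) h) + (2 * M * K) * norm h" if h: "h \<in> Dinf" for h
    proof -
      have "norm (A ((A ^^ n) h)) \<le> M * norm ((A ^^ n) h) + bound * t * norm (A (A ((A ^^ n) h)))"
        unfolding M_def using Dinf_domain[OF power_Dinf[OF h]] Dinf_domain[OF generator_Dinf[OF power_Dinf[OF h]]] t(1,2)
        by (rule generator_interpolation)
      also have "M * norm ((A ^^ n) h) \<le> M * ((1 / (2 * M)) * norm ((A ^^ Suc n) h) + K * norm h)"
        using K(2)[OF h, of n] M by (intro mult_left_mono) auto
      also have "\<dots> = norm ((A ^^ Suc n) h) / 2 + M * K * norm h" using M by (simp add: field_simps)
      finally have 1: "norm ((A ^^ Suc n) h) \<le> norm ((A ^^ Suc n) h) / 2 + M * K * norm h + bound * t * norm ((A ^^ Suc (Suc n)) h)" by simp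
      have "bound * t * norm ((A ^^ Suc (Suc n)) h) \<le> \<epsilon> / 2 * norm ((A ^^ Suc (Suc n)) h)"
        by (rule mult_right_mono[OF t(3)]) simp
      then show ?thesis using 1 by (simp del: funpow.simps(2) add: algebra_simps)
    qed
    moreover have "2 * M * K \<ge> 0" using M K by simp
    ultimately show ?thesis by blast
  qed
  show ?case
  proof (intro allI impI)
    fix \<epsilon> :: real assume \<epsilon>: "\<epsilon> > 0"
    from Suc.IH[rule_format, OF zero_less_one] obtain K where K0: "K \<ge> 0"
      "\<forall>h\<in>Dinf. \<forall>i\<le>n. norm ((A ^^ i) h) \<le> 1 * norm ((A ^^ Suc n) h) + K * norm h" by blast
    note K = K0(1) K0(2)[rule_format]
    from top[OF \<epsilon>] obtain L where L0: "L \<ge> 0"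
      "\<forall>h\<in>Dinf. norm ((A ^^ Suc n) h) \<le> \<epsilon> * norm ((A ^^ Suc (Suc n)) h) + L * norm h" by blast
    note L = L0(1) L0(2)[rule_format]
    have "norm ((A ^^ i) h) \<le> \<epsilon> * norm ((A ^^ Suc (Suc n)) h) + (K + L) * norm h" if h: "h \<in> Dinf" and i: "i \<le> Suc n" for h i
    proof (cases "i = Suc n")
      case True
      have "0 \<le> K * norm h" using K(1) by simp
      then show ?thesis using L(2)[OF h] unfolding True distrib_right by linarith
    next
      case False
      then show ?thesis using K(2)[OF h, of i] L(2)[OF h] i unfolding distrib_right by simp
    qed
    then have "\<forall>h\<in>Dinf. \<forall>i\<le>Suc n. norm ((A ^^ i) h) \<le> \<epsilon> * norm ((A ^^ Suc (Suc n)) h) + (K + L) * norm h" by blast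
    then show "\<exists>K\<ge>0. \<forall>h\<in>Dinf. \<forall>i\<le>Suc n. norm ((A ^^ i) h) \<le> \<epsilon> * norm ((A ^^ Suc (Suc n)) h) + K * norm h"
      by (rule exI[of _ "K + L", OF conjI[rotated]]) (use K(1) L(1) in simp)
  qed
qed

text \<open>Interpolation absorbs the seminorm into the left side, so |A^(n+1) h| and then |A h| are
  bounded by multiples of |h| on a dense subspace; closedness of \<open>A\<close> extends its domain
  to all of \<open>H\<close>. Power 1 must be among the interpolated ones, whence n \<ge> 1.\<close>

lemma generator_bounded_if:
  assumes "\<And>h. h \<in> Dinf \<Longrightarrow> norm ((A ^^ Suc n) h) \<le> C * seminorm (DA_inf ev) n h" "n \<ge> 1"
  shows "domA ev = UNIV"
proof -
  define C' where "C' = \<bar>C\<bar> + 1"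
  have C': "C' > 0" "C \<le> C'" by (auto simp: C'_def)
  \<comment> \<open>The seminorm has n + 1 summands, each contributing \<epsilon> |A^(n+1) h|; with
    the factor C' they add up to one half.\<close>
  define \<epsilon> where "\<epsilon> = 1 / (2 * (C' * real (Suc n)))"
  have \<epsilon>: "\<epsilon> > 0" "C' * real (Suc n) * \<epsilon> = 1/2" using C' by (auto simp: \<epsilon>_def)
  from power_interpolation[rule_format, OF \<epsilon>(1)] obtain K where K0: "K \<ge> 0"
    "\<forall>h\<in>Dinf. \<forall>i\<le>n. norm ((A ^^ i) h) \<le> \<epsilon> * norm ((A ^^ Suc n) h) + K * norm h" by blast
  note K = K0(1) K0(2)[rule_format]
  have top: "norm ((A ^^ Suc n) h) \<le> (2 * C' * real (Suc n) * K) * norm h" if h: "h \<in> Dinf" for h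
  proof -
    have s: "seminorm (DA_inf ev) n h \<le> real (Suc n) * (\<epsilon> * norm ((A ^^ Suc n) h) + K * norm h)"
      unfolding seminorm_Dinf using sum_bounded_above[of "{..n}" "\<lambda>m. norm ((A ^^ m) h)"] K(2)[OF h] by fastforce
    have "0 \<le> seminorm (DA_inf ev) n h" unfolding seminorm_Dinf by (intro sum_nonneg) simp
    then have "norm ((A ^^ Suc n) h) \<le> C' * seminorm (DA_inf ev) n h"
      using assms(1)[OF h] C'(2) by (meson mult_right_mono order_trans)
    also have "\<dots> \<le> C' * (real (Suc n) * (\<epsilon> * norm ((A ^^ Suc n) h) + K * norm h))"
      using s C' by (intro mult_left_mono) auto
    also have "\<dots> = (C' * real (Suc n) * \<epsilon>) * norm ((A ^^ Suc n) h) + C' * real (Suc n) * K * norm h"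
      by (simp only: distrib_left mult.assoc)
    finally show ?thesis unfolding \<epsilon>(2) by (simp del: funpow.simps(2))
  qed
  define M where "M = \<epsilon> * (2 * C' * real (Suc n) * K) + K"
  have M: "norm (A h) \<le> M * norm h" if h: "h \<in> Dinf" for h
  proof -
    have "norm ((A ^^ 1) h) \<le> \<epsilon> * norm ((A ^^ Suc n) h) + K * norm h" using K(2)[OF h assms(2)] .
    also have "\<dots> \<le> \<epsilon> * ((2 * C' * real (Suc n) * K) * norm h) + K * norm h"
      using top[OF h] \<epsilon>(1) K(1) by (intro add_mono mult_left_mono) auto
    finally show ?thesis by (simp add: M_def algebra_simps)
  qed
  have "h \<in> domA ev" for h
  proof -
    have "\<exists>g\<in>Dinf. norm (g - h) \<le> inverse (real (Suc k))" for k by (rule Dinf_dense) simp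
    then obtain g where g: "\<And>k. g k \<in> Dinf" "\<And>k. norm (g k - h) \<le> inverse (real (Suc k))" by metis
    have lim: "g \<longlonglongrightarrow> h"
      unfolding Lim_null[of g h] by (rule Lim_null_comparison[OF _ LIMSEQ_inverse_real_of_nat]) (use g in auto)
    have "Cauchy (\<lambda>k. A (g k))"
    proof (rule CauchyI)
      fix e :: real assume e: "e > 0"
      have "e / (\<bar>M\<bar> + 1) > 0" using e by simp
      then obtain N where N: "\<forall>m\<ge>N. \<forall>n\<ge>N. norm (g m - g n) < e / (\<bar>M\<bar> + 1)"
        using CauchyD[OF LIMSEQ_imp_Cauchy[OF lim]] by blast
      show "\<exists>N. \<forall>m\<ge>N. \<forall>n\<ge>N. norm (A (g m) - A (g n)) < e"
      proof (intro exI[of _ N] allI impI)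
        fix m n assume mn: "N \<le> m" "N \<le> n"
        have "A (g m) - A (g n) = A (g m - g n)" using power_linear(2)[OF g(1) g(1), of 1 m n] by simp
        also have "norm \<dots> \<le> M * norm (g m - g n)" by (rule M) (use g subspace_diff[OF Dinf_subspace] in blast)
        also have "\<dots> \<le> (\<bar>M\<bar> + 1) * norm (g m - g n)" by (rule mult_right_mono) auto
        also have "\<dots> < e"
        proof -
          have "norm (g m - g n) < e / (\<bar>M\<bar> + 1)" using N mn by blast
          then show ?thesis using pos_less_divide_eq[of "\<bar>M\<bar> + 1" "norm (g m - g n)" e] by (simp add: mult.commute)
        qed
        finally show "norm (A (g m) - A (g n)) < e" .
      qed
    qed
    then obtain k where "(\<lambda>n. A (g n)) \<longlonglongrightarrow> k" using Cauchy_convergent_iff convergent_def by blast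
    moreover have "\<forall>\<^sub>F n in sequentially. g n \<in> domA ev"
      using g(1) by (intro always_eventually allI) (rule Dinf_domain)
    ultimately show ?thesis using generator_closed(1)[OF sequentially_bot _ lim] by blast
  qed
  then show ?thesis by blast
qed

end

section \<open>The product of the drift condition\<close>

context forward_curve_space
begin

lemma ev_integrable: "x \<ge> 0 \<Longrightarrow> ev g integrable_on {0..x}"
  by (rule integrable_continuous_real, rule continuous_on_subset[OF ev_continuous]) auto

lemma ev_sprod:
  "f \<in> H0 \<Longrightarrow> g \<in> H0 \<Longrightarrow> x \<ge> 0 \<Longrightarrow> ev (sprod ev f g) x = ev f x * integral {0..x} (ev g)"
  unfolding sprod_def by (simp add: ev_elem sprod_in_space sprod_fun_def)

lemma sprod_bilinear: "subspace_bilinear H0 H0 (sprod ev)"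
proof
  fix x y x' y' :: 'h and r :: real
  assume H: "x \<in> H0" "y \<in> H0"
  show "sprod ev (r *\<^sub>R x) y = r *\<^sub>R sprod ev x y"
    by (rule ev_inject) (use H in \<open>simp add: ev_sprod ev_simps subspace_scale[OF H0_subspace]\<close>)
  have int: "integral {0..t} (ev (r *\<^sub>R y)) = r * integral {0..t} (ev y)" if "t \<ge> 0" for t
  proof -
    have "integral {0..t} (ev (r *\<^sub>R y)) = integral {0..t} (\<lambda>s. r *\<^sub>R ev y s)"
      by (rule Henstock_Kurzweil_Integration.integral_cong) (simp add: ev_simps)
    then show ?thesis by simp
  qed
  show "sprod ev x (r *\<^sub>R y) = r *\<^sub>R sprod ev x y"
    by (rule ev_inject) (use H in \<open>simp add: ev_sprod ev_simps int subspace_scale[OF H0_subspace]\<close>)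
next
  fix x x' y :: 'h assume H: "x \<in> H0" "x' \<in> H0" "y \<in> H0"
  show "sprod ev (x + x') y = sprod ev x y + sprod ev x' y"
    by (rule ev_inject) (use H in \<open>simp add: ev_sprod ev_simps subspace_add[OF H0_subspace] algebra_simps\<close>)
next
  fix x y y' :: 'h assume H: "x \<in> H0" "y \<in> H0" "y' \<in> H0"
  have "integral {0..t} (ev (y + y')) = integral {0..t} (ev y) + integral {0..t} (ev y')" if "t \<ge> 0" for t
  proof -
    have "integral {0..t} (ev (y + y')) = integral {0..t} (\<lambda>s. ev y s + ev y' s)"
      by (rule Henstock_Kurzweil_Integration.integral_cong) (simp add: ev_simps)
    then show ?thesis by (simp add: Henstock_Kurzweil_Integration.integral_add ev_integrable that)
  qed
  then show "sprod ev x (y + y') = sprod ev x y + sprod ev x y'"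
    by (intro ev_inject) (use H in \<open>simp add: ev_sprod ev_simps subspace_add[OF H0_subspace] algebra_simps\<close>)
qed (use H0_closed H0_subspace sprod_continuous in auto)

text \<open>With \<open>F = \<integral> f\<close> and \<open>G = \<integral> g\<close>, the products in \<open>(f G)'' = f'' G + 2 f' g + f g'\<close> lie in the
  space because \<open>f' g = f' (\<integral> g') + g(0) f'\<close>.\<close>

lemma sprod_second_derivative:
  assumes f: "f \<in> D0inf" and g: "g \<in> D0inf"
  defines "w \<equiv> sprod ev (A (A f)) g + 2 *\<^sub>R sprod ev (A f) (A g) + (2 * ev g 0) *\<^sub>R A f
    + sprod ev (A g) (A f) + ev f 0 *\<^sub>R A g"
  shows "sprod ev f g \<in> domA ev" "A (sprod ev f g) \<in> domA ev" "A (A (sprod ev f g)) = w"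
    "A (sprod ev f g) = (1 / tmax) *\<^sub>R (S tmax (sprod ev f g) - sprod ev f g - J tmax w)"
proof -
  have H0: "(A ^^ k) f \<in> H0" "(A ^^ k) g \<in> H0" and dom: "(A ^^ k) f \<in> domA ev" "(A ^^ k) g \<in> domA ev" for k
    using f g by (auto simp: D0inf_iff Dinf_iff)
  note H0' = H0[of 0] H0[of 1] H0[of 2] and dom' = dom[of 0] dom[of 1]
  let ?G = "\<lambda>x. integral {0..x} (ev g)"
  have dG: "(?G has_real_derivative ev g x) (at x within {0..})" if "x \<ge> 0" for x
    by (rule primitive_derivative[OF ev_continuous that])
  have df: "(ev f has_real_derivative ev (A f) x) (at x within {0..})"
    "(ev (A f) has_real_derivative ev (A (A f)) x) (at x within {0..})"
    "(ev g has_real_derivative ev (A g) x) (at x within {0..})" if "x \<ge> 0" for x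
    using generator_derivative[of _ x] dom' that by simp_all
  have FTC: "integral {0..x} (ev (A u)) = ev u x - ev u 0" if "u \<in> domA ev" "x \<ge> 0" for u x
  proof (rule integral_unique, rule fundamental_theorem_of_calculus[OF that(2)])
    fix s assume "s \<in> {0..x}"
    then show "(ev u has_vector_derivative ev (A u) s) (at s within {0..x})"
      using DERIV_subset[OF generator_derivative[OF that(1), of s], of "{0..x}"]
      by (auto simp: has_real_derivative_iff_has_vector_derivative)
  qed
  let ?k = "\<lambda>x. ev (A f) x * ?G x + ev f x * ev g x"
  have 1: "(ev (sprod ev f g) has_real_derivative ?k x) (at x within {0..})" if x: "x \<ge> 0" for x
  proof (rule has_field_derivative_transform_within[where d = 1])
    show "((\<lambda>x. ev f x * ?G x) has_real_derivative ?k x) (at x within {0..})"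
      by (rule DERIV_cong[OF DERIV_mult[OF df(1)[OF x] dG[OF x]]]) (simp add: algebra_simps)
  qed (use x H0' in \<open>simp_all add: ev_sprod\<close>)
  have 2: "(?k has_real_derivative ev w x) (at x within {0..})" if x: "x \<ge> 0" for x
  proof (rule DERIV_cong[OF DERIV_add[OF DERIV_mult[OF df(2)[OF x] dG[OF x]] DERIV_mult[OF df(1)[OF x] df(3)[OF x]]]])
    show "ev (A (A f)) x * ?G x + ev g x * ev (A f) x + (ev (A f) x * ev g x + ev (A g) x * ev f x) = ev w x"
      using x H0' dom' unfolding w_def
      by (simp add: ev_simps ev_sprod FTC numeral_2_eq_2) (simp add: algebra_simps)
  qed
  show "sprod ev f g \<in> domA ev" "A (sprod ev f g) \<in> domA ev" "A (A (sprod ev f g)) = w"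
    "A (sprod ev f g) = (1 / tmax) *\<^sub>R (S tmax (sprod ev f g) - sprod ev f g - J tmax w)"
    using second_derivative[OF 1 2 tmax_pos order_refl] by blast+
qed

lemma D0inf_generator: "f \<in> D0inf \<Longrightarrow> A f \<in> D0inf"
  unfolding D0inf_iff using generator_Dinf by (metis comp_apply funpow_Suc_right)

text \<open>Applying A twice to a product yields products of elements of D(A_0^\<infinity>) and
  multiples of such elements, so the induction advances by two powers.\<close>

lemma sprod_Dinf:
  assumes "f \<in> D0inf" "g \<in> D0inf" shows "sprod ev f g \<in> Dinf"
proof -
  have "(A ^^ m) (sprod ev f g) \<in> domA ev" for m
    using assms
  proof (induction m arbitrary: f g rule: less_induct)
    case (less m)
    note sd = sprod_second_derivative[OF less.prems]
    consider "m = 0" | "m = 1" | k where "m = Suc (Suc k)" by (metis One_nat_def not0_implies_Suc)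
    then show ?case
    proof cases
      case 3
      let ?D = "{h. \<forall>i<Suc k. (A ^^ i) h \<in> domA ev}"
      \<comment> \<open>All powers up to k are kept in the domain, since this makes the set a
        subspace and lets the sum be treated term by term.\<close>
      have IH: "sprod ev f' g' \<in> ?D" if "f' \<in> D0inf" "g' \<in> D0inf" for f' g'
        using less.IH[OF _ that] 3 by auto
      have D: "h \<in> ?D" if "h \<in> D0inf" for h using that by (auto simp: D0inf_iff Dinf_iff)
      note A = D0inf_generator[OF less.prems(1)] D0inf_generator[OF less.prems(2)]
      have "A (A (sprod ev f g)) \<in> ?D"
        unfolding sd(3) by (intro subspace_add[OF power_domain_subspace] subspace_scale[OF power_domain_subspace]
            IH D A less.prems D0inf_generator)
      then have "(A ^^ k) (A (A (sprod ev f g))) \<in> domA ev" by blast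
      then show ?thesis by (simp add: 3 funpow_swap1)
    qed (use sd in auto)
  qed
  then show ?thesis by (simp add: Dinf_iff)
qed

lemma csmooth_ev: "csmooth c \<Longrightarrow> x \<ge> 0 \<Longrightarrow> csmooth (\<lambda>t. ev (c t) x)"
  using bounded_linear.csmooth[OF ev_bounded_linear] by blast

text \<open>The same recursion by two powers. Power 1 is reached by Taylor's formula, which writes A
  of the product through the bounded operators \<open>S tmax\<close> and
  \<open>J tmax\<close>.\<close>

lemma sprod_csmooth:
  assumes "\<And>t. f t \<in> D0inf" "\<And>t. g t \<in> D0inf"
    "\<And>i. csmooth (\<lambda>t. (A ^^ i) (f t))" "\<And>i. csmooth (\<lambda>t. (A ^^ i) (g t))"
  shows "csmooth (\<lambda>t. (A ^^ m) (sprod ev (f t) (g t)))"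
  using assms
proof (induction m arbitrary: f g rule: less_induct)
  case (less m)
  note sd = sprod_second_derivative[OF less.prems(1,2)]
  note A0 = D0inf_generator[OF less.prems(1)] D0inf_generator[OF less.prems(2)]
  note A1 = D0inf_generator[OF A0(1)]
  have Asm: "csmooth (\<lambda>t. (A ^^ i) (A (f t)))" "csmooth (\<lambda>t. (A ^^ i) (A (g t)))"
    "csmooth (\<lambda>t. (A ^^ i) (A (A (f t))))" for i
    using less.prems(3)[of "Suc i"] less.prems(4)[of "Suc i"] less.prems(3)[of "Suc (Suc i)"]
    by (simp_all add: funpow_swap1)
  have base: "csmooth (\<lambda>t. sprod ev (u t) (v t))"
    if "\<And>t. u t \<in> D0inf" "\<And>t. v t \<in> D0inf" "\<And>i. csmooth (\<lambda>t. (A ^^ i) (u t))" "\<And>i. csmooth (\<lambda>t. (A ^^ i) (v t))" for u v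
  proof (rule subspace_bilinear.csmooth[OF sprod_bilinear])
    show "csmooth u" "csmooth v" using that(3)[of 0] that(4)[of 0] by simp_all
    show "u t \<in> H0" "v t \<in> H0" for t
      using that(1)[of t] that(2)[of t] unfolding D0inf_iff by (metis funpow_0)+
  qed
  have ev0: "csmooth (\<lambda>t. ev (g t) 0)" "csmooth (\<lambda>t. ev (f t) 0)"
    using csmooth_ev[of g 0] csmooth_ev[of f 0] less.prems(3)[of 0] less.prems(4)[of 0] by simp_all
  let ?w = "\<lambda>t. sprod ev (A (A (f t))) (g t) + 2 *\<^sub>R sprod ev (A (f t)) (A (g t)) + (2 * ev (g t) 0) *\<^sub>R A (f t)
    + sprod ev (A (g t)) (A (f t)) + ev (f t) 0 *\<^sub>R A (g t)"
  have w: "csmooth (\<lambda>t. (A ^^ k) (?w t))"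
    if "\<And>u v. (\<And>t. u t \<in> D0inf) \<Longrightarrow> (\<And>t. v t \<in> D0inf) \<Longrightarrow> (\<And>i. csmooth (\<lambda>t. (A ^^ i) (u t))) \<Longrightarrow>
        (\<And>i. csmooth (\<lambda>t. (A ^^ i) (v t))) \<Longrightarrow> csmooth (\<lambda>t. (A ^^ k) (sprod ev (u t) (v t)))" for k
  proof -
    have D: "h \<in> Dinf" if "h \<in> D0inf" for h using that by (simp add: D0inf_iff)
    note sc = subspace_scale[OF Dinf_subspace] and ad = subspace_add[OF Dinf_subspace]
    have "(A ^^ k) (?w t) = (A ^^ k) (sprod ev (A (A (f t))) (g t)) + 2 *\<^sub>R (A ^^ k) (sprod ev (A (f t)) (A (g t)))
        + (2 * ev (g t) 0) *\<^sub>R (A ^^ k) (A (f t)) + (A ^^ k) (sprod ev (A (g t)) (A (f t))) + ev (f t) 0 *\<^sub>R (A ^^ k) (A (g t))" for t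
      by (simp add: power_linear(1) power_scaleR sc ad sprod_Dinf D A0 A1 less.prems)
    then show ?thesis
      by (simp only:) (intro csmooth_add csmooth_scaleR csmooth_const csmooth_mult that Asm A0 A1 less.prems ev0)
  qed
  consider "m = 0" | "m = 1" | k where "m = Suc (Suc k)" by (metis One_nat_def not0_implies_Suc)
  then show ?case
  proof cases
    case 1
    then show ?thesis using base[OF less.prems] by simp
  next
    case 2
    have tm: "0 \<le> tmax" using tmax_pos by simp
    have w0: "csmooth ?w" using w[of 0] base by simp
    have "csmooth (\<lambda>t. (1 / tmax) *\<^sub>R (S tmax (sprod ev (f t) (g t)) - sprod ev (f t) (g t) - J tmax (?w t)))"
      by (intro csmooth_scaleR_right csmooth_diff bounded_linear.csmooth[OF shift_linear]
          bounded_linear.csmooth[OF J_linear] base less.prems w0 tm order_refl)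
    then show ?thesis unfolding 2 using sd(4) by simp
  next
    case 3
    have "csmooth (\<lambda>t. (A ^^ k) (?w t))" by (rule w, rule less.IH) (use 3 in auto)
    then have "csmooth (\<lambda>t. (A ^^ k) (A (A (sprod ev (f t) (g t)))))" unfolding sd(3) .
    then show ?thesis by (simp add: 3 funpow_swap1)
  qed
qed

lemma smooth_into_sprod:
  assumes "smooth_into f" "smooth_into g" "\<And>x. f x \<in> D0inf" "\<And>x. g x \<in> D0inf"
  shows "smooth_into (\<lambda>x. sprod ev (f x) (g x))"
  unfolding smooth_into_def smooth_along_def
proof (intro conjI allI impI)
  show "sprod ev (f x) (g x) \<in> Dinf" for x using sprod_Dinf assms by blast
  show "csmooth (\<lambda>t. (A ^^ m) (sprod ev (f (c t)) (g (c t))))" if "csmooth c" for m c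
    by (rule sprod_csmooth) (use assms that in \<open>auto simp: smooth_into_def smooth_along_def\<close>)
qed

section \<open>Operations on smooth maps into the smooth vectors\<close>

lemma smooth_into_add: "smooth_into f \<Longrightarrow> smooth_into g \<Longrightarrow> smooth_into (\<lambda>x. f x + g x)"
  unfolding smooth_into_def smooth_along_def
  by (auto simp: power_linear(1) intro!: csmooth_add subspace_add[OF Dinf_subspace])

lemma smooth_into_scaleR: "smooth_into f \<Longrightarrow> smooth_into (\<lambda>x. r *\<^sub>R f x)"
  unfolding smooth_into_def smooth_along_def
  by (auto simp: power_scaleR intro!: csmooth_scaleR_right subspace_scale[OF Dinf_subspace])

lemma smooth_into_diff: "smooth_into f \<Longrightarrow> smooth_into g \<Longrightarrow> smooth_into (\<lambda>x. f x - g x)"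
  using smooth_into_add[of f "\<lambda>x. (- 1) *\<^sub>R g x"] smooth_into_scaleR[of g "- 1"] by simp

lemma smooth_into_0: "smooth_into (\<lambda>x. 0)"
  by (simp add: smooth_into_def smooth_along_def power_0 subspace_0[OF Dinf_subspace])

lemma smooth_into_sum: "(\<And>i. i \<in> N \<Longrightarrow> smooth_into (f i)) \<Longrightarrow> smooth_into (\<lambda>x. \<Sum>i\<in>N. f i x)"
  by (induction N rule: infinite_finite_induct) (auto intro: smooth_into_add smooth_into_0)

lemma smooth_into_generator: "smooth_into f \<Longrightarrow> smooth_into (\<lambda>x. A (f x))"
  unfolding smooth_into_def by (auto simp: generator_Dinf simp flip: funpow_swap1 dest: spec[of _ "Suc _"])

lemma smooth_into_compose: "smooth_into f \<Longrightarrow> smooth_along g \<Longrightarrow> smooth_into (\<lambda>x. f (g x))"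
  unfolding smooth_into_def smooth_along_def by auto

lemma directional_Dinf:
  assumes Q: "smooth_into Q"
  shows "directional Q x v \<in> Dinf" "(A ^^ m) (directional Q x v) = directional (\<lambda>x. (A ^^ m) (Q x)) x v"
  using Dinf_closed_derivative[of "\<lambda>s. Q (x + s *\<^sub>R v)" "\<lambda>m. directional (\<lambda>x. (A ^^ m) (Q x)) x v" 0]
    directional_has_vector_derivative[of "\<lambda>x. (A ^^ _) (Q x)"] Q
  by (auto simp: smooth_into_def)

lemma smooth_into_directional:
  fixes Q :: "'x::banach \<Rightarrow> 'h"
  assumes Q: "smooth_into Q" and X: "smooth_along X" and V: "smooth_along V"
  shows "smooth_into (\<lambda>y. directional Q (X y) (V y))"
  unfolding smooth_into_def smooth_along_def directional_Dinf(2)[OF Q]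
proof (intro conjI allI impI directional_Dinf(1)[OF Q])
  show "csmooth (\<lambda>t. directional (\<lambda>x. (A ^^ m) (Q x)) (X (c t)) (V (c t)))" if "csmooth c" for m c
    by (rule csmooth_directional) (use Q X V that in \<open>auto simp: smooth_into_def smooth_along_def\<close>)
qed

text \<open>Uniqueness is decided by the seminorm of index 0, which is the norm of
  \<open>H\<close>.\<close>

lemma dir_deriv_eq:
  assumes "has_curve_derivative (DA_inf ev) (\<lambda>t. f (x + t *\<^sub>R v)) k 0"
  shows "dir_deriv (DA_inf ev) f x v = k"
  unfolding dir_deriv_def
proof (rule the_equality)
  show "has_curve_derivative (DA_inf ev) (\<lambda>t. f (x + t *\<^sub>R v)) k 0" by (rule assms)
next
  fix k' assume k': "has_curve_derivative (DA_inf ev) (\<lambda>t. f (x + t *\<^sub>R v)) k' 0"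
  have "((\<lambda>t. f (x + t *\<^sub>R v)) has_vector_derivative k) (at 0)"
    if "has_curve_derivative (DA_inf ev) (\<lambda>t. f (x + t *\<^sub>R v)) k 0" for k
  proof -
    have "((\<lambda>s. seminorm (DA_inf ev) 0 ((1 / (s - 0)) *\<^sub>R (f (x + s *\<^sub>R v) - f (x + 0 *\<^sub>R v)) - k)) \<longlongrightarrow> 0) (at 0)"
      using that unfolding has_curve_derivative_def by blast
    then show ?thesis
      unfolding seminorm_Dinf has_vector_derivative_iff_quotient
      by (simp add: tendsto_norm_zero_iff Lim_null[symmetric])
  qed
  from this[OF assms] this[OF k'] show "k' = k" using vector_derivative_unique_at by blast
qed

end

section \<open>Jet fields\<close>

text \<open>The library has completeness of \<open>bcontfun\<close> only for functions on a metric space.\<close>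

instantiation nat :: metric_space
begin
definition dist_nat :: "nat \<Rightarrow> nat \<Rightarrow> real" where "dist_nat m n = \<bar>real m - real n\<bar>"
definition uniformity_nat :: "(nat \<times> nat) filter" where
  "uniformity_nat = (INF e\<in>{0<..}. principal {(x, y). dist x y < e})"
instance
proof
  fix U :: "nat set"
  have "\<forall>\<^sub>F (x', y) in uniformity. x' = x \<longrightarrow> y \<in> U" if "x \<in> U" for x :: nat
  proof (rule filter_leD)
    show "uniformity \<le> principal {(x :: nat, y). dist x y < 1}"
      unfolding uniformity_nat_def by (rule INF_lower) simp
    show "\<forall>\<^sub>F (x', y) in principal {(x :: nat, y). dist x y < 1}. x' = x \<longrightarrow> y \<in> U"
    proof -
      have "b = x" if "\<bar>real x - real b\<bar> < 1" for b
      proof -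
        have "real_of_int \<bar>int x - int b\<bar> < 1" using that by simp
        then show ?thesis by linarith
      qed
      with that show ?thesis by (auto simp: eventually_principal dist_nat_def)
    qed
  qed
  then show "open U \<longleftrightarrow> (\<forall>x\<in>U. \<forall>\<^sub>F (x', y) in uniformity. x' = x \<longrightarrow> y \<in> U)"
    by (simp add: open_discrete)
qed (auto simp: dist_nat_def uniformity_nat_def)
end

instance bcontfun :: (metric_space, banach) banach ..

text \<open>The jet \<open>(l h, l (A h), \<dots>)\<close> occupies the second components of a sequence in the ambient space
  \<open>nat \<Rightarrow>\<^sub>C (real \<times> 'b)\<close> of the Banach maps.\<close>

definition jet_unit :: "nat \<Rightarrow> 'b::real_normed_vector \<Rightarrow> nat \<Rightarrow>\<^sub>C (real \<times> 'b)" where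
  "jet_unit i b = Bcontfun (\<lambda>n. if n = i then (0, b) else 0)"

definition jet_coord :: "nat \<Rightarrow> (nat \<Rightarrow>\<^sub>C (real \<times> 'b)) \<Rightarrow> 'b::real_normed_vector" where
  "jet_coord i s = snd (apply_bcontfun s i)"

lemma apply_jet_unit: "apply_bcontfun (jet_unit i b) n = (if n = i then (0, b) else 0)"
proof -
  have "(\<lambda>n. if n = i then (0 :: real, b) else 0) \<in> bcontfun"
    by (rule bcontfun_normI[where b = "norm b"])
      (auto simp: norm_Pair continuous_on_open_vimage open_discrete)
  then show ?thesis by (simp add: jet_unit_def Bcontfun_inverse)
qed

lemma jet_unit_linear: "bounded_linear (jet_unit i)"
proof (rule bounded_linear_intro[where K = 1])
  show "jet_unit i (x + y) = jet_unit i x + jet_unit i y" for x y :: 'a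
    by (rule bcontfun_eqI) (simp add: apply_jet_unit plus_bcontfun.rep_eq)
  show "jet_unit i (r *\<^sub>R x) = r *\<^sub>R jet_unit i x" for r and x :: 'a
    by (rule bcontfun_eqI) (simp add: apply_jet_unit scaleR_bcontfun.rep_eq)
  show "norm (jet_unit i x) \<le> norm x * 1" for x :: 'a
    by (rule norm_bound) (simp add: apply_jet_unit norm_Pair)
qed

lemma jet_coord_linear: "bounded_linear (jet_coord i)"
proof (rule bounded_linear_intro[where K = 1])
  show "jet_coord i (x + y) = jet_coord i x + jet_coord i y" for x y :: "nat \<Rightarrow>\<^sub>C (real \<times> 'a)"
    by (simp add: jet_coord_def plus_bcontfun.rep_eq)
  show "jet_coord i (r *\<^sub>R x) = r *\<^sub>R jet_coord i x" for r and x :: "nat \<Rightarrow>\<^sub>C (real \<times> 'a)"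
    by (simp add: jet_coord_def scaleR_bcontfun.rep_eq)
  show "norm (jet_coord i x) \<le> norm x * 1" for x :: "nat \<Rightarrow>\<^sub>C (real \<times> 'a)"
    using norm_snd_le[of "snd (apply_bcontfun x i)" "fst (apply_bcontfun x i)"] norm_bounded[of x i]
    by (simp add: jet_coord_def)
qed

lemma jet_coord_unit: "jet_coord i (jet_unit j b) = (if i = j then b else 0)"
  by (simp add: jet_coord_def apply_jet_unit)

lemma smooth_along_bounded_linear: "bounded_linear f \<Longrightarrow> smooth_along f"
  by (simp add: smooth_along_def bounded_linear.csmooth)

lemma smooth_along_add: "smooth_along f \<Longrightarrow> smooth_along g \<Longrightarrow> smooth_along (\<lambda>x. f x + g x)"
  by (simp add: smooth_along_def csmooth_add)

lemma smooth_along_sum: "(\<And>i. i \<in> N \<Longrightarrow> smooth_along (f i)) \<Longrightarrow> smooth_along (\<lambda>x. \<Sum>i\<in>N. f i x)"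
  by (simp add: smooth_along_def csmooth_sum)

lemma smooth_along_compose: "smooth_along f \<Longrightarrow> smooth_along g \<Longrightarrow> smooth_along (\<lambda>x. f (g x))"
  by (simp add: smooth_along_def)

lemma smooth_along_scaleR: "smooth_along f \<Longrightarrow> smooth_along (\<lambda>x. r *\<^sub>R f x)"
  by (simp add: smooth_along_def csmooth_scaleR_right)

locale forward_curve_model = forward_curve_space ev H0
  for ev :: "'h::{real_inner, complete_space} \<Rightarrow> real \<Rightarrow> real" and H0 +
  fixes l :: "'h \<Rightarrow> 'b::banach" and d :: nat and \<phi> :: "nat \<Rightarrow> 'b \<Rightarrow> 'h"
  assumes l: "bounded_linear l"
    and \<phi>: "\<And>j. j \<in> {1..d} \<Longrightarrow>
      smooth_map (normed_space_on (UNIV :: 'b set) norm) UNIV (DA0_inf ev H0) (\<phi> j)"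
begin

definition jet :: "nat \<Rightarrow> 'h \<Rightarrow> nat \<Rightarrow>\<^sub>C (real \<times> 'b)" where
  "jet N h = (\<Sum>i\<le>N. jet_unit i (l ((A ^^ i) h)))"

text \<open>Evaluates maps of low-order jets on jets of higher order, so that two fields can be
  given a common order.\<close>

definition jet_truncate :: "nat \<Rightarrow> (nat \<Rightarrow>\<^sub>C (real \<times> 'b)) \<Rightarrow> nat \<Rightarrow>\<^sub>C (real \<times> 'b)" where
  "jet_truncate N s = (\<Sum>i\<le>N. jet_unit i (jet_coord i s))"

text \<open>On jets the unbounded \<open>A\<close> acts as this bounded shift, at the price of one
  order.\<close>

definition jet_shift :: "nat \<Rightarrow> (nat \<Rightarrow>\<^sub>C (real \<times> 'b)) \<Rightarrow> nat \<Rightarrow>\<^sub>C (real \<times> 'b)" where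
  "jet_shift N s = (\<Sum>i\<le>N. jet_unit i (jet_coord (Suc i) s))"

lemma jet_coord_jet: "i \<le> N \<Longrightarrow> jet_coord i (jet N h) = l ((A ^^ i) h)"
  unfolding jet_def by (simp add: linear_sum[OF bounded_linear.linear[OF jet_coord_linear]] jet_coord_unit)

lemma jet_truncate_jet: "N \<le> M \<Longrightarrow> jet_truncate N (jet M h) = jet N h"
  unfolding jet_truncate_def jet_def[of N] by (rule sum.cong) (simp_all add: jet_coord_jet)

lemma jet_shift_jet: "jet_shift N (jet (Suc N) h) = jet N (A h)"
  unfolding jet_shift_def jet_def[of N]
  by (rule sum.cong) (simp_all add: jet_coord_jet funpow_Suc_right del: funpow.simps)

lemma jet_linear:
  assumes "x \<in> Dinf" "v \<in> Dinf"
  shows "jet N (x + v) = jet N x + jet N v" "jet N (t *\<^sub>R v) = t *\<^sub>R jet N v" "jet N (x - v) = jet N x - jet N v"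
proof -
  have lin: "linear l" "linear (jet_unit i :: 'b \<Rightarrow> _)" for i
    using l jet_unit_linear bounded_linear.linear by blast+
  show "jet N (x + v) = jet N x + jet N v" "jet N (t *\<^sub>R v) = t *\<^sub>R jet N v" "jet N (x - v) = jet N x - jet N v"
    using assms by (simp_all add: jet_def power_linear power_scaleR linear_add linear_diff linear_scale lin
        sum.distrib sum_subtractf scaleR_sum_right)
qed

lemma jet_bound: "\<exists>C\<ge>0. \<forall>h. norm (jet N h) \<le> C * seminorm (DA_inf ev) N h"
proof -
  obtain C where C: "C > 0" "\<And>h. norm (l h) \<le> norm h * C" using bounded_linear.pos_bounded[OF l] by blast
  have u: "norm (jet_unit i b :: nat \<Rightarrow>\<^sub>C (real \<times> 'b)) \<le> norm b" for i and b :: 'b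
    by (rule norm_bound) (simp add: apply_jet_unit norm_Pair)
  have "norm (jet N h) \<le> C * seminorm (DA_inf ev) N h" for h
    unfolding jet_def seminorm_Dinf sum_distrib_left
    by (intro sum_norm_le order_trans[OF u]) (use C(2) in \<open>simp add: mult.commute\<close>)
  then show ?thesis using C by (intro exI[of _ C]) auto
qed

lemma csmooth_jet:
  assumes "\<And>m. csmooth (\<lambda>t. (A ^^ m) (c t))"
  shows "csmooth (\<lambda>t. jet N (c t))"
  unfolding jet_def
  by (intro csmooth_sum bounded_linear.csmooth[OF jet_unit_linear] bounded_linear.csmooth[OF l] assms)

lemma smooth_along_jet: "smooth_into Q \<Longrightarrow> smooth_along (\<lambda>x. jet N (Q x))"
  by (auto simp: smooth_into_def smooth_along_def intro!: csmooth_jet)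

lemma smooth_along_truncate: "smooth_along (jet_truncate N)" and smooth_along_shift: "smooth_along (jet_shift N)"
  unfolding jet_truncate_def[abs_def] jet_shift_def[abs_def]
  by (intro smooth_along_sum smooth_along_bounded_linear bounded_linear_compose[OF jet_unit_linear jet_coord_linear])+

definition jet_field :: "real \<Rightarrow> nat \<Rightarrow> ((nat \<Rightarrow>\<^sub>C (real \<times> 'b)) \<Rightarrow> 'h) \<Rightarrow> ('h \<Rightarrow> 'h) \<Rightarrow> bool" where
  "jet_field r N Q P \<longleftrightarrow> smooth_into Q \<and> (\<forall>h\<in>Dinf. P h = r *\<^sub>R A h + Q (jet N h))"

lemma jet_field_mono:
  assumes "jet_field r N Q P" "N \<le> M"
  shows "jet_field r M (\<lambda>s. Q (jet_truncate N s)) P"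
  using assms smooth_into_compose[OF _ smooth_along_truncate] unfolding jet_field_def
  by (simp add: jet_truncate_jet)

lemma jet_field_Dinf: "jet_field r N Q P \<Longrightarrow> h \<in> Dinf \<Longrightarrow> P h \<in> Dinf"
  unfolding jet_field_def smooth_into_def
  by (auto intro!: subspace_add[OF Dinf_subspace] subspace_scale[OF Dinf_subspace] generator_Dinf)

text \<open>Along a line both \<open>A h\<close> and \<open>jet N h\<close> are affine, so only
  \<open>Q\<close> has to be differentiated.\<close>

lemma jet_field_derivative:
  assumes P: "jet_field r N Q P" and x: "x \<in> Dinf" and v: "v \<in> Dinf"
  shows "has_curve_derivative (DA_inf ev) (\<lambda>t. P (x + t *\<^sub>R v)) (r *\<^sub>R A v + directional Q (jet N x) (jet N v)) 0"
proof -
  have Q: "smooth_into Q" and Peq: "\<And>h. h \<in> Dinf \<Longrightarrow> P h = r *\<^sub>R A h + Q (jet N h)"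
    using P by (auto simp: jet_field_def)
  note sc = subspace_scale[OF Dinf_subspace] and ad = subspace_add[OF Dinf_subspace]
  have D: "x + t *\<^sub>R v \<in> Dinf" for t using x v sc ad by blast
  have DQ: "Q y \<in> Dinf" for y using Q by (simp add: smooth_into_def)
  show ?thesis
  proof (subst has_curve_derivative_Dinf, rule jet_field_Dinf[OF P D], intro conjI allI)
    show "r *\<^sub>R A v + directional Q (jet N x) (jet N v) \<in> Dinf"
      using v directional_Dinf(1)[OF Q] sc ad generator_Dinf by blast
    fix m
    have A: "A (x + t *\<^sub>R v) = A x + t *\<^sub>R A v" for t
      using power_linear(1)[OF x sc[OF v], of 1] power_scaleR[OF v, of 1] by simp
    have eq: "(A ^^ m) (P (x + t *\<^sub>R v)) = r *\<^sub>R ((A ^^ m) (A x) + t *\<^sub>R (A ^^ m) (A v)) + (A ^^ m) (Q (jet N x + t *\<^sub>R jet N v))" for t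
      by (simp add: Peq D A jet_linear(1) jet_linear(2)[OF x v] x v sc ad power_linear(1) power_scaleR generator_Dinf DQ)
    have "((\<lambda>t. (A ^^ m) (Q (jet N x + t *\<^sub>R jet N v))) has_vector_derivative (A ^^ m) (directional Q (jet N x) (jet N v))) (at 0)"
      unfolding directional_Dinf(2)[OF Q] by (rule directional_has_vector_derivative) (use Q in \<open>simp add: smooth_into_def\<close>)
    then have "((\<lambda>t. (A ^^ m) (P (x + t *\<^sub>R v))) has_vector_derivative
        r *\<^sub>R (A ^^ m) (A v) + (A ^^ m) (directional Q (jet N x) (jet N v))) (at 0)"
      unfolding eq by (auto intro!: derivative_eq_intros)
    then show "((\<lambda>t. (A ^^ m) (P (x + t *\<^sub>R v))) has_vector_derivative
        (A ^^ m) (r *\<^sub>R A v + directional Q (jet N x) (jet N v))) (at 0)"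
      by (simp add: power_linear(1) power_scaleR sc generator_Dinf v directional_Dinf(1)[OF Q])
  qed
qed

text \<open>The second-order terms \<open>A\<^sup>2 h\<close> cancel, so every bracket factors through a finite jet.\<close>

lemma jet_field_bracket:
  assumes P1: "jet_field r1 N1 Q1 P1" and P2: "jet_field r2 N2 Q2 P2"
  shows "\<exists>N Q. jet_field 0 N Q (lie_bracket (DA_inf ev) P1 P2)"
proof -
  define N where "N = max N1 N2"
  define T1 T2 where "T1 s = Q1 (jet_truncate N1 s)" and "T2 s = Q2 (jet_truncate N2 s)" for s
  have F1: "jet_field r1 N T1 P1" and F2: "jet_field r2 N T2 P2"
    unfolding T1_def T2_def using jet_field_mono[OF P1, of N] jet_field_mono[OF P2, of N] by (simp_all add: N_def)
  have T: "smooth_into T1" "smooth_into T2" using F1 F2 by (auto simp: jet_field_def)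
  define \<pi> where "\<pi> = jet_truncate N"
  \<comment> \<open>What is left after r1 r2 A^2 h has dropped out. The direction P2 h has the jet
    r2 jet(A h) + jet(T2), and \<open>jet_shift\<close> reads jet(A h) off the jet of order N + 1,
    whence \<open>Suc N\<close> below.\<close>
  define Q where "Q s = (r1 *\<^sub>R A (T2 (\<pi> s)) + directional T1 (\<pi> s) (r2 *\<^sub>R jet_shift N s + jet N (T2 (\<pi> s))))
    - (r2 *\<^sub>R A (T1 (\<pi> s)) + directional T2 (\<pi> s) (r1 *\<^sub>R jet_shift N s + jet N (T1 (\<pi> s))))" for s
  have \<pi>: "smooth_along \<pi>" unfolding \<pi>_def by (rule smooth_along_truncate)
  note T\<pi> = smooth_into_compose[OF T(1) \<pi>] smooth_into_compose[OF T(2) \<pi>]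
  have V: "smooth_along (\<lambda>s. r *\<^sub>R jet_shift N s + jet N (T (\<pi> s)))" if "smooth_into T" for r T
    using smooth_along_jet[OF smooth_into_compose[OF that \<pi>], of N] smooth_along_shift
    by (intro smooth_along_add smooth_along_scaleR)
  have "smooth_into Q"
    unfolding Q_def[abs_def]
    by (intro smooth_into_diff smooth_into_add smooth_into_scaleR smooth_into_generator T\<pi>
        smooth_into_directional[OF T(1) \<pi> V[OF T(2)]] smooth_into_directional[OF T(2) \<pi> V[OF T(1)]])
  moreover have "lie_bracket (DA_inf ev) P1 P2 h = 0 *\<^sub>R A h + Q (jet (Suc N) h)" if h: "h \<in> Dinf" for h
  proof -
    note sc = subspace_scale[OF Dinf_subspace] and ad = subspace_add[OF Dinf_subspace]
    have D: "T1 s \<in> Dinf" "T2 s \<in> Dinf" for s using T by (auto simp: smooth_into_def)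
    have eq: "P1 h = r1 *\<^sub>R A h + T1 (jet N h)" "P2 h = r2 *\<^sub>R A h + T2 (jet N h)"
      using F1 F2 h by (auto simp: jet_field_def)
    have A: "A (r *\<^sub>R A h + T) = r *\<^sub>R A (A h) + A T" if "T \<in> Dinf" for r T
      using power_linear(1)[OF sc[OF generator_Dinf[OF h]] that, of 1] power_scaleR[OF generator_Dinf[OF h], of 1] by simp
    have J: "jet N (r *\<^sub>R A h + T) = r *\<^sub>R jet N (A h) + jet N T" if "T \<in> Dinf" for r T
      using that h jet_linear(2)[OF h generator_Dinf[OF h]] by (simp add: jet_linear(1) sc generator_Dinf)
    have "dir_deriv (DA_inf ev) P1 h (P2 h) = r1 *\<^sub>R A (P2 h) + directional T1 (jet N h) (jet N (P2 h))"
      "dir_deriv (DA_inf ev) P2 h (P1 h) = r2 *\<^sub>R A (P1 h) + directional T2 (jet N h) (jet N (P1 h))"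
      using jet_field_derivative[OF F1 h jet_field_Dinf[OF F2 h]] jet_field_derivative[OF F2 h jet_field_Dinf[OF F1 h]]
      by (auto intro: dir_deriv_eq)
    then show ?thesis
      unfolding lie_bracket_def Q_def \<pi>_def eq
      by (simp add: A J D jet_shift_jet jet_truncate_jet algebra_simps)
  qed
  ultimately show ?thesis unfolding jet_field_def by blast
qed

text \<open>The drift without \<open>A h\<close>. As l is linear, the derivative of \<phi>^j(l h) in
  the direction \<sigma>^j(h) is that of \<phi>^j at y = l h in the direction l(\<phi>^j(y)), so
  everything depends on y alone.\<close>

definition drift_correction :: "'b \<Rightarrow> 'h" where
  "drift_correction y = (\<Sum>j\<in>{1..d}. sprod ev (\<phi> j y) (\<phi> j y))
    - (1/2) *\<^sub>R (\<Sum>j\<in>{1..d}. directional (\<phi> j) y (l (\<phi> j y)))"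

lemma smooth_into_\<phi>: "j \<in> {1..d} \<Longrightarrow> smooth_into (\<phi> j)"
  and \<phi>_D0inf: "j \<in> {1..d} \<Longrightarrow> \<phi> j y \<in> D0inf"
  using smooth_into_D0inf[OF \<phi>] by blast+

lemma smooth_into_drift_correction: "smooth_into drift_correction"
  unfolding drift_correction_def[abs_def]
proof (intro smooth_into_diff smooth_into_sum smooth_into_scaleR)
  fix j assume j: "j \<in> {1..d}"
  show "smooth_into (\<lambda>y. sprod ev (\<phi> j y) (\<phi> j y))"
    by (intro smooth_into_sprod smooth_into_\<phi> \<phi>_D0inf j)
  show "smooth_into (\<lambda>y. directional (\<phi> j) y (l (\<phi> j y)))"
    using smooth_along_bounded_linear[OF bounded_linear_ident]
    by (intro smooth_into_directional smooth_into_\<phi> j smooth_along_compose[OF smooth_along_bounded_linear[OF l]]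
        smooth_into_smooth_along)
qed

lemma jet_field_vol: "j \<in> {1..d} \<Longrightarrow> jet_field 0 0 (\<lambda>s. \<phi> j (jet_coord 0 s)) (vol l \<phi> j)"
  using smooth_into_compose[OF smooth_into_\<phi> smooth_along_bounded_linear[OF jet_coord_linear]]
  unfolding jet_field_def vol_def by (simp add: jet_coord_jet)

lemma directional_linear_argument:
  "linear L \<Longrightarrow> directional (\<lambda>s. f (L s)) x v = directional f (L x) (L v)"
  by (simp add: directional_def linear_add linear_scale)

lemma jet_field_drift: "jet_field 1 0 (\<lambda>s. drift_correction (jet_coord 0 s)) (drift ev l d \<phi>)"
  unfolding jet_field_def
proof (intro conjI ballI)
  show "smooth_into (\<lambda>s. drift_correction (jet_coord 0 s))"
    by (rule smooth_into_compose[OF smooth_into_drift_correction smooth_along_bounded_linear[OF jet_coord_linear]])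
  fix h assume h: "h \<in> Dinf"
  have "dir_deriv (DA_inf ev) (vol l \<phi> j) h (vol l \<phi> j h) = directional (\<phi> j) (l h) (l (\<phi> j (l h)))"
    if j: "j \<in> {1..d}" for j
  proof -
    have "vol l \<phi> j h \<in> Dinf" by (rule jet_field_Dinf[OF jet_field_vol[OF j] h])
    from dir_deriv_eq[OF jet_field_derivative[OF jet_field_vol[OF j] h this]]
    show ?thesis
      by (simp add: directional_linear_argument[OF bounded_linear.linear[OF jet_coord_linear]] jet_coord_jet vol_def[abs_def])
  qed
  then show "drift ev l d \<phi> h = 1 *\<^sub>R A h + drift_correction (jet_coord 0 (jet 0 h))"
    by (simp add: drift_def drift_correction_def jet_coord_jet vol_def)
qed

text \<open>Only the drift has r = 1 among the generators, and a bracket has r = 0 whatever the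
  coefficients of its arguments.\<close>

lemma iterated_brackets_jet_field:
  assumes "X \<in> iterated_brackets (DA_inf ev) (insert (drift ev l d \<phi>) (vol l \<phi> ` {1..d}))"
  shows "X = drift ev l d \<phi> \<or> (\<exists>N Q. jet_field 0 N Q X)"
  using assms
proof induction
  case (generator X)
  then show ?case using jet_field_vol by blast
next
  case (bracket X Y)
  then obtain r N Q r' N' Q' where "jet_field r N Q X" "jet_field r' N' Q' Y"
    using jet_field_drift by metis
  then show ?case using jet_field_bracket by blast
qed

text \<open>The factorization is P = Q o jet N through the whole ambient space, whose own norm is
  complete.\<close>

lemma jet_field_banach_map:
  assumes P: "jet_field 0 N Q P" and V: "openin (seminorm_topology (DA_inf ev)) V"
  shows "banach_map TYPE(nat \<Rightarrow>\<^sub>C (real \<times> 'b)) (DA_inf ev) V P"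
proof -
  have Q: "smooth_into Q" and eq: "\<And>h. h \<in> Dinf \<Longrightarrow> P h = Q (jet N h)" using P by (auto simp: jet_field_def)
  have VD: "V \<subseteq> Dinf" using V by (simp add: openin_seminorm_topology seminorm_open_def)
  have jets: "csmooth (\<lambda>t. jet N (c t))" if "smooth_curve (DA_inf ev) c" for c
    using that by (intro csmooth_jet) (simp add: smooth_curve_Dinf)
  have top: "openin (seminorm_topology (normed_space_on (UNIV :: (nat \<Rightarrow>\<^sub>C (real \<times> 'b)) set) norm)) UNIV"
    by (auto simp: openin_seminorm_topology seminorm_open_def normed_space_on_def intro: exI[of _ 1])
  have "smooth_map (DA_inf ev) V (DA_inf ev) P"
    unfolding smooth_map_def
  proof (intro conjI allI impI V)
    show "P ` V \<subseteq> Dinf" using VD jet_field_Dinf[OF P] by blast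
    fix c assume c: "smooth_curve (DA_inf ev) c \<and> range c \<subseteq> V"
    then have "c t \<in> Dinf" for t using VD by blast
    then have "P \<circ> c = (\<lambda>t. Q (jet N (c t)))" using eq by (simp add: fun_eq_iff)
    then show "smooth_curve (DA_inf ev) (P \<circ> c)" using Q jets c by (simp add: smooth_into_iff)
  qed
  moreover have "banach_norm_on (UNIV :: (nat \<Rightarrow>\<^sub>C (real \<times> 'b)) set) norm"
    unfolding banach_norm_on_def
  proof (intro conjI allI impI)
    fix s :: "nat \<Rightarrow> nat \<Rightarrow>\<^sub>C (real \<times> 'b)"
    assume s: "range s \<subseteq> UNIV \<and> (\<forall>\<epsilon>>0. \<exists>M. \<forall>m\<ge>M. \<forall>n\<ge>M. norm (s m - s n) < \<epsilon>)"
    then have "Cauchy s" by (intro CauchyI) blast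
    then obtain x where "s \<longlonglongrightarrow> x" using Cauchy_convergent_iff convergent_def by blast
    then show "\<exists>x\<in>UNIV. (\<lambda>n. norm (s n - x)) \<longlonglongrightarrow> 0"
      by (auto simp: tendsto_norm_zero_iff Lim_null[symmetric])
  qed (auto intro: norm_triangle_ineq)
  moreover have "smooth_map (DA_inf ev) V (normed_space_on UNIV norm) (jet N)"
    unfolding smooth_map_def using V jets by (auto simp: smooth_curve_normed o_def) (simp add: normed_space_on_def)
  moreover have "smooth_map (normed_space_on (UNIV :: (nat \<Rightarrow>\<^sub>C (real \<times> 'b)) set) norm) UNIV (DA_inf ev) Q"
    unfolding smooth_map_def using Q top by (auto simp: smooth_curve_normed o_def smooth_into_iff)
  moreover have "\<forall>x\<in>V. P x = Q (jet N x)" using VD eq by blast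
  ultimately show ?thesis unfolding banach_map_def using top by blast
qed

lemma seminorm_mono: "n \<le> m \<Longrightarrow> seminorm (DA_inf ev) n h \<le> seminorm (DA_inf ev) m h"
  unfolding seminorm_Dinf by (rule sum_mono2) auto

lemma jet_field_continuous:
  assumes P: "jet_field r N Q P" and h: "h \<in> Dinf" and e: "e > 0"
  shows "\<exists>n. \<exists>\<delta>>0. \<forall>y\<in>Dinf. seminorm (DA_inf ev) n (y - h) < \<delta> \<longrightarrow> norm (P y - P h) < e"
proof -
  have Q: "smooth_into Q" and eq: "\<And>h. h \<in> Dinf \<Longrightarrow> P h = r *\<^sub>R A h + Q (jet N h)"
    using P by (auto simp: jet_field_def)
  obtain \<eta> where \<eta>: "\<eta> > 0" "\<And>s. norm (s - jet N h) < \<eta> \<Longrightarrow> norm (Q s - Q (jet N h)) < e / 2"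
    using smooth_along_isCont[OF smooth_into_smooth_along[OF Q], of "jet N h"] e
    unfolding continuous_at_eps_delta dist_norm by (metis half_gt_zero)
  obtain C where C: "C \<ge> 0" "\<And>h. norm (jet N h) \<le> C * seminorm (DA_inf ev) N h" using jet_bound by blast
  \<comment> \<open>Order N controls the jet and order 1 the term r A h. Adding 1 to C and |r| below
    avoids division by 0.\<close>
  define n where "n = max N 1"
  define \<delta> where "\<delta> = min (\<eta> / (C + 1)) (e / (2 * (\<bar>r\<bar> + 1)))"
  have \<delta>: "\<delta> > 0" using \<eta>(1) C(1) e by (auto simp: \<delta>_def)
  have "norm (P y - P h) < e" if y: "y \<in> Dinf" and s: "seminorm (DA_inf ev) n (y - h) < \<delta>" for y
  proof -
    have sN: "seminorm (DA_inf ev) N (y - h) < \<eta> / (C + 1)" "seminorm (DA_inf ev) 1 (y - h) < e / (2 * (\<bar>r\<bar> + 1))"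
      using s seminorm_mono[of N n "y - h"] seminorm_mono[of 1 n "y - h"] by (auto simp: n_def \<delta>_def)
    have "norm (jet N y - jet N h) \<le> C * seminorm (DA_inf ev) N (y - h)"
      using C(2)[of "y - h"] by (simp add: jet_linear y h)
    also have "\<dots> \<le> C * (\<eta> / (C + 1))" using sN(1) C(1) by (intro mult_left_mono) auto
    also have "\<dots> < \<eta>" using C(1) \<eta>(1) by (simp add: field_simps)
    finally have q: "norm (Q (jet N y) - Q (jet N h)) < e / 2" by (rule \<eta>(2))
    have "norm (A y - A h) \<le> seminorm (DA_inf ev) 1 (y - h)"
      using power_linear(2)[OF y h, of 1] by (simp add: seminorm_Dinf)
    then have "\<bar>r\<bar> * norm (A y - A h) \<le> \<bar>r\<bar> * (e / (2 * (\<bar>r\<bar> + 1)))" using sN(2) by (intro mult_left_mono) auto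
    also have "\<dots> \<le> e / 2" using e by (simp add: field_simps)
    finally have a: "norm (r *\<^sub>R (A y - A h)) \<le> e / 2" by simp
    have "P y - P h = r *\<^sub>R (A y - A h) + (Q (jet N y) - Q (jet N h))" by (simp add: eq y h algebra_simps)
    then show ?thesis using norm_triangle_ineq[of "r *\<^sub>R (A y - A h)" "Q (jet N y) - Q (jet N h)"] a q by simp
  qed
  with \<delta> show ?thesis by blast
qed

end

section \<open>Finite families of vectors\<close>

text \<open>Coefficients belong to indices, so families whose members move or coincide are treated
  uniformly.\<close>

lemma span_finite_family:
  assumes "finite I"
  shows "span (b ` I) = range (\<lambda>c. \<Sum>i\<in>I. c i *\<^sub>R b i)"
proof
  show "range (\<lambda>c. \<Sum>i\<in>I. c i *\<^sub>R b i) \<subseteq> span (b ` I)"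
    by (rule image_subsetI) (intro span_sum span_scale span_base imageI)
  show "span (b ` I) \<subseteq> range (\<lambda>c. \<Sum>i\<in>I. c i *\<^sub>R b i)"
  proof (rule span_minimal)
    show "b ` I \<subseteq> range (\<lambda>c. \<Sum>i\<in>I. c i *\<^sub>R b i)"
    proof
      fix v assume "v \<in> b ` I"
      then obtain i where i: "i \<in> I" "v = b i" by blast
      have "(\<Sum>j\<in>I. (if j = i then 1 else 0) *\<^sub>R b j) = (\<Sum>j\<in>I. if j = i then b j else 0)"
        by (rule sum.cong) auto
      then have "(\<Sum>j\<in>I. (if j = i then 1 else 0) *\<^sub>R b j) = v"
        using i assms by simp
      then show "v \<in> range (\<lambda>c. \<Sum>i\<in>I. c i *\<^sub>R b i)"
        by (intro range_eqI[where x = "\<lambda>j. if j = i then 1 else 0"]) simp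
    qed
    show "subspace (range (\<lambda>c. \<Sum>i\<in>I. c i *\<^sub>R b i))"
    proof (rule subspaceI)
      show "0 \<in> range (\<lambda>c. \<Sum>i\<in>I. c i *\<^sub>R b i)" by (rule range_eqI[of _ _ "\<lambda>_. 0"]) simp
      fix x y assume "x \<in> range (\<lambda>c. \<Sum>i\<in>I. c i *\<^sub>R b i)" "y \<in> range (\<lambda>c. \<Sum>i\<in>I. c i *\<^sub>R b i)"
      then obtain c e where "x = (\<Sum>i\<in>I. c i *\<^sub>R b i)" "y = (\<Sum>i\<in>I. e i *\<^sub>R b i)" by blast
      then have "x + y = (\<Sum>i\<in>I. (c i + e i) *\<^sub>R b i)" by (simp add: scaleR_add_left sum.distrib)
      then show "x + y \<in> range (\<lambda>c. \<Sum>i\<in>I. c i *\<^sub>R b i)"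
        by (intro range_eqI[where x = "\<lambda>i. c i + e i"])
    next
      fix x r assume "x \<in> range (\<lambda>c. \<Sum>i\<in>I. c i *\<^sub>R b i)"
      then obtain c where "x = (\<Sum>i\<in>I. c i *\<^sub>R b i)" by blast
      then have "r *\<^sub>R x = (\<Sum>i\<in>I. (r * c i) *\<^sub>R b i)" by (simp add: scaleR_sum_right)
      then show "r *\<^sub>R x \<in> range (\<lambda>c. \<Sum>i\<in>I. c i *\<^sub>R b i)"
        by (intro range_eqI[where x = "\<lambda>i. r * c i"])
    qed
  qed
qed

lemma lin_indep_family_iff:
  assumes "finite I"
  shows "lin_indep_family I b \<longleftrightarrow> (\<forall>c. (\<Sum>i\<in>I. c i *\<^sub>R b i) = 0 \<longrightarrow> (\<forall>i\<in>I. c i = 0))"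
proof (intro iffI allI impI ballI)
  fix c i assume b: "lin_indep_family I b" and c: "(\<Sum>i\<in>I. c i *\<^sub>R b i) = 0" and i: "i \<in> I"
  have inj: "inj_on b I" and ind: "independent (b ` I)" using b by (auto simp: lin_indep_family_def)
  have "(\<Sum>v\<in>b ` I. c (the_inv_into I b v) *\<^sub>R v) = 0"
    using c by (simp add: sum.reindex[OF inj] the_inv_into_f_f[OF inj])
  then have "c (the_inv_into I b (b i)) = 0"
    using independentD[OF ind _ subset_refl, where u = "\<lambda>v. c (the_inv_into I b v)" and v = "b i"] assms i by simp
  then show "c i = 0" by (simp add: the_inv_into_f_f[OF inj i])
next
  assume H: "\<forall>c. (\<Sum>i\<in>I. c i *\<^sub>R b i) = 0 \<longrightarrow> (\<forall>i\<in>I. c i = 0)"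
  have "i = j" if "i \<in> I" "j \<in> I" "b i = b j" for i j
  proof (rule ccontr)
    assume "i \<noteq> j"
    let ?c = "\<lambda>k. (if k = i then 1 else 0) - (if k = j then 1 else (0 :: real))"
    have "(\<Sum>k\<in>I. ?c k *\<^sub>R b k) = (\<Sum>k\<in>I. if k = i then b k else 0) - (\<Sum>k\<in>I. if k = j then b k else 0)"
      unfolding sum_subtractf[symmetric] by (rule sum.cong) auto
    also have "\<dots> = 0" using that assms by simp
    finally have "?c i = 0" using that(1) by (rule H[rule_format])
    with \<open>i \<noteq> j\<close> show False by simp
  qed
  then have "inj_on b I" by (auto intro: inj_onI)
  moreover have "independent (b ` I)"
  proof
    assume "dependent (b ` I)"
    then obtain u v where u: "v \<in> b ` I" "u v \<noteq> 0" "(\<Sum>v\<in>b ` I. u v *\<^sub>R v) = 0"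
      using assms by (auto simp: dependent_finite)
    then have "(\<Sum>i\<in>I. u (b i) *\<^sub>R b i) = 0" by (simp add: sum.reindex[OF \<open>inj_on b I\<close>])
    then show False using H u by auto
  qed
  ultimately show "lin_indep_family I b" by (simp add: lin_indep_family_def)
qed

text \<open>Gram-Schmidt: the new direction q is a minus its projection, hence orthogonal to the old
  span.\<close>

lemma orthogonal_projection_finite:
  fixes F :: "'a::real_inner set"
  assumes "finite F"
  shows "\<exists>y\<in>span F. \<forall>z\<in>span F. (x - y) \<bullet> z = 0"
  using assms
proof (induction F arbitrary: x rule: finite_induct)
  case (insert a F)
  obtain p where p: "p \<in> span F" "\<And>z. z \<in> span F \<Longrightarrow> (a - p) \<bullet> z = 0" using insert.IH[of a] by blast
  obtain y where y: "y \<in> span F" "\<And>z. z \<in> span F \<Longrightarrow> (x - y) \<bullet> z = 0" using insert.IH[of x] by blast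
  define q where "q = a - p"
  \<comment> \<open>If a lies in the old span then q = 0, and division by 0 gives r = 0, a correct
    choice.\<close>
  define r where "r = (x \<bullet> q) / (q \<bullet> q)"
  have sub: "z \<in> span (insert a F)" if "z \<in> span F" for z using that span_mono[of F "insert a F"] by blast
  have q: "q \<in> span (insert a F)" unfolding q_def by (intro span_diff sub p(1) span_base) simp
  have "y \<bullet> q = 0" using p(2)[OF y(1)] by (simp add: q_def inner_commute)
  then have xq: "(x - (y + r *\<^sub>R q)) \<bullet> q = 0" by (simp add: r_def inner_diff_left inner_add_left)
  have "(x - (y + r *\<^sub>R q)) \<bullet> z = 0" if "z \<in> span (insert a F)" for z
  proof -
    obtain k where k: "z - k *\<^sub>R a \<in> span F" using \<open>z \<in> span (insert a F)\<close> by (auto simp: span_breakdown_eq)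
    define w where "w = (z - k *\<^sub>R a) + k *\<^sub>R p"
    have w: "w \<in> span F" unfolding w_def by (intro span_add span_scale k p(1))
    have z: "z = k *\<^sub>R q + w" by (simp add: w_def q_def algebra_simps)
    have "(x - (y + r *\<^sub>R q)) \<bullet> w = 0"
      using y(2)[OF w] p(2)[OF w] by (simp add: q_def[symmetric] diff_add_eq_diff_diff_swap inner_diff_left inner_add_left)
    then show ?thesis using xq by (simp add: z inner_add_right)
  qed
  moreover have "y + r *\<^sub>R q \<in> span (insert a F)" by (intro span_add span_scale q sub y(1))
  ultimately show ?case by blast
qed auto

text \<open>Independence makes b_i minus its projection onto the span of the other vectors nonzero;
  rescaled, this difference reads off the i-th coefficient.\<close>

lemma lin_indep_family_dual:
  fixes b :: "'i \<Rightarrow> 'a::real_inner"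
  assumes I: "finite I" and b: "lin_indep_family I b" and i: "i \<in> I"
  shows "\<exists>w. \<forall>c. w \<bullet> (\<Sum>j\<in>I. c j *\<^sub>R b j) = c i"
proof -
  obtain y where y: "y \<in> span (b ` (I - {i}))" "\<And>z. z \<in> span (b ` (I - {i})) \<Longrightarrow> (b i - y) \<bullet> z = 0"
    using orthogonal_projection_finite[of "b ` (I - {i})" "b i"] I by blast
  define u where "u = b i - y"
  have nz: "u \<noteq> 0"
  proof
    assume "u = 0"
    then have "b i \<in> span (b ` (I - {i}))" using y(1) by (simp add: u_def)
    then obtain c where c: "b i = (\<Sum>j\<in>I - {i}. c j *\<^sub>R b j)"
      using span_finite_family[of "I - {i}" b] I by auto
    have "(\<Sum>j\<in>I. (c(i := - 1)) j *\<^sub>R b j) = - b i + (\<Sum>j\<in>I - {i}. (c(i := - 1)) j *\<^sub>R b j)"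
      using I i by (subst sum.remove[of _ i]) auto
    also have "(\<Sum>j\<in>I - {i}. (c(i := - 1)) j *\<^sub>R b j) = b i" unfolding c by (rule sum.cong) auto
    finally have "(\<Sum>j\<in>I. (c(i := - 1)) j *\<^sub>R b j) = 0" by simp
    from b[unfolded lin_indep_family_iff[OF I], rule_format, OF this i] show False by simp
  qed
  have uj: "u \<bullet> b j = (if j = i then u \<bullet> u else 0)" if "j \<in> I" for j
  proof (cases "j = i")
    case True
    have "u \<bullet> y = 0" unfolding u_def by (rule y(2)[OF y(1)])
    moreover have "b i = u + y" by (simp add: u_def)
    ultimately show ?thesis using True by (simp add: inner_add_right)
  next
    case False
    then show ?thesis using y(2)[of "b j"] that by (auto simp: u_def intro: span_base)
  qed
  have "((1 / (u \<bullet> u)) *\<^sub>R u) \<bullet> (\<Sum>j\<in>I. c j *\<^sub>R b j) = c i" for c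
  proof -
    have "u \<bullet> (\<Sum>j\<in>I. c j *\<^sub>R b j) = (\<Sum>j\<in>I. if j = i then c j * (u \<bullet> u) else 0)"
      unfolding inner_sum_right inner_scaleR_right by (rule sum.cong) (simp_all add: uj)
    then show ?thesis using nz I i by simp
  qed
  then show ?thesis by blast
qed

lemma lin_indep_family_coefficient_bound:
  fixes b :: "'i \<Rightarrow> 'a::real_inner"
  assumes I: "finite I" and b: "lin_indep_family I b"
  shows "\<exists>K\<ge>0. \<forall>c. (\<Sum>i\<in>I. \<bar>c i\<bar>) \<le> K * norm (\<Sum>i\<in>I. c i *\<^sub>R b i)"
proof -
  obtain w where w: "\<And>i c. i \<in> I \<Longrightarrow> w i \<bullet> (\<Sum>j\<in>I. c j *\<^sub>R b j) = c i"
    using lin_indep_family_dual[OF I b] by metis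
  have "(\<Sum>i\<in>I. \<bar>c i\<bar>) \<le> (\<Sum>i\<in>I. norm (w i)) * norm (\<Sum>i\<in>I. c i *\<^sub>R b i)" for c
    unfolding sum_distrib_right
  proof (rule sum_mono)
    fix i assume "i \<in> I"
    then show "\<bar>c i\<bar> \<le> norm (w i) * norm (\<Sum>i\<in>I. c i *\<^sub>R b i)"
      using Cauchy_Schwarz_ineq2[of "w i" "\<Sum>j\<in>I. c j *\<^sub>R b j"] by (simp add: w)
  qed
  then show ?thesis by (intro exI[of _ "\<Sum>i\<in>I. norm (w i)"]) (auto intro: sum_nonneg)
qed

text \<open>With K \<delta> \<le> 1/2 the perturbation costs at most half the sum of the
  coefficients and is absorbed. The constant is uniform over all nearby families, as limits of
  moving spans require.\<close>

lemma lin_indep_family_perturb: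
  fixes b :: "'i \<Rightarrow> 'a::real_inner"
  assumes I: "finite I" and b: "lin_indep_family I b"
  shows "\<exists>\<delta>>0. \<exists>K\<ge>0. \<forall>b'. (\<forall>i\<in>I. norm (b' i - b i) < \<delta>) \<longrightarrow> lin_indep_family I b' \<and>
    (\<forall>c. (\<Sum>i\<in>I. \<bar>c i\<bar>) \<le> K * norm (\<Sum>i\<in>I. c i *\<^sub>R b' i))"
proof -
  obtain K where K: "K \<ge> 0" "\<And>c. (\<Sum>i\<in>I. \<bar>c i\<bar>) \<le> K * norm (\<Sum>i\<in>I. c i *\<^sub>R b i)"
    using lin_indep_family_coefficient_bound[OF I b] by blast
  define \<delta> where "\<delta> = 1 / (2 * (K + 1))"
  have \<delta>: "\<delta> > 0" "K * \<delta> \<le> 1/2" using K(1) by (auto simp: \<delta>_def field_simps)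
  have bound: "(\<Sum>i\<in>I. \<bar>c i\<bar>) \<le> 2 * K * norm (\<Sum>i\<in>I. c i *\<^sub>R b' i)"
    if b': "\<forall>i\<in>I. norm (b' i - b i) < \<delta>" for b' c
  proof -
    have "norm (\<Sum>i\<in>I. c i *\<^sub>R (b i - b' i)) \<le> (\<Sum>i\<in>I. \<bar>c i\<bar> * \<delta>)"
    proof (rule sum_norm_le)
      fix i assume "i \<in> I"
      then have "norm (b i - b' i) \<le> \<delta>" using b' by (simp add: norm_minus_commute less_imp_le)
      then show "norm (c i *\<^sub>R (b i - b' i)) \<le> \<bar>c i\<bar> * \<delta>" by (simp add: mult_left_mono)
    qed
    moreover have "(\<Sum>i\<in>I. c i *\<^sub>R b i) = (\<Sum>i\<in>I. c i *\<^sub>R b' i) + (\<Sum>i\<in>I. c i *\<^sub>R (b i - b' i))"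
      by (simp add: sum.distrib[symmetric] scaleR_diff_right)
    ultimately have "norm (\<Sum>i\<in>I. c i *\<^sub>R b i) \<le> norm (\<Sum>i\<in>I. c i *\<^sub>R b' i) + (\<Sum>i\<in>I. \<bar>c i\<bar>) * \<delta>"
      using norm_triangle_ineq[of "\<Sum>i\<in>I. c i *\<^sub>R b' i" "\<Sum>i\<in>I. c i *\<^sub>R (b i - b' i)"] by (simp add: sum_distrib_right)
    then have "(\<Sum>i\<in>I. \<bar>c i\<bar>) \<le> K * (norm (\<Sum>i\<in>I. c i *\<^sub>R b' i) + (\<Sum>i\<in>I. \<bar>c i\<bar>) * \<delta>)"
      using K(2)[of c] K(1) mult_left_mono order_trans by blast
    also have "\<dots> = K * norm (\<Sum>i\<in>I. c i *\<^sub>R b' i) + (K * \<delta>) * (\<Sum>i\<in>I. \<bar>c i\<bar>)" by (simp add: algebra_simps)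
    also have "(K * \<delta>) * (\<Sum>i\<in>I. \<bar>c i\<bar>) \<le> 1/2 * (\<Sum>i\<in>I. \<bar>c i\<bar>)"
      using \<delta>(2) by (intro mult_right_mono) (auto intro: sum_nonneg)
    finally show ?thesis by simp
  qed
  have "lin_indep_family I b'" if b': "\<forall>i\<in>I. norm (b' i - b i) < \<delta>" for b'
    unfolding lin_indep_family_iff[OF I]
  proof (intro allI impI ballI)
    fix c i assume "(\<Sum>i\<in>I. c i *\<^sub>R b' i) = 0" and i: "i \<in> I"
    then have "(\<Sum>i\<in>I. \<bar>c i\<bar>) \<le> 0" using bound[OF b', of c] by simp
    moreover have "\<bar>c i\<bar> \<le> (\<Sum>i\<in>I. \<bar>c i\<bar>)" by (rule member_le_sum) (use i I in auto)
    ultimately show "c i = 0" by simp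
  qed
  with bound \<delta>(1) K(1) show ?thesis by (intro exI[of _ \<delta>] conjI exI[of _ "2 * K"]) auto
qed

text \<open>Let u be the part of g0 orthogonal to the limit span. The coefficients of g(s) stay
  bounded by the uniform estimate while u . b_i(s) tends to 0, so u . g0 = 0 and hence u =
  0.\<close>

lemma span_limit:
  fixes b :: "'s \<Rightarrow> 'i \<Rightarrow> 'a::real_inner"
  assumes I: "finite I" and b0: "lin_indep_family I b0" and F: "F \<noteq> bot"
    and b: "\<And>i. i \<in> I \<Longrightarrow> ((\<lambda>s. b s i) \<longlongrightarrow> b0 i) F"
    and g: "\<forall>\<^sub>F s in F. g s \<in> span (b s ` I)" "(g \<longlongrightarrow> g0) F"
  shows "g0 \<in> span (b0 ` I)"
proof -
  obtain \<delta> K where \<delta>: "\<delta> > 0" and K: "\<And>b' c. \<forall>i\<in>I. norm (b' i - b0 i) < \<delta> \<Longrightarrow>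
      (\<Sum>i\<in>I. \<bar>c i\<bar>) \<le> K * norm (\<Sum>i\<in>I. c i *\<^sub>R b' i)"
    using lin_indep_family_perturb[OF I b0] by metis
  obtain y where y: "y \<in> span (b0 ` I)" "\<And>z. z \<in> span (b0 ` I) \<Longrightarrow> (g0 - y) \<bullet> z = 0"
    using orthogonal_projection_finite[of "b0 ` I" g0] I by blast
  define u where "u = g0 - y"
  have u0: "u \<bullet> b0 i = 0" if "i \<in> I" for i using y(2)[of "b0 i"] that by (auto simp: u_def intro: span_base)
  define e where "e s = (\<Sum>i\<in>I. \<bar>u \<bullet> (b s i - b0 i)\<bar>)" for s
  have "\<forall>\<^sub>F s in F. norm (b s i - b0 i) < \<delta>" if "i \<in> I" for i
    using tendstoD[OF b[OF that] \<delta>] by (simp add: dist_norm)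
  then have "\<forall>\<^sub>F s in F. \<forall>i\<in>I. norm (b s i - b0 i) < \<delta>" using I by (simp add: eventually_ball_finite)
  with g(1) have bd: "\<forall>\<^sub>F s in F. norm (u \<bullet> g s) \<le> (K * norm (g s)) * e s"
  proof eventually_elim
    case (elim s)
    obtain c where c: "g s = (\<Sum>i\<in>I. c i *\<^sub>R b s i)" using elim(1) span_finite_family[OF I, of "b s"] by auto
    have "u \<bullet> g s = (\<Sum>i\<in>I. c i * (u \<bullet> (b s i - b0 i)))"
      unfolding c inner_sum_right by (rule sum.cong) (simp_all add: inner_diff_right u0)
    also have "norm \<dots> \<le> (\<Sum>i\<in>I. \<bar>c i\<bar> * e s)"
      using I by (intro sum_norm_le) (auto simp: abs_mult e_def intro!: mult_left_mono member_le_sum)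
    also have "\<dots> = (\<Sum>i\<in>I. \<bar>c i\<bar>) * e s" by (simp add: sum_distrib_right)
    also have "\<dots> \<le> (K * norm (g s)) * e s"
      unfolding c using K[OF elim(2), of c] by (intro mult_right_mono) (auto simp: e_def intro: sum_nonneg)
    finally show ?case .
  qed
  have "(e \<longlongrightarrow> (\<Sum>i\<in>I. \<bar>u \<bullet> (b0 i - b0 i)\<bar>)) F"
    unfolding e_def by (intro tendsto_intros b)
  then have "((\<lambda>s. (K * norm (g s)) * e s) \<longlongrightarrow> (K * norm g0) * 0) F" by (intro tendsto_intros g(2)) simp
  then have "((\<lambda>s. u \<bullet> g s) \<longlongrightarrow> 0) F" by (intro Lim_null_comparison[OF bd]) simp
  moreover have "((\<lambda>s. u \<bullet> g s) \<longlongrightarrow> u \<bullet> g0) F" by (intro tendsto_intros g(2))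
  ultimately have "u \<bullet> g0 = 0" using tendsto_unique[OF F] by blast
  moreover have "u \<bullet> y = 0" unfolding u_def by (rule y(2)[OF y(1)])
  ultimately have "u \<bullet> u = 0" by (simp add: u_def inner_diff_right)
  then show ?thesis using y(1) by (simp add: u_def)
qed

lemma independent_card_dimension:
  assumes "has_dimension D k" "independent B" "B \<subseteq> D" "D \<subseteq> span B"
  shows "finite B" "card B = k"
proof -
  obtain C where C: "finite C" "card C = k" "independent C" "span C = D" using assms(1) by (auto simp: has_dimension_def)
  have 1: "finite B \<and> card B \<le> card C" by (rule independent_span_bound) (use assms C in auto)
  have 2: "finite C \<and> card C \<le> card B" by (rule independent_span_bound) (use assms C 1 span_superset in auto)
  show "finite B" "card B = k" using 1 2 C by auto
qed

text \<open>For points near \<open>h0\<close>, where independence persists by continuity and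
  spanning has to come from the dimension.\<close>

lemma lin_indep_family_span_dimension:
  assumes D: "has_dimension D k" and b: "lin_indep_family I b" and I: "b ` I \<subseteq> D" "finite I"
  shows "card I \<le> k" "card I = k \<Longrightarrow> span (b ` I) = D"
proof -
  obtain C where C: "finite C" "card C = k" "independent C" "span C = D" using D by (auto simp: has_dimension_def)
  have inj: "inj_on b I" and ind: "independent (b ` I)" using b by (auto simp: lin_indep_family_def)
  have "finite (b ` I) \<and> card (b ` I) \<le> card C" by (rule independent_span_bound) (use ind C I in auto)
  then show "card I \<le> k" by (simp add: card_image[OF inj] C)
  assume k: "card I = k"
  have sub: "span (b ` I) \<subseteq> D" using span_mono[OF I(1)] C(4) span_span by blast
  moreover have "D \<subseteq> span (b ` I)"
  proof
    fix x assume x: "x \<in> D"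
    show "x \<in> span (b ` I)"
    proof (rule ccontr)
      assume nx: "x \<notin> span (b ` I)"
      then have ind': "independent (insert x (b ` I))" using ind by (simp add: independent_insert)
      have "finite (insert x (b ` I)) \<and> card (insert x (b ` I)) \<le> card C"
        by (rule independent_span_bound) (use ind' C I x in auto)
      moreover have "x \<notin> b ` I" using nx span_base[of x "b ` I"] by argo
      then have "card (insert x (b ` I)) = Suc k" using I(2) k card_image[OF inj] by simp
      ultimately show False using C(2) by simp
    qed
  qed
  ultimately show "span (b ` I) = D" by blast
qed

section \<open>The drift and the volatilities\<close>

context forward_curve_model
begin

text \<open>Jet fields are continuous into \<open>H\<close>, and independence survives small
  perturbations in the norm of \<open>H\<close>.\<close>

lemma jet_fields_independent_open:
  assumes U: "openin (seminorm_topology (DA_inf ev)) U" and Idx: "finite Idx"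
    and P: "\<And>i. i \<in> Idx \<Longrightarrow> \<exists>r N Q. jet_field r N Q (P i)"
  shows "openin (seminorm_topology (DA_inf ev)) {h \<in> U. lin_indep_family Idx (\<lambda>i. P i h)}"
  unfolding openin_seminorm_topology seminorm_open_def
proof (intro conjI ballI)
  have Uo: "seminorm_open (DA_inf ev) U" using U by (simp add: openin_seminorm_topology)
  then show "{h \<in> U. lin_indep_family Idx (\<lambda>i. P i h)} \<subseteq> Dinf" by (auto simp: seminorm_open_def)
  fix h assume h: "h \<in> {h \<in> U. lin_indep_family Idx (\<lambda>i. P i h)}"
  then have hD: "h \<in> Dinf" using Uo by (auto simp: seminorm_open_def)
  obtain M e where e: "e > 0" "\<And>y. y \<in> Dinf \<Longrightarrow> \<forall>n\<le>M. seminorm (DA_inf ev) n (y - h) < e \<Longrightarrow> y \<in> U"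
    using Uo h unfolding seminorm_open_def by blast
  obtain \<delta> where \<delta>: "\<delta> > 0" "\<And>b'. \<forall>i\<in>Idx. norm (b' i - P i h) < \<delta> \<Longrightarrow> lin_indep_family Idx b'"
    using lin_indep_family_perturb[OF Idx, of "\<lambda>i. P i h"] h by blast
  have "\<exists>n \<eta>. \<eta> > 0 \<and> (\<forall>y\<in>Dinf. seminorm (DA_inf ev) n (y - h) < \<eta> \<longrightarrow> norm (P i y - P i h) < \<delta>)" if "i \<in> Idx" for i
    using P[OF that] jet_field_continuous[OF _ hD \<delta>(1)] by metis
  then obtain n \<eta> where n: "\<And>i. i \<in> Idx \<Longrightarrow> \<eta> i > (0 :: real)"
    "\<And>i y. i \<in> Idx \<Longrightarrow> y \<in> Dinf \<Longrightarrow> seminorm (DA_inf ev) (n i) (y - h) < \<eta> i \<Longrightarrow> norm (P i y - P i h) < \<delta>" by metis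
  define N where "N = Max (insert M (n ` Idx))"
  define \<epsilon> where "\<epsilon> = Min (insert e (\<eta> ` Idx))"
  have N: "M \<le> N" "\<And>i. i \<in> Idx \<Longrightarrow> n i \<le> N" using Idx by (auto simp: N_def)
  have \<epsilon>: "\<epsilon> > 0" "\<epsilon> \<le> e" "\<And>i. i \<in> Idx \<Longrightarrow> \<epsilon> \<le> \<eta> i" using Idx n(1) e(1) by (auto simp: \<epsilon>_def)
  have "y \<in> {h \<in> U. lin_indep_family Idx (\<lambda>i. P i h)}"
    if y: "y \<in> Dinf" and s: "\<forall>k\<le>N. seminorm (DA_inf ev) k (y - h) < \<epsilon>" for y
  proof
    have "y \<in> U" by (rule e(2)[OF y]) (use s N(1) \<epsilon>(2) in \<open>meson le_trans less_le_trans\<close>)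
    moreover have "lin_indep_family Idx (\<lambda>i. P i y)"
    proof (rule \<delta>(2), rule ballI)
      fix i assume i: "i \<in> Idx"
      show "norm (P i y - P i h) < \<delta>" by (rule n(2)[OF i y]) (use s N(2)[OF i] \<epsilon>(3)[OF i] in \<open>meson less_le_trans\<close>)
    qed
    ultimately show "y \<in> U \<and> lin_indep_family Idx (\<lambda>i. P i y)" ..
  qed
  with \<epsilon>(1) show "\<exists>N. \<exists>\<epsilon>>0. \<forall>y\<in>Dinf. (\<forall>n\<le>N. seminorm (DA_inf ev) n (y - h) < \<epsilon>) \<longrightarrow>
      y \<in> {h \<in> U. lin_indep_family Idx (\<lambda>i. P i h)}" by blast
qed

text \<open>The order N is the same for every k: A^k Q is smooth again because Q maps into
  D(A^\<infinity>), and its derivative sees only the jet.\<close>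

lemma directional_jet_bound:
  assumes Q: "smooth_into Q"
  shows "\<exists>C\<ge>0. \<forall>h. norm ((A ^^ k) (directional Q s (jet N h))) \<le> C * seminorm (DA_inf ev) N h"
proof -
  have "smooth_along (\<lambda>x. (A ^^ k) (Q x))" using Q by (simp add: smooth_into_def)
  from directional_bound[OF this] obtain C where C: "C \<ge> 0"
    "\<And>v. norm (directional (\<lambda>x. (A ^^ k) (Q x)) s v) \<le> C * norm v" by blast
  obtain K where K: "K \<ge> 0" "\<And>h. norm (jet N h) \<le> K * seminorm (DA_inf ev) N h" using jet_bound by blast
  have "norm ((A ^^ k) (directional Q s (jet N h))) \<le> (C * K) * seminorm (DA_inf ev) N h" for h
    using order_trans[OF C(2)[of "jet N h"] mult_left_mono[OF K(2)[of h] C(1)]]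
    by (simp add: directional_Dinf(2)[OF Q] mult.assoc)
  then show ?thesis using C(1) K(1) by (intro exI[of _ "C * K"]) auto
qed

text \<open>Differentiating \<open>drift = \<Sum> c\<^sub>i P\<^sub>i\<close> at \<open>h0\<close> in the direction \<open>h\<close> shows that \<open>A h\<close> is, up to
  an element of the finite-dimensional span of the \<open>P\<^sub>i h0\<close>, a function of a finite jet of \<open>h\<close>
  bounded in all seminorms.\<close>

lemma generator_bounded_if_drift_in_span:
  assumes V: "openin (seminorm_topology (DA_inf ev)) V" and h0: "h0 \<in> V" and Idx: "finite Idx"
    and P: "\<And>i. i \<in> Idx \<Longrightarrow> \<exists>N Q. jet_field 0 N Q (P i)"
    and ind: "lin_indep_family Idx (\<lambda>i. P i h0)"
    and drift: "\<And>h. h \<in> V \<Longrightarrow> drift ev l d \<phi> h \<in> span ((\<lambda>i. P i h) ` Idx)"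
  shows "domA ev = UNIV"
proof -
  have Vo: "seminorm_open (DA_inf ev) V" using V by (simp add: openin_seminorm_topology)
  then have hD: "h0 \<in> Dinf" using h0 by (auto simp: seminorm_open_def)
  obtain N Q where NQ: "\<And>i. i \<in> Idx \<Longrightarrow> jet_field 0 (N i) (Q i) (P i)" using P by metis
  have Qs: "smooth_into (Q i)" if "i \<in> Idx" for i using NQ[OF that] by (simp add: jet_field_def)
  obtain c where c: "drift ev l d \<phi> h0 = (\<Sum>i\<in>Idx. c i *\<^sub>R P i h0)"
    using drift[OF h0] span_finite_family[OF Idx, of "\<lambda>i. P i h0"] by auto
  define \<psi> where "\<psi> s = drift_correction (jet_coord 0 s)" for s
  have D: "jet_field 1 0 \<psi> (drift ev l d \<phi>)" using jet_field_drift by (simp add: \<psi>_def[abs_def])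
  then have \<psi>: "smooth_into \<psi>" by (simp add: jet_field_def)
  note sc = subspace_scale[OF Dinf_subspace] and ad = subspace_add[OF Dinf_subspace]
  define E where "E i h = directional (Q i) (jet (N i) h0) (jet (N i) h)" for i h
  \<comment> \<open>The derivative at \<open>h0\<close> in direction h of the drift minus the
    combination with frozen coefficients, without its term \<open>A h\<close>.\<close>
  define T where "T h = directional \<psi> (jet 0 h0) (jet 0 h) - (\<Sum>i\<in>Idx. c i *\<^sub>R E i h)" for h
  have ED: "E i h \<in> Dinf" if "i \<in> Idx" for i h unfolding E_def by (rule directional_Dinf(1)[OF Qs[OF that]])
  have sumD: "(\<Sum>i\<in>Idx. c i *\<^sub>R E i h) \<in> Dinf" for h by (intro subspace_sum[OF Dinf_subspace] sc ED)
  have TD: "T h \<in> Dinf" for h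
    unfolding T_def by (intro subspace_diff[OF Dinf_subspace] directional_Dinf(1)[OF \<psi>] sumD)
  have key: "A h + T h \<in> span ((\<lambda>i. P i h0) ` Idx)" if h: "h \<in> Dinf" for h
  proof (rule span_limit[OF Idx ind, where F = "at 0" and b = "\<lambda>s i. P i (h0 + s *\<^sub>R h)"])
    have vd: "((\<lambda>t. X (h0 + t *\<^sub>R h)) has_vector_derivative (r *\<^sub>R A h + directional W (jet M h0) (jet M h))) (at 0)"
      if X: "jet_field r M W X" for r M W X
    proof -
      have "X (h0 + t *\<^sub>R h) \<in> Dinf" for t by (intro jet_field_Dinf[OF X] ad sc hD h)
      then show ?thesis
        using jet_field_derivative[OF X hD h] by (auto simp: has_curve_derivative_Dinf dest: spec[of _ 0])
    qed
    show "((\<lambda>s. P i (h0 + s *\<^sub>R h)) \<longlongrightarrow> P i h0) (at 0)" if "i \<in> Idx" for i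
      using has_vector_derivative_continuous[OF vd[OF NQ[OF that]]] by (simp add: continuous_within)
    \<comment> \<open>Vanishes at s = 0, has derivative \<open>A h + T h\<close> there, and for
      small s lies in the span at h0 + s h because V is open.\<close>
    let ?G = "\<lambda>s. drift ev l d \<phi> (h0 + s *\<^sub>R h) - (\<Sum>i\<in>Idx. c i *\<^sub>R P i (h0 + s *\<^sub>R h))"
    have Esum: "((\<lambda>s. \<Sum>i\<in>Idx. c i *\<^sub>R P i (h0 + s *\<^sub>R h)) has_vector_derivative (\<Sum>i\<in>Idx. c i *\<^sub>R E i h)) (at 0)"
      using vd[OF NQ] unfolding E_def
      by (intro has_vector_derivative_sum bounded_linear.has_vector_derivative[OF bounded_linear_scaleR_right]) simp
    have "(?G has_vector_derivative (A h + T h)) (at 0)"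
      using has_vector_derivative_diff[OF vd[OF D] Esum] by (simp add: T_def algebra_simps)
    then show "((\<lambda>s. (1 / s) *\<^sub>R ?G s) \<longlongrightarrow> A h + T h) (at 0)"
      by (simp add: has_vector_derivative_iff_offset c)
    obtain M e where e: "e > 0" "\<And>y. y \<in> Dinf \<Longrightarrow> \<forall>n\<le>M. seminorm (DA_inf ev) n (y - h0) < e \<Longrightarrow> y \<in> V"
      using Vo h0 unfolding seminorm_open_def by blast
    have "((\<lambda>s. \<bar>s\<bar> * seminorm (DA_inf ev) M h) \<longlongrightarrow> \<bar>0\<bar> * seminorm (DA_inf ev) M h) (at 0)" by (intro tendsto_intros)
    then have "\<forall>\<^sub>F s in at 0. \<bar>s\<bar> * seminorm (DA_inf ev) M h < e" using e(1) by (intro order_tendstoD) auto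
    then show "\<forall>\<^sub>F s in at 0. (1 / s) *\<^sub>R ?G s \<in> span ((\<lambda>i. P i (h0 + s *\<^sub>R h)) ` Idx)"
    proof eventually_elim
      case (elim s)
      have "seminorm (DA_inf ev) n (h0 + s *\<^sub>R h - h0) < e" if "n \<le> M" for n
      proof -
        have "seminorm (DA_inf ev) n (s *\<^sub>R h) = \<bar>s\<bar> * seminorm (DA_inf ev) n h"
          by (simp add: seminorm_Dinf power_scaleR[OF h] sum_distrib_left)
        also have "\<dots> \<le> \<bar>s\<bar> * seminorm (DA_inf ev) M h" by (intro mult_left_mono seminorm_mono that) simp
        finally show ?thesis using elim by simp
      qed
      then have "h0 + s *\<^sub>R h \<in> V" by (intro e(2) ad sc hD h) auto
      then show ?case by (intro span_scale span_diff drift span_sum span_base) auto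
    qed
  qed simp
  \<comment> \<open>Above all jet orders, so that one seminorm controls every jet, and at least 1,
    so that it controls \<open>A h\<close> too.\<close>
  define n where "n = Max (insert 1 (N ` Idx))"
  have n: "n \<ge> 1" "\<And>i. i \<in> Idx \<Longrightarrow> N i \<le> n" using Idx by (auto simp: n_def)
  let ?p = "seminorm (DA_inf ev) n"
  have Tb: "\<exists>C\<ge>0. \<forall>h. norm ((A ^^ k) (T h)) \<le> C * ?p h" for k
  proof -
    obtain C0 where C0: "C0 \<ge> 0" "\<And>h. norm ((A ^^ k) (directional \<psi> (jet 0 h0) (jet 0 h))) \<le> C0 * seminorm (DA_inf ev) 0 h"
      using directional_jet_bound[OF \<psi>] by blast
    have "\<exists>C\<ge>0. \<forall>h. norm ((A ^^ k) (E i h)) \<le> C * seminorm (DA_inf ev) (N i) h" if "i \<in> Idx" for i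
      unfolding E_def by (rule directional_jet_bound[OF Qs[OF that]])
    then obtain C where C: "\<And>i. i \<in> Idx \<Longrightarrow> C i \<ge> 0"
      "\<And>i h. i \<in> Idx \<Longrightarrow> norm ((A ^^ k) (E i h)) \<le> C i * seminorm (DA_inf ev) (N i) h" by metis
    have "norm ((A ^^ k) (T h)) \<le> (C0 + (\<Sum>i\<in>Idx. \<bar>c i\<bar> * C i)) * ?p h" for h
    proof -
      have 1: "norm ((A ^^ k) (directional \<psi> (jet 0 h0) (jet 0 h))) \<le> C0 * ?p h"
        by (rule order_trans[OF C0(2)]) (intro mult_left_mono seminorm_mono C0(1), simp)
      have 2: "norm (\<Sum>i\<in>Idx. c i *\<^sub>R (A ^^ k) (E i h)) \<le> (\<Sum>i\<in>Idx. \<bar>c i\<bar> * (C i * ?p h))"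
      proof (rule sum_norm_le)
        fix i assume i: "i \<in> Idx"
        have "C i * seminorm (DA_inf ev) (N i) h \<le> C i * ?p h"
          by (intro mult_left_mono seminorm_mono n(2) C(1) i)
        then show "norm (c i *\<^sub>R (A ^^ k) (E i h)) \<le> \<bar>c i\<bar> * (C i * ?p h)"
          using C(2)[OF i, of h] by (simp add: mult_left_mono)
      qed
      have "(A ^^ k) (T h) = (A ^^ k) (directional \<psi> (jet 0 h0) (jet 0 h)) - (\<Sum>i\<in>Idx. c i *\<^sub>R (A ^^ k) (E i h))"
        unfolding T_def power_linear(2)[OF directional_Dinf(1)[OF \<psi>] sumD]
        by (simp add: power_sum power_scaleR ED sc)
      then have "norm ((A ^^ k) (T h)) \<le> C0 * ?p h + (\<Sum>i\<in>Idx. \<bar>c i\<bar> * (C i * ?p h))"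
        by (simp only:) (rule order_trans[OF norm_triangle_ineq4 add_mono[OF 1 2]])
      then show ?thesis by (simp add: distrib_right sum_distrib_right mult.assoc)
    qed
    moreover have "C0 + (\<Sum>i\<in>Idx. \<bar>c i\<bar> * C i) \<ge> 0" using C0(1) C(1) by (auto intro!: add_nonneg_nonneg sum_nonneg)
    ultimately show ?thesis by blast
  qed
  obtain C0 where C0: "C0 \<ge> 0" "\<And>h. norm (T h) \<le> C0 * ?p h" using Tb[of 0] by auto
  obtain Cn where Cn: "Cn \<ge> 0" "\<And>h. norm ((A ^^ n) (T h)) \<le> Cn * ?p h" using Tb[of n] by auto
  obtain K where K: "K \<ge> 0" "\<And>a. (\<Sum>i\<in>Idx. \<bar>a i\<bar>) \<le> K * norm (\<Sum>i\<in>Idx. a i *\<^sub>R P i h0)"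
    using lin_indep_family_coefficient_bound[OF Idx ind] by blast
  define B where "B = (\<Sum>i\<in>Idx. norm ((A ^^ n) (P i h0)))"
  have B: "B \<ge> 0" by (simp add: B_def sum_nonneg)
  \<comment> \<open>A^(n+1) h is A^n (A h + T h) - A^n (T h). The first vector combines the fixed
    P_i h0, with coefficients already bounded through the norm of A h + T h in
    \<open>H\<close>.\<close>
  have "norm ((A ^^ Suc n) h) \<le> (K * (1 + C0) * B + Cn) * ?p h" if h: "h \<in> Dinf" for h
  proof -
    obtain a where a: "A h + T h = (\<Sum>i\<in>Idx. a i *\<^sub>R P i h0)"
      using key[OF h] span_finite_family[OF Idx, of "\<lambda>i. P i h0"] by auto
    have PD: "P i h0 \<in> Dinf" if "i \<in> Idx" for i using jet_field_Dinf[OF NQ[OF that] hD] .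
    have "norm (A h) \<le> seminorm (DA_inf ev) 1 h" by (simp add: seminorm_Dinf)
    then have "norm (A h) \<le> ?p h" using seminorm_mono[OF n(1), of h] by linarith
    then have "norm (A h + T h) \<le> (1 + C0) * ?p h"
      using norm_triangle_ineq[of "A h" "T h"] C0(2)[of h] by (simp add: distrib_right)
    then have "K * norm (A h + T h) \<le> K * ((1 + C0) * ?p h)" using K(1) by (intro mult_left_mono)
    then have sa: "(\<Sum>i\<in>Idx. \<bar>a i\<bar>) \<le> K * ((1 + C0) * ?p h)"
      using K(2)[of a] unfolding a by linarith
    have "norm ((A ^^ n) (A h + T h)) \<le> (\<Sum>i\<in>Idx. \<bar>a i\<bar>) * B"
    proof -
      have "(A ^^ n) (A h + T h) = (\<Sum>i\<in>Idx. a i *\<^sub>R (A ^^ n) (P i h0))"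
        unfolding a by (simp add: power_sum power_scaleR PD sc)
      also have "norm \<dots> \<le> (\<Sum>i\<in>Idx. \<bar>a i\<bar> * B)"
        using Idx by (intro sum_norm_le) (auto simp: B_def intro!: mult_left_mono member_le_sum)
      finally show ?thesis by (simp add: sum_distrib_right)
    qed
    also have "\<dots> \<le> (K * ((1 + C0) * ?p h)) * B" using sa B by (rule mult_right_mono)
    finally have 1: "norm ((A ^^ n) (A h + T h)) \<le> (K * (1 + C0) * B) * ?p h" by (simp add: mult_ac)
    have "(A ^^ n) (A h) = (A ^^ n) (A h + T h) - (A ^^ n) (T h)"
      using power_linear(1)[OF generator_Dinf[OF h] TD, of n h] by simp
    then have "norm ((A ^^ n) (A h)) \<le> norm ((A ^^ n) (A h + T h)) + norm ((A ^^ n) (T h))"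
      by (simp only:) (rule norm_triangle_ineq4)
    then have "norm ((A ^^ n) (A h)) \<le> (K * (1 + C0) * B) * ?p h + Cn * ?p h" using 1 Cn(2)[of h] by linarith
    then show ?thesis by (simp add: funpow_Suc_right distrib_right del: funpow.simps)
  qed
  then show ?thesis using n(1) by (rule generator_bounded_if)
qed

end

section \<open>Constant dimension, transversality of the drift and the local basis\<close>

theorem lemma8:
  fixes ev :: "'h::{real_inner, complete_space} \<Rightarrow> real \<Rightarrow> real"
    and H0 :: "'h set"
    and d :: nat
    and l :: "'h \<Rightarrow> 'b::banach"
    and \<phi> :: "nat \<Rightarrow> 'b \<Rightarrow> 'h"
    and U :: "'h set"
    and kD :: nat
  assumes "forward_curve_space ev H0"
    and "d \<ge> 1"
    and "bounded_linear l"
    and "\<And>j. j \<in> {1..d} \<Longrightarrow>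
           smooth_map (normed_space_on (UNIV :: 'b set) norm) UNIV (DA0_inf ev H0) (\<phi> j)"
    and "open_map (seminorm_topology (DA_inf ev)) euclidean (\<lambda>h. (l h, l (opA ev h)))"
    and "\<And>y. lin_indep_family {1..d} (\<lambda>j. \<phi> j y)"
    and "domA ev \<noteq> UNIV"
    and "openin (seminorm_topology (DA_inf ev)) U"
    and "U \<noteq> {}"
    and "\<And>h. h \<in> U \<Longrightarrow> has_dimension (D_LA ev l d \<phi> h) kD"
  shows "kD > d
    \<and> (\<forall>h\<in>U. drift ev l d \<phi> h \<notin> span ((\<lambda>j. vol l \<phi> j h) ` {1..d}))
    \<and> (\<forall>h0\<in>U. \<exists>V X. openin (seminorm_topology (DA_inf ev)) V \<and> h0 \<in> V
         \<and> (\<forall>i. d + 1 \<le> i \<and> i < kD \<longrightarrow> banach_map TYPE(nat \<Rightarrow>\<^sub>C (real \<times> 'b)) (DA_inf ev) V (X i))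
         \<and> (\<forall>h\<in>V. basis_family {..<kD}
               (\<lambda>i. if i = 0 then drift ev l d \<phi> h
                    else if i \<le> d then vol l \<phi> i h
                    else X i h)
               (D_LA ev l d \<phi> h)))"
proof -
  interpret forward_curve_model ev H0 l d \<phi>
    using assms(1,3,4) by (auto simp: forward_curve_model_def forward_curve_model_axioms_def)
  note U = \<open>openin (seminorm_topology (DA_inf ev)) U\<close> and dim = \<open>\<And>h. h \<in> U \<Longrightarrow> has_dimension (D_LA ev l d \<phi> h) kD\<close>
  define F where "F = iterated_brackets (DA_inf ev) (insert (drift ev l d \<phi>) (vol l \<phi> ` {1..d}))"
  have D_LA: "D_LA ev l d \<phi> h = span ((\<lambda>X. X h) ` F)" for h by (simp add: D_LA_def F_def)
  have DF: "X h \<in> D_LA ev l d \<phi> h" if "X \<in> F" for X h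
    unfolding D_LA by (rule span_base) (use that in blast)
  have driftF: "drift ev l d \<phi> \<in> F" and volF: "\<And>j. j \<in> {1..d} \<Longrightarrow> vol l \<phi> j \<in> F"
    unfolding F_def by (auto intro: iterated_brackets.generator)
  have jets: "X = drift ev l d \<phi> \<or> (\<exists>N Q. jet_field 0 N Q X)" if "X \<in> F" for X
    using iterated_brackets_jet_field that by (simp add: F_def)
  have vol_indep: "lin_indep_family {1..d} (\<lambda>j. vol l \<phi> j h)" for h
    using assms(6)[of "l h"] by (simp add: vol_def)
  have drift_notin: "drift ev l d \<phi> h0 \<notin> span ((\<lambda>j. vol l \<phi> j h0) ` {1..d})" if h0: "h0 \<in> U" for h0
  proof
    assume drift: "drift ev l d \<phi> h0 \<in> span ((\<lambda>j. vol l \<phi> j h0) ` {1..d})"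
    \<comment> \<open>The brackets in jet form with r = 0. Under the assumption on the drift, their
      values at \<open>h0\<close> span the whole distribution there.\<close>
    define G where "G = {X \<in> F. \<exists>N Q. jet_field 0 N Q X}"
    have volG: "vol l \<phi> j \<in> G" if "j \<in> {1..d}" for j using volF jet_field_vol that by (auto simp: G_def)
    have "drift ev l d \<phi> h0 \<in> span ((\<lambda>X. X h0) ` G)"
      using drift span_mono[of "(\<lambda>j. vol l \<phi> j h0) ` {1..d}" "(\<lambda>X. X h0) ` G"] volG by blast
    moreover have "X h0 \<in> span ((\<lambda>X. X h0) ` G)" if "X \<in> G" for X
      by (rule span_base) (rule imageI[OF that])
    moreover have "X = drift ev l d \<phi> \<or> X \<in> G" if "X \<in> F" for X using jets[OF that] that by (auto simp: G_def)
    ultimately have "X h0 \<in> span ((\<lambda>X. X h0) ` G)" if "X \<in> F" for X using that by blast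
    then have "(\<lambda>X. X h0) ` F \<subseteq> span ((\<lambda>X. X h0) ` G)" by (rule image_subsetI)
    then have DG: "D_LA ev l d \<phi> h0 \<subseteq> span ((\<lambda>X. X h0) ` G)"
      unfolding D_LA by (rule span_minimal) (rule subspace_span)
    obtain B where B: "B \<subseteq> (\<lambda>X. X h0) ` G" "independent B" "(\<lambda>X. X h0) ` G \<subseteq> span B"
      using maximal_independent_subset by blast
    have "B \<subseteq> D_LA ev l d \<phi> h0" using B(1) DF by (auto simp: G_def)
    moreover have "D_LA ev l d \<phi> h0 \<subseteq> span B"
      using DG span_minimal[OF B(3) subspace_span] by blast
    ultimately have finB: "finite B" "card B = kD"
      using independent_card_dimension[OF dim[OF h0] B(2)] by blast+
    have "\<forall>v\<in>B. \<exists>X. X \<in> G \<and> X h0 = v" using B(1) by auto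
    from bchoice[OF this] obtain P where P: "\<And>v. v \<in> B \<Longrightarrow> P v \<in> G" "\<And>v. v \<in> B \<Longrightarrow> P v h0 = v" by blast
    define V where "V = {h \<in> U. lin_indep_family B (\<lambda>v. P v h)}"
    have "inj_on (\<lambda>v. P v h0) B" "(\<lambda>v. P v h0) ` B = B" using P(2) by (auto simp: inj_on_def image_iff)
    then have ind: "lin_indep_family B (\<lambda>v. P v h0)" using B(2) by (simp add: lin_indep_family_def)
    have jetP: "\<exists>N Q. jet_field 0 N Q (P v)" if "v \<in> B" for v using P(1)[OF that] by (simp add: G_def)
    have "openin (seminorm_topology (DA_inf ev)) V"
      unfolding V_def by (rule jet_fields_independent_open[OF U finB(1)]) (use jetP in blast)
    moreover have "h0 \<in> V" using h0 ind by (simp add: V_def)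
    \<comment> \<open>On V the values of the P v are kD independent members of a space of dimension
      kD and span it, so they catch the drift near \<open>h0\<close> too.\<close>
    moreover have "drift ev l d \<phi> h \<in> span ((\<lambda>v. P v h) ` B)" if h: "h \<in> V" for h
    proof -
      have "span ((\<lambda>v. P v h) ` B) = D_LA ev l d \<phi> h"
        by (rule lin_indep_family_span_dimension(2)[OF dim])
          (use h P(1) DF finB in \<open>auto simp: V_def G_def\<close>)
      then show ?thesis using DF[OF driftF] by simp
    qed
    ultimately have "domA ev = UNIV"
      using generator_bounded_if_drift_in_span[OF _ _ finB(1) jetP ind] by blast
    with assms(7) show False ..
  qed
  \<comment> \<open>d + 1 independent vectors by \<open>drift_notin\<close>, which already forces kD
    > d.\<close>
  define W where "W h = insert (drift ev l d \<phi> h) ((\<lambda>j. vol l \<phi> j h) ` {1..d})" for h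
  have W: "independent (W h)" "card (W h) = Suc d" "finite (W h)" "W h \<subseteq> (\<lambda>X. X h) ` F" if h: "h \<in> U" for h
  proof -
    have ind: "independent ((\<lambda>j. vol l \<phi> j h) ` {1..d})" and inj: "inj_on (\<lambda>j. vol l \<phi> j h) {1..d}"
      using vol_indep by (auto simp: lin_indep_family_def)
    have "drift ev l d \<phi> h \<notin> (\<lambda>j. vol l \<phi> j h) ` {1..d}" 
      using drift_notin[OF h] span_base[of "drift ev l d \<phi> h" "(\<lambda>j. vol l \<phi> j h) ` {1..d}"] by argo
    then show "card (W h) = Suc d" using card_image[OF inj] by (simp add: W_def)
    show "independent (W h)" unfolding W_def by (intro independent_insertI drift_notin h ind)
    show "W h \<subseteq> (\<lambda>X. X h) ` F" using driftF volF by (auto simp: W_def)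
  qed (simp add: W_def)
  \<comment> \<open>The basis is extended within the values of brackets, so that each new vector is
    the value of a field.\<close>
  have ext: "\<exists>B. W h \<subseteq> B \<and> B \<subseteq> (\<lambda>X. X h) ` F \<and> independent B \<and> finite B \<and> card B = kD" if h: "h \<in> U" for h
  proof -
    obtain B where B: "W h \<subseteq> B" "B \<subseteq> (\<lambda>X. X h) ` F" "independent B" "(\<lambda>X. X h) ` F \<subseteq> span B"
      using maximal_independent_subset_extend[OF W(4)[OF h] W(1)[OF h]] by blast
    have "D_LA ev l d \<phi> h \<subseteq> span B" unfolding D_LA by (rule span_minimal[OF B(4) subspace_span])
    moreover have "B \<subseteq> D_LA ev l d \<phi> h" using B(2) DF by auto
    ultimately show ?thesis using independent_card_dimension[OF dim[OF h] B(3)] B by blast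
  qed
  have kD: "kD > d"
  proof -
    obtain h where h: "h \<in> U" using \<open>U \<noteq> {}\<close> by blast
    obtain B where "W h \<subseteq> B" "finite B" "card B = kD" using ext[OF h] by blast
    then show ?thesis using card_mono[of B "W h"] W(2)[OF h] by simp
  qed
  have "\<exists>V X. openin (seminorm_topology (DA_inf ev)) V \<and> h0 \<in> V
         \<and> (\<forall>i. d + 1 \<le> i \<and> i < kD \<longrightarrow> banach_map TYPE(nat \<Rightarrow>\<^sub>C (real \<times> 'b)) (DA_inf ev) V (X i))
         \<and> (\<forall>h\<in>V. basis_family {..<kD}
               (\<lambda>i. if i = 0 then drift ev l d \<phi> h else if i \<le> d then vol l \<phi> i h else X i h)
               (D_LA ev l d \<phi> h))" if h0: "h0 \<in> U" for h0
  proof -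
    obtain B where B: "W h0 \<subseteq> B" "B \<subseteq> (\<lambda>X. X h0) ` F" "independent B" "finite B" "card B = kD"
      using ext[OF h0] by blast
    have "card (B - W h0) = card {d + 1..<kD}" using B W[OF h0] by (simp add: card_Diff_subset)
    then obtain e where e: "bij_betw e {d + 1..<kD} (B - W h0)"
      using finite_same_card_bij[of "{d + 1..<kD}" "B - W h0"] B(4) by auto
    have eB: "e i \<in> B - W h0" if "d + 1 \<le> i" "i < kD" for i using bij_betwE[OF e] that by auto
    have "\<forall>i\<in>{d + 1..<kD}. \<exists>X. X \<in> F \<and> X h0 = e i"
    proof
      fix i assume "i \<in> {d + 1..<kD}"
      then have "e i \<in> (\<lambda>X. X h0) ` F" using eB[of i] B(2) by auto
      then show "\<exists>X. X \<in> F \<and> X h0 = e i" by auto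
    qed
    from bchoice[OF this] obtain X where "\<forall>i\<in>{d + 1..<kD}. X i \<in> F \<and> X i h0 = e i" by blast
    then have X: "X i \<in> F" "X i h0 = e i" if "d + 1 \<le> i" "i < kD" for i using that by simp_all
    \<comment> \<open>The value of X i at \<open>h0\<close> lies outside \<open>W h0\<close>, so X i
      is not the drift and must be a jet field with r = 0.\<close>
    have jetX: "\<exists>N Q. jet_field 0 N Q (X i)" if i: "d + 1 \<le> i" "i < kD" for i
      using jets[OF X(1)[OF i]] X(2)[OF i] eB[OF i] by (auto simp: W_def)
    define P where "P i = (if i = 0 then drift ev l d \<phi> else if i \<le> d then vol l \<phi> i else X i)" for i :: nat
    have PF: "P i \<in> F" if "i < kD" for i using that driftF volF X(1) by (auto simp: P_def)
    have jetP: "\<exists>r N Q. jet_field r N Q (P i)" if "i < kD" for i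
      using jets[OF PF[OF that]] jet_field_drift by metis
    have split: "{..<kD} = {0} \<union> {1..d} \<union> {d + 1..<kD}" using kD by auto
    have "(\<lambda>i. P i h0) ` {0} = {drift ev l d \<phi> h0}" by (simp add: P_def)
    moreover have "(\<lambda>i. P i h0) ` {1..d} = (\<lambda>j. vol l \<phi> j h0) ` {1..d}" by (rule image_cong) (auto simp: P_def)
    moreover have "(\<lambda>i. P i h0) ` {d + 1..<kD} = e ` {d + 1..<kD}" by (rule image_cong) (auto simp: P_def X)
    ultimately have img: "(\<lambda>i. P i h0) ` {..<kD} = B"
      unfolding split image_Un using B(1) bij_betw_imp_surj_on[OF e] by (auto simp: W_def)
    then have "inj_on (\<lambda>i. P i h0) {..<kD}" by (intro eq_card_imp_inj_on) (simp_all add: B)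
    then have ind: "lin_indep_family {..<kD} (\<lambda>i. P i h0)" using img B(3) by (simp add: lin_indep_family_def)
    define V where "V = {h \<in> U. lin_indep_family {..<kD} (\<lambda>i. P i h)}"
    have V: "openin (seminorm_topology (DA_inf ev)) V"
      unfolding V_def by (rule jet_fields_independent_open[OF U]) (use jetP in auto)
    have "basis_family {..<kD} (\<lambda>i. P i h) (D_LA ev l d \<phi> h)" if h: "h \<in> V" for h
    proof -
      have hU: "h \<in> U" and li: "lin_indep_family {..<kD} (\<lambda>i. P i h)" using h by (auto simp: V_def)
      have "span ((\<lambda>i. P i h) ` {..<kD}) = D_LA ev l d \<phi> h"
      proof (rule lin_indep_family_span_dimension(2)[OF dim[OF hU] li])
        show "(\<lambda>i. P i h) ` {..<kD} \<subseteq> D_LA ev l d \<phi> h" using DF PF by (intro image_subsetI) simp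
      qed simp_all
      with li show ?thesis by (simp add: basis_family_def)
    qed
    moreover have "P i h = (if i = 0 then drift ev l d \<phi> h else if i \<le> d then vol l \<phi> i h else X i h)" for i h
      by (simp add: P_def)
    moreover have "h0 \<in> V" using h0 ind by (simp add: V_def)
    moreover have "banach_map TYPE(nat \<Rightarrow>\<^sub>C (real \<times> 'b)) (DA_inf ev) V (X i)" if "d + 1 \<le> i \<and> i < kD" for i
      using jetX[of i] that jet_field_banach_map V by blast
    ultimately show ?thesis using V by (intro exI[of _ V] exI[of _ X]) simp
  qed
  with kD drift_notin show ?thesis by blast
qed

end
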